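(* Let $\alpha\in\,]1,2[$, $s>\lceil\frac{\alpha}{\alpha-1}\rceil-\frac12$, $r>0$ and $u_0\in H^s(\mathbb T;\mathbb R)$. Let $C_s$ be the constant of the well-posedness statement recalled in the context and let $0<T<\frac{C_s}{r+\|\partial_xu_0\|_{L^\infty(\mathbb T)}}$. For $v_0\in B(u_0,r)$ let $v$ be the solution on $[0,T]$ of $$\partial_tv+v\,\partial_xv+|D|^{\alpha-1}\partial_xv=0,\qquad v(0,\cdot)=v_0.$$ Then: (i) the flow map $B(u_0,r)\to C^0([0,T],H^s(\mathbb T;\mathbb R))$, $v_0\mapsto v$, is continuous but not uniformly continuous; (ii) for all $\varepsilon>0$ the flow map $B(u_0,r)\to C^0([0,T],H^{s-1+\varepsilon}(\mathbb T;\mathbb R))$, $v_0\mapsto v$, is not $C^1$.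
   Context: $\mathbb T=\mathbb R/2\pi\mathbb Z$; $|D|^{\alpha-1}$ is the Fourier multiplier with symbol $|\xi|^{\alpha-1}$; $B(u_0,r)$ is the ball of centre $u_0$ and radius $r$ in $H^s(\mathbb T;\mathbb R)$ (data are not assumed to have zero mean). Well-posedness (known): for $\alpha\in[0,2[$, $s>2+\frac12$, $r>0$ and $u_0\in H^s(\mathbb T)$ there exists $C_s>0$ such that for $0<T<\frac{C_s}{r+\|\partial_xu_0\|_{L^\infty}}$ and every $v_0\in B(u_0,r)\subset H^s(\mathbb T)$ there is a unique $v\in C^0([0,T],H^s(\mathbb T))$ solving $\partial_tv+v\partial_xv+|D|^{\alpha-1}\partial_xv=0$, $v(0,\cdot)=v_0$. *)

theory Defs
  imports "HOL-Analysis.Analysis" "HOL-Library.Function_Algebras"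
begin

section \<open>Pointwise real vector space structure on function types\<close>

instantiation "fun" :: (type, scaleR) scaleR
begin
definition "scaleR c f = (\<lambda>x. c *\<^sub>R f x)"
instance ..
end

lemma scaleR_fun_apply [simp]: "(c *\<^sub>R f) x = c *\<^sub>R f x"
  by (simp add: scaleR_fun_def)

instance "fun" :: (type, real_vector) real_vector
  by standard (simp_all add: fun_eq_iff scaleR_add_right scaleR_add_left)

section \<open>Sobolev spaces on the circle\<close>

text \<open>
  A function on the circle \<open>\<real> / 2\<pi>\<int>\<close> is a \<open>2\<pi>\<close>-periodic function on \<open>\<real>\<close>. Only Sobolev
  exponents \<open>s > 1/2\<close> are used below. For these every class in \<open>H\<^sup>s\<close> has exactly one continuous
  representative, and the elements of \<open>H\<^sup>s\<close> are taken to be these representatives.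
  (For \<open>s \<le> 1/2\<close> the set \<open>Hs s\<close> is only a subspace of the usual Sobolev space.)
\<close>

definition fourier_coeff :: "(real \<Rightarrow> real) \<Rightarrow> int \<Rightarrow> complex" where
  "fourier_coeff u n =
     integral {0..2*pi} (\<lambda>x. of_real (u x) * cis (- (of_int n * x))) / of_real (2*pi)"

definition Hs :: "real \<Rightarrow> (real \<Rightarrow> real) set" where
  "Hs s = {u. continuous_on UNIV u \<and> (\<forall>x. u (x + 2*pi) = u x) \<and>
     (\<lambda>n. (1 + (of_int n)\<^sup>2) powr s * (cmod (fourier_coeff u n))\<^sup>2) summable_on UNIV}"

definition Hs_norm :: "real \<Rightarrow> (real \<Rightarrow> real) \<Rightarrow> real" where
  "Hs_norm s u = sqrt (\<Sum>\<^sub>\<infinity>n. (1 + (of_int n)\<^sup>2) powr s * (cmod (fourier_coeff u n))\<^sup>2)"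

text \<open>That the next constant is built from a metric is \<open>Metric_space_Hs\<close> below.\<close>

definition Hs_metric :: "real \<Rightarrow> (real \<Rightarrow> real) metric" where
  "Hs_metric s = metric (Hs s, \<lambda>u v. Hs_norm s (u - v))"

text \<open>
  The space \<open>C\<^sup>0([0,T], H\<^sup>s)\<close>. Its elements are extended by \<open>0\<close> to times outside \<open>[0,T]\<close>, so
  that they are determined by their values on \<open>[0,T]\<close> and form a vector space under the pointwise
  operations. The first argument of \<open>v\<close> is time, the second is space.
  The case distinction in the metric makes the distance nonnegative outside the carrier, as
  required by \<open>Metric_space\<close>; see \<open>Metric_space_C0_Hs\<close>.
\<close>

definition C0_Hs :: "real \<Rightarrow> real \<Rightarrow> (real \<Rightarrow> real \<Rightarrow> real) set" where
  "C0_Hs T s = {v. continuous_map (top_of_set {0..T}) (mtopology_of (Hs_metric s)) v \<and>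
     (\<forall>t. t \<notin> {0..T} \<longrightarrow> v t = 0)}"

definition C0_Hs_norm :: "real \<Rightarrow> real \<Rightarrow> (real \<Rightarrow> real \<Rightarrow> real) \<Rightarrow> real" where
  "C0_Hs_norm T s v = (SUP t\<in>{0..T}. Hs_norm s (v t))"

definition C0_Hs_metric :: "real \<Rightarrow> real \<Rightarrow> (real \<Rightarrow> real \<Rightarrow> real) metric" where
  "C0_Hs_metric T s = metric (C0_Hs T s,
     \<lambda>v w. if v \<in> C0_Hs T s \<and> w \<in> C0_Hs T s then C0_Hs_norm T s (v - w) else 0)"

subsection \<open>The two distance functions are metrics\<close>

lemma Hs_continuous: "u \<in> Hs s \<Longrightarrow> continuous_on A u"
  unfolding Hs_def using continuous_on_subset by blast

lemma Hs_summable: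
  "u \<in> Hs s \<Longrightarrow>
     (\<lambda>n. (1 + (of_int n)\<^sup>2) powr s * (cmod (fourier_coeff u n))\<^sup>2) summable_on UNIV"
  by (simp add: Hs_def)

lemma fourier_integrable:
  fixes u :: "real \<Rightarrow> real"
  assumes "continuous_on UNIV u"
  shows "(\<lambda>x. complex_of_real (u x) * cis (- (of_int n * x))) integrable_on {0..2*pi}"
  by (intro integrable_continuous_interval continuous_intros continuous_on_subset[OF assms]) auto

lemma fourier_coeff_add:
  assumes "continuous_on UNIV u" "continuous_on UNIV v"
  shows "fourier_coeff (u + v) n = fourier_coeff u n + fourier_coeff v n"
  unfolding fourier_coeff_def
  by (simp add: distrib_right integral_add[OF fourier_integrable[OF assms(1)] fourier_integrable[OF assms(2)]]
      add_divide_distrib)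

lemma fourier_coeff_scaleR: "fourier_coeff (c *\<^sub>R u) n = of_real c * fourier_coeff u n"
  unfolding fourier_coeff_def by (simp add: mult.assoc)

lemma Hs_norm_nonneg: "0 \<le> Hs_norm s u"
  unfolding Hs_norm_def by (intro real_sqrt_ge_zero infsum_nonneg) simp

lemma Hs_scaleR:
  assumes "u \<in> Hs s"
  shows "c *\<^sub>R u \<in> Hs s" "Hs_norm s (c *\<^sub>R u) = \<bar>c\<bar> * Hs_norm s u"
proof -
  let ?f = "\<lambda>n::int. (1 + (of_int n)\<^sup>2) powr s * (cmod (fourier_coeff u n))\<^sup>2"
  have eq: "(\<lambda>n::int. (1 + (of_int n)\<^sup>2) powr s * (cmod (fourier_coeff (c *\<^sub>R u) n))\<^sup>2) = (\<lambda>n. c\<^sup>2 * ?f n)"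
    by (auto simp: fourier_coeff_scaleR norm_mult power_mult_distrib)
  have "(\<lambda>n. c\<^sup>2 * ?f n) summable_on UNIV"
    by (intro summable_on_cmult_right Hs_summable assms)
  then show "c *\<^sub>R u \<in> Hs s"
    using assms unfolding Hs_def mem_Collect_eq eq
    by (auto simp: scaleR_fun_def intro!: continuous_intros)
  show "Hs_norm s (c *\<^sub>R u) = \<bar>c\<bar> * Hs_norm s u"
    unfolding Hs_norm_def eq by (simp add: infsum_cmult_right' real_sqrt_mult)
qed

lemma Hs_add:
  assumes u: "u \<in> Hs s" and v: "v \<in> Hs s"
  shows "u + v \<in> Hs s" "Hs_norm s (u + v) \<le> Hs_norm s u + Hs_norm s v"
proof -
  define W where "W = (\<lambda>u n. (1 + (real_of_int n)\<^sup>2) powr s * (cmod (fourier_coeff u n))\<^sup>2)"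
  define a where "a = (\<lambda>u n. sqrt ((1 + (real_of_int n)\<^sup>2) powr s) * cmod (fourier_coeff u n))"
  have aW: "(a u n)\<^sup>2 = W u n" for u n
    by (simp add: a_def W_def power_mult_distrib)
  have a0: "0 \<le> a u n" for u n by (simp add: a_def)
  have W0: "0 \<le> W u n" for u n by (simp add: W_def)
  have N: "Hs_norm s u = sqrt (infsum (W u) UNIV)" for u by (simp add: Hs_norm_def W_def)
  have sm: "W u summable_on UNIV" if "u \<in> Hs s" for u
    using Hs_summable[OF that] by (simp add: W_def)
  have le: "L2_set (a u) F \<le> Hs_norm s u" if "u \<in> Hs s" "finite F" for u F
    unfolding L2_set_def N aW
    by (intro real_sqrt_le_mono finite_sum_le_infsum sm that) (auto simp: W0)
  have fin: "sum (W (u + v)) F \<le> (Hs_norm s u + Hs_norm s v)\<^sup>2" if F: "finite F" for F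
  proof -
    have cu: "continuous_on UNIV u" "continuous_on UNIV v" using u v by (auto simp: Hs_continuous)
    have "L2_set (a (u + v)) F \<le> L2_set (\<lambda>n. a u n + a v n) F"
    proof (rule L2_set_mono)
      fix n
      show "a (u + v) n \<le> a u n + a v n"
        unfolding a_def fourier_coeff_add[OF cu] distrib_left[symmetric]
        by (intro mult_left_mono norm_triangle_ineq) simp
    qed (rule a0)
    also have "\<dots> \<le> L2_set (a u) F + L2_set (a v) F" by (rule L2_set_triangle_ineq)
    also have "\<dots> \<le> Hs_norm s u + Hs_norm s v"
      using le[OF u F] le[OF v F] by simp
    finally have "sqrt (sum (W (u + v)) F) \<le> Hs_norm s u + Hs_norm s v"
      unfolding L2_set_def aW .
    then show ?thesis
      using real_le_rsqrt sqrt_le_D by blast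
  qed
  have S: "W (u + v) summable_on UNIV"
    by (rule nonneg_bdd_above_summable_on) (auto intro!: bdd_aboveI2 fin simp: W0)
  show "u + v \<in> Hs s"
    using u v S unfolding Hs_def mem_Collect_eq W_def
    by (auto simp: plus_fun_def intro!: continuous_intros)
  have "infsum (W (u + v)) UNIV \<le> (Hs_norm s u + Hs_norm s v)\<^sup>2"
    by (rule infsum_le_finite_sums[OF S]) (use fin in auto)
  then show "Hs_norm s (u + v) \<le> Hs_norm s u + Hs_norm s v"
    unfolding N[of "u + v"] by (intro real_le_lsqrt add_nonneg_nonneg Hs_norm_nonneg) 
qed

lemma fourier_coeff_eq_0_imp:
  fixes u :: "real \<Rightarrow> real"
  assumes cu: "continuous_on UNIV u" and per: "\<And>x. u (x + 2*pi) = u x"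
    and zero: "\<And>n. fourier_coeff u n = 0"
  shows "u = 0"
proof -
  have ci [continuous_intros]: "continuous_on A u" for A
    using cu continuous_on_subset by blast
  define K where "K = {q :: real \<Rightarrow> complex. continuous_on {0..2*pi} q \<and>
     (\<forall>n::int. ((\<lambda>x. of_real (u x) * q x * cis (of_int n * x)) has_integral 0) {0..2*pi})}"
  have K_add: "(\<lambda>x. p x + q x) \<in> K" if "p \<in> K" "q \<in> K" for p q
  proof -
    have "((\<lambda>x. of_real (u x) * (p x + q x) * cis (of_int n * x)) has_integral 0) {0..2*pi}" for n :: int
      using has_integral_add[of "\<lambda>x. of_real (u x) * p x * cis (of_int n * x)" 0 "{0..2*pi}"
          "\<lambda>x. of_real (u x) * q x * cis (of_int n * x)" 0] that
      by (auto simp: K_def algebra_simps)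
    then show ?thesis using that by (auto simp: K_def intro!: continuous_intros)
  qed
  have K_mult: "(\<lambda>x. c * p x) \<in> K" if "p \<in> K" for p and c :: complex
  proof -
    have "((\<lambda>x. of_real (u x) * (c * p x) * cis (of_int n * x)) has_integral 0) {0..2*pi}" for n :: int
      using has_integral_mult_right[of "\<lambda>x. of_real (u x) * p x * cis (of_int n * x)" 0 "{0..2*pi}" c] that
      by (auto simp: K_def mult_ac)
    then show ?thesis using that by (auto simp: K_def intro!: continuous_intros)
  qed
  have K_cis: "(\<lambda>x. cis (of_int m * x) * p x) \<in> K" if "p \<in> K" for p and m :: int
  proof -
    have "((\<lambda>x. of_real (u x) * (cis (of_int m * x) * p x) * cis (of_int n * x)) has_integral 0) {0..2*pi}" for n :: int
    proof -
      have "((\<lambda>x. of_real (u x) * p x * cis (of_int (m + n) * x)) has_integral 0) {0..2*pi}"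
        using that unfolding K_def by blast
      moreover have "of_real (u x) * p x * cis (of_int (m + n) * x)
          = of_real (u x) * (cis (of_int m * x) * p x) * cis (of_int n * x)" for x
        by (simp add: distrib_right cis_mult[symmetric])
      ultimately show ?thesis by (simp only:)
    qed
    then show ?thesis using that by (auto simp: K_def intro!: continuous_intros)
  qed
  have K1: "(\<lambda>x. 1) \<in> K"
  proof -
    have "((\<lambda>x. of_real (u x) * 1 * cis (of_int n * x)) has_integral 0) {0..2*pi}" for n :: int
    proof -
      have "integral {0..2*pi} (\<lambda>x. complex_of_real (u x) * cis (- (of_int (-n) * x))) = 0"
        using zero[of "-n"] by (simp add: fourier_coeff_def)
      with integrable_integral[OF fourier_integrable[OF cu, of "-n"]] show ?thesis by simp
    qed
    then show ?thesis by (auto simp: K_def)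
  qed
  have K_poly: "(\<lambda>x. of_real (p (cis x)) * q x) \<in> K"
    if "real_polynomial_function p" "q \<in> K" for p :: "complex \<Rightarrow> real" and q
    using that
  proof (induction p arbitrary: q rule: real_polynomial_function.induct)
    case (linear f)
    interpret bounded_linear f by fact
    have "of_real (f (cis x)) = of_real (f 1) * complex_of_real (cos x) + of_real (f \<i>) * of_real (sin x)" for x
    proof -
      have "cis x = cos x *\<^sub>R 1 + sin x *\<^sub>R \<i>" by (simp add: complex_eq_iff)
      then have "f (cis x) = cos x * f 1 + sin x * f \<i>"
        by (metis add real_scaleR_def scaleR)
      then show ?thesis by simp
    qed
    also have "\<dots> x = ((of_real (f 1) - \<i> * of_real (f \<i>)) / 2) * cis (of_int 1 * x)
       + ((of_real (f 1) + \<i> * of_real (f \<i>)) / 2) * cis (of_int (-1) * x)" for x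
      by (simp add: complex_eq_iff field_simps)
    finally have *: "of_real (f (cis x)) * q x = ((of_real (f 1) - \<i> * of_real (f \<i>)) / 2) * (cis (of_int 1 * x) * q x)
       + ((of_real (f 1) + \<i> * of_real (f \<i>)) / 2) * (cis (of_int (-1) * x) * q x)" for x
      by (simp add: algebra_simps)
    show ?case unfolding * by (intro K_add K_mult K_cis linear.prems)
  next
    case (const c)
    show ?case by (intro K_mult const)
  next
    case (add f g)
    then show ?case using K_add[OF add.IH(1)[OF add.prems] add.IH(2)[OF add.prems]]
      by (simp add: algebra_simps)
  next
    case (mult f g)
    then show ?case using mult.IH(1)[OF mult.IH(2)[OF mult.prems]]
      by (simp add: algebra_simps)
  qed
  have int_poly: "((\<lambda>x. u x * p (cis x)) has_integral 0) {0..2*pi}"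
    if "real_polynomial_function p" for p :: "complex \<Rightarrow> real"
  proof -
    have "((\<lambda>x. of_real (u x) * (of_real (p (cis x)) * 1) * cis (of_int 0 * x)) has_integral (0::complex)) {0..2*pi}"
      using K_poly[OF that K1] unfolding K_def by blast
    from has_integral_Re[OF this] show ?thesis by simp
  qed
  have per_int: "u (x + 2 * pi * of_int k) = u x" for x and k :: int
  proof (induction k rule: int_induct[where k = 0])
    case base then show ?case by simp
  next
    case (step1 i) then show ?case using per[of "x + 2 * pi * of_int i"] by (simp add: algebra_simps)
  next
    case (step2 i) then show ?case using per[of "x + 2 * pi * of_int (i - 1)"] by (simp add: algebra_simps)
  qed
  have u_cis: "u a = u b" if "cis a = cis b" for a b
  proof -
    have "cis (a - b) = 1" using that by (simp add: cis_divide[symmetric])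
    then obtain k :: int where "a - b = of_int k * 2 * pi"
      by (metis cis.simps(1) complex_eq_iff cos_one_2pi_int one_complex.simps(1) mult.commute mult.assoc)
    then have "a = b + 2 * pi * of_int k" by (simp add: algebra_simps)
    then show ?thesis using per_int by simp
  qed
  define g where "g = (\<lambda>z. u (Arg z))"
  have g_cis: "g (cis x) = u x" for x
    unfolding g_def by (rule u_cis) (simp add: cis_Arg)
  have cg: "continuous_on (sphere 0 1) g"
  proof -
    have eq: "g z = u (Arg2pi z)" if "z \<noteq> 0" for z
      unfolding g_def
    proof (rule u_cis)
      have "z = of_real (cmod z) * cis (Arg2pi z)" by (metis Arg2pi_eq cis_conv_exp)
      then have "cis (Arg2pi z) = sgn z" using that by (metis cis_Arg rcis_def Arg2pi_eq cis_conv_exp sgn_eq nonzero_mult_div_cancel_left norm_eq_zero of_real_eq_0_iff)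
      then show "cis (Arg z) = cis (Arg2pi z)" using that by (simp add: cis_Arg)
    qed
    have "continuous (at z) g" if "z \<in> sphere 0 1" for z
    proof (cases "z \<in> \<real>\<^sub>\<le>\<^sub>0")
      case False
      have "isCont u (Arg z)" using cu by (simp add: continuous_on_eq_continuous_at)
      then show ?thesis unfolding g_def by (rule isCont_o2[OF continuous_at_Arg[OF False]])
    next
      case True
      have z0: "z \<noteq> 0" using that by auto
      with True have nz: "z \<notin> \<real>\<^sub>\<ge>\<^sub>0" 
        by (metis complex_nonneg_Reals_iff complex_nonpos_Reals_iff complex_eq_iff order_antisym zero_complex.simps)
      have "isCont u (Arg2pi z)" using cu by (simp add: continuous_on_eq_continuous_at)
      then have "isCont (\<lambda>z. u (Arg2pi z)) z" by (rule isCont_o2[OF continuous_at_Arg2pi[OF nz]])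
      moreover have "\<forall>\<^sub>F w in nhds z. u (Arg2pi w) = g w"
        using t1_space_nhds[OF z0] by eventually_elim (simp add: eq)
      ultimately show ?thesis by (simp only: isCont_cong[of "\<lambda>w. u (Arg2pi w)" g z])
    qed
    then show ?thesis by (simp add: continuous_at_imp_continuous_on)
  qed
  have bd: "compact (u ` {0..2*pi})" by (intro compact_continuous_image continuous_intros) auto
  then obtain B where B: "\<And>x. x \<in> {0..2*pi} \<Longrightarrow> \<bar>u x\<bar> \<le> B"
    by (metis bounded_iff compact_imp_bounded image_eqI real_norm_def)
  have B0: "0 \<le> B" using B[of 0] by simp
  have iu: "(\<lambda>x. (u x)\<^sup>2) integrable_on {0..2*pi}"
    by (intro integrable_continuous_interval continuous_intros)
  have small: "integral {0..2*pi} (\<lambda>x. (u x)\<^sup>2) \<le> 2 * pi * B * e" if e: "e > 0" for e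
  proof -
    obtain p where p: "real_polynomial_function p" "\<And>z. z \<in> sphere 0 1 \<Longrightarrow> \<bar>g z - p z\<bar> < e"
      using Stone_Weierstrass_real_polynomial_function[OF compact_sphere cg e] by metis
    have p': "\<bar>u x - p (cis x)\<bar> < e" for x using p(2)[of "cis x"] by (simp add: g_cis)
    have "((\<lambda>x. (u x)\<^sup>2 - u x * p (cis x)) has_integral (integral {0..2*pi} (\<lambda>x. (u x)\<^sup>2) - 0)) {0..2*pi}"
      by (intro has_integral_diff int_poly p integrable_integral iu)
    moreover have "((\<lambda>x. B * e) has_integral (2*pi - 0) *\<^sub>R (B * e)) {0..2*pi}"
      using has_integral_const_real[of "B * e" 0 "2*pi"] by simp
    moreover have "(u x)\<^sup>2 - u x * p (cis x) \<le> B * e" if "x \<in> {0..2*pi}" for x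
    proof -
      have "(u x)\<^sup>2 - u x * p (cis x) = u x * (u x - p (cis x))" by (simp add: power2_eq_square algebra_simps)
      also have "\<dots> \<le> \<bar>u x\<bar> * \<bar>u x - p (cis x)\<bar>" by (metis abs_ge_self abs_mult)
      also have "\<dots> \<le> B * e" using B[OF that] p'[of x] B0 by (intro mult_mono) auto
      finally show ?thesis .
    qed
    ultimately have "integral {0..2*pi} (\<lambda>x. (u x)\<^sup>2) - 0 \<le> (2*pi - 0) *\<^sub>R (B * e)"
      by (rule has_integral_le)
    then show ?thesis by simp
  qed
  have int0: "integral {0..2*pi} (\<lambda>x. (u x)\<^sup>2) = 0"
  proof (rule antisym)
    have "integral {0..2*pi} (\<lambda>x. (u x)\<^sup>2) \<le> 0 + e" if e: "e > 0" for e
    proof -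
      define b where "b = 2 * pi * B"
      have b: "0 \<le> b" using B0 by (simp add: b_def)
      have "integral {0..2*pi} (\<lambda>x. (u x)\<^sup>2) \<le> b * (e / (b + 1))"
        using small[of "e / (b + 1)"] b e by (simp flip: b_def)
      also have "b * (e / (b + 1)) = e * (b / (b + 1))" by simp
      also have "\<dots> \<le> e * 1"
        using b e by (intro mult_left_mono) simp_all
      finally show ?thesis by simp
    qed
    then show "integral {0..2*pi} (\<lambda>x. (u x)\<^sup>2) \<le> 0" by (rule field_le_epsilon)
  qed (simp add: integral_nonneg iu)
  have z: "u x = 0" if "x \<in> {0..2*pi}" for x
  proof -
    have "continuous_on {0..2*pi} (\<lambda>x. (u x)\<^sup>2)" by (intro continuous_intros)
    from integral_eq_0_iff[OF this] int0 that show ?thesis by simp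
  qed
  have "u x = 0" for x
  proof -
    have "u x = u (Arg2pi (cis x))"
      by (rule u_cis) (metis Arg2pi_eq cis_conv_exp mult_1 norm_cis of_real_1)
    also have "\<dots> = 0" using Arg2pi[of "cis x"] by (intro z) auto
    finally show ?thesis .
  qed
  then show ?thesis by (simp add: fun_eq_iff)
qed

lemma Hs_norm_eq_0_iff:
  assumes "u \<in> Hs s"
  shows "Hs_norm s u = 0 \<longleftrightarrow> u = 0"
proof
  assume "Hs_norm s u = 0"
  then have "(\<Sum>\<^sub>\<infinity>n. (1 + (of_int n)\<^sup>2) powr s * (cmod (fourier_coeff u n))\<^sup>2) = 0"
    by (simp add: Hs_norm_def)
  then have "(1 + (of_int n)\<^sup>2) powr s * (cmod (fourier_coeff u n))\<^sup>2 = 0" for n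
    by (rule nonneg_infsum_le_0D[OF eq_refl]) (auto intro: Hs_summable assms)
  moreover have "1 + (real_of_int n)\<^sup>2 \<noteq> 0" for n
    by (metis add_pos_nonneg less_numeral_extra(1,3) zero_le_power2)
  ultimately have "fourier_coeff u n = 0" for n by simp
  then show "u = 0" using assms by (intro fourier_coeff_eq_0_imp) (auto simp: Hs_def)
qed (simp add: Hs_norm_def fourier_coeff_def)

lemma Hs_diff:
  assumes "u \<in> Hs s" "v \<in> Hs s"
  shows "u - v \<in> Hs s"
  using Hs_add(1)[OF assms(1) Hs_scaleR(1)[OF assms(2), of "-1"]] by simp

lemma Hs_norm_minus_commute: "Hs_norm s (u - v) = Hs_norm s (v - u)"
proof -
  have "fourier_coeff (u - v) n = - fourier_coeff (v - u) n" for n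
    using fourier_coeff_scaleR[of "-1" "v - u" n] by simp
  then show ?thesis by (simp add: Hs_norm_def)
qed

lemma Hs_norm_triangle:
  assumes "u \<in> Hs s" "v \<in> Hs s" "w \<in> Hs s"
  shows "Hs_norm s (u - w) \<le> Hs_norm s (u - v) + Hs_norm s (v - w)"
  using Hs_add(2)[OF Hs_diff[OF assms(1,2)] Hs_diff[OF assms(2,3)]] by simp

lemma Metric_space_Hs: "Metric_space (Hs s) (\<lambda>u v. Hs_norm s (u - v))"
proof
  fix u v w
  assume "u \<in> Hs s" "v \<in> Hs s"
  then show "Hs_norm s (u - v) = 0 \<longleftrightarrow> u = v"
    by (simp add: Hs_norm_eq_0_iff Hs_diff)
  assume "w \<in> Hs s"
  then show "Hs_norm s (u - w) \<le> Hs_norm s (u - v) + Hs_norm s (v - w)"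
    using Hs_norm_triangle \<open>u \<in> Hs s\<close> \<open>v \<in> Hs s\<close> by blast
qed (use Hs_norm_nonneg Hs_norm_minus_commute in blast)+

interpretation Hs: Metric_space "Hs s" "\<lambda>u v. Hs_norm s (u - v)" for s
  by (rule Metric_space_Hs)

lemma C0_Hs_in_Hs: "v \<in> C0_Hs T s \<Longrightarrow> t \<in> {0..T} \<Longrightarrow> v t \<in> Hs s"
  by (auto simp: C0_Hs_def Hs_metric_def continuous_map_def)

lemma C0_Hs_bdd_above:
  assumes v: "v \<in> C0_Hs T s"
  shows "bdd_above ((\<lambda>t. Hs_norm s (v t)) ` {0..T})"
proof -
  have "continuous_map (top_of_set {0..T}) (Hs.mtopology s) v"
    using v by (simp add: C0_Hs_def Hs_metric_def)
  then have "compactin (Hs.mtopology s) (v ` {0..T})"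
    by (rule image_compactin[rotated]) (simp add: compactin_subtopology)
  then have "Hs.mbounded s (v ` {0..T})"
    by (rule Hs.compactin_imp_mbounded)
  then obtain c B where cB: "v ` {0..T} \<subseteq> Hs.mcball s c B"
    unfolding Hs.mbounded_def by blast
  have "Hs_norm s (v t) \<le> Hs_norm s c + B" if t: "t \<in> {0..T}" for t
  proof -
    have c: "c \<in> Hs s" and le: "Hs_norm s (c - v t) \<le> B"
      using cB t by (auto simp: image_subset_iff)
    have "v t = c + (v t - c)" by simp
    then have "Hs_norm s (v t) \<le> Hs_norm s c + Hs_norm s (v t - c)"
      using Hs_add(2)[OF c Hs_diff[OF C0_Hs_in_Hs[OF v t] c]] by metis
    then show ?thesis using le Hs_norm_minus_commute[of s "v t" c] by linarith
  qed
  then show ?thesis by (intro bdd_aboveI2)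
qed

lemma Metric_space_C0_Hs:
  assumes T: "0 \<le> T"
  shows "Metric_space (C0_Hs T s)
    (\<lambda>v w. if v \<in> C0_Hs T s \<and> w \<in> C0_Hs T s then C0_Hs_norm T s (v - w) else 0)"
proof -
  have bdd: "bdd_above ((\<lambda>t. Hs_norm s (v t - w t)) ` {0..T})"
    if vw: "v \<in> C0_Hs T s" "w \<in> C0_Hs T s" for v w
  proof -
    obtain B B' where "\<And>t. t \<in> {0..T} \<Longrightarrow> Hs_norm s (v t) \<le> B"
        "\<And>t. t \<in> {0..T} \<Longrightarrow> Hs_norm s (w t) \<le> B'"
      using C0_Hs_bdd_above[OF vw(1)] C0_Hs_bdd_above[OF vw(2)] unfolding bdd_above_def by blast
    moreover have "Hs_norm s (v t - w t) \<le> Hs_norm s (v t) + Hs_norm s (w t)" if "t \<in> {0..T}" for t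
      using C0_Hs_in_Hs[OF vw(1) that] C0_Hs_in_Hs[OF vw(2) that]
        Hs_add(2)[of "v t" s "- w t"] Hs_scaleR[of "w t" s "-1"] by simp
    ultimately show ?thesis by (intro bdd_aboveI2[of _ _ "B + B'"]) force
  qed
  have le: "Hs_norm s (v t - w t) \<le> C0_Hs_norm T s (v - w)"
    if "v \<in> C0_Hs T s" "w \<in> C0_Hs T s" "t \<in> {0..T}" for v w t
    unfolding C0_Hs_norm_def using cSUP_upper[OF that(3) bdd[OF that(1,2)]] by simp
  have leI: "C0_Hs_norm T s (v - w) \<le> B"
    if "\<And>t. t \<in> {0..T} \<Longrightarrow> Hs_norm s (v t - w t) \<le> B" for v w B
    unfolding C0_Hs_norm_def by (rule cSUP_least) (use that T in auto)
  have nonneg: "0 \<le> C0_Hs_norm T s (v - w)" if "v \<in> C0_Hs T s" "w \<in> C0_Hs T s" for v w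
    using order_trans[OF Hs_norm_nonneg le[OF that, of 0]] T by simp
  show ?thesis
  proof
    fix v w
    show "0 \<le> (if v \<in> C0_Hs T s \<and> w \<in> C0_Hs T s then C0_Hs_norm T s (v - w) else 0)"
      by (simp add: nonneg)
    show "(if v \<in> C0_Hs T s \<and> w \<in> C0_Hs T s then C0_Hs_norm T s (v - w) else 0) =
       (if w \<in> C0_Hs T s \<and> v \<in> C0_Hs T s then C0_Hs_norm T s (w - v) else 0)"
      by (simp add: C0_Hs_norm_def Hs_norm_minus_commute)
  next
    fix v w assume vw: "v \<in> C0_Hs T s" "w \<in> C0_Hs T s"
    show "(if v \<in> C0_Hs T s \<and> w \<in> C0_Hs T s then C0_Hs_norm T s (v - w) else 0) = 0 \<longleftrightarrow> v = w"
    proof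
      assume "(if v \<in> C0_Hs T s \<and> w \<in> C0_Hs T s then C0_Hs_norm T s (v - w) else 0) = 0"
      then have 0: "C0_Hs_norm T s (v - w) = 0" using vw by simp
      show "v = w"
      proof
        fix t
        show "v t = w t"
        proof (cases "t \<in> {0..T}")
          case True
          then have "Hs_norm s (v t - w t) = 0"
            using le[OF vw True] 0 Hs_norm_nonneg[of s "v t - w t"] by simp
          then show ?thesis
            using C0_Hs_in_Hs[OF vw(1) True] C0_Hs_in_Hs[OF vw(2) True] Hs.zero by blast
        next
          case False
          then show ?thesis using vw by (simp add: C0_Hs_def)
        qed
      qed
    next
      assume "v = w"
      have "C0_Hs_norm T s (v - v) \<le> 0"
        by (rule leI) (simp add: Hs_norm_def fourier_coeff_def)
      then show "(if v \<in> C0_Hs T s \<and> w \<in> C0_Hs T s then C0_Hs_norm T s (v - w) else 0) = 0"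
        using \<open>v = w\<close> nonneg[of v v] vw by simp
    qed
  next
    fix v w z assume *: "v \<in> C0_Hs T s" "w \<in> C0_Hs T s" "z \<in> C0_Hs T s"
    have "C0_Hs_norm T s (v - z) \<le> C0_Hs_norm T s (v - w) + C0_Hs_norm T s (w - z)"
    proof (rule leI)
      fix t assume t: "t \<in> {0..T}"
      show "Hs_norm s (v t - z t) \<le> C0_Hs_norm T s (v - w) + C0_Hs_norm T s (w - z)"
        using Hs_norm_triangle[of "v t" s "w t" "z t"] C0_Hs_in_Hs[OF _ t] *
          le[OF *(1,2) t] le[OF *(2,3) t] by fastforce
    qed
    then show "(if v \<in> C0_Hs T s \<and> z \<in> C0_Hs T s then C0_Hs_norm T s (v - z) else 0) \<le>
      (if v \<in> C0_Hs T s \<and> w \<in> C0_Hs T s then C0_Hs_norm T s (v - w) else 0) +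
      (if w \<in> C0_Hs T s \<and> z \<in> C0_Hs T s then C0_Hs_norm T s (w - z) else 0)"
      using * by simp
  qed
qed

section \<open>The dispersive Burgers equation and its flow\<close>

text \<open>
  The Fourier multiplier with symbol \<open>\<bar>\<xi>\<bar>\<^sup>\<beta>\<close>, for \<open>\<beta> > 0\<close>. The series is real since its
  symbol is even.
\<close>

definition abs_D_powr :: "real \<Rightarrow> (real \<Rightarrow> real) \<Rightarrow> real \<Rightarrow> real" where
  "abs_D_powr \<beta> w x =
     Re (\<Sum>\<^sub>\<infinity>n. of_real (\<bar>of_int n\<bar> powr \<beta>) * fourier_coeff w n * cis (of_int n * x))"

text \<open>
  For \<open>\<alpha> < 2\<close> and \<open>s > 5/2\<close> all terms of the equation are continuous in \<open>(t,x)\<close> for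
  \<open>v \<in> C\<^sup>0([0,T], H\<^sup>s)\<close> (the series above converges absolutely), so the equation holds in the
  sense of distributions iff it holds pointwise, with one-sided time derivatives at \<open>0\<close> and \<open>T\<close>.
\<close>

definition is_solution ::
  "real \<Rightarrow> real \<Rightarrow> real \<Rightarrow> (real \<Rightarrow> real) \<Rightarrow> (real \<Rightarrow> real \<Rightarrow> real) \<Rightarrow> bool" where
  "is_solution \<alpha> s T v0 v \<longleftrightarrow> v \<in> C0_Hs T s \<and> v 0 = v0 \<and>
     (\<forall>t\<in>{0..T}. \<forall>x. \<exists>dtv. ((\<lambda>\<tau>. v \<tau> x) has_real_derivative dtv) (at t within {0..T}) \<and>
        dtv + v t x * deriv (v t) x + abs_D_powr (\<alpha> - 1) (deriv (v t)) x = 0)"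

definition flow :: "real \<Rightarrow> real \<Rightarrow> real \<Rightarrow> (real \<Rightarrow> real) \<Rightarrow> real \<Rightarrow> real \<Rightarrow> real" where
  "flow \<alpha> s T v0 = (THE v. is_solution \<alpha> s T v0 v)"

text \<open>Used for continuous functions only, where the supremum is the \<open>L\<^sup>\<infinity>\<close> norm.\<close>

definition Linf_norm :: "(real \<Rightarrow> real) \<Rightarrow> real" where
  "Linf_norm w = (SUP x. \<bar>w x\<bar>)"

text \<open>\<open>C\<close> is a constant as provided by the well-posedness theorem for the data \<open>\<alpha>, s, r, u0\<close>.\<close>

definition well_posedness_constant ::
  "real \<Rightarrow> real \<Rightarrow> real \<Rightarrow> (real \<Rightarrow> real) \<Rightarrow> real \<Rightarrow> bool" where
  "well_posedness_constant \<alpha> s r u0 C \<longleftrightarrow> C > 0 \<and>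
     (\<forall>T. 0 < T \<and> T < C / (r + Linf_norm (deriv u0)) \<longrightarrow>
        (\<forall>v0\<in>mball_of (Hs_metric s) u0 r. \<exists>!v. is_solution \<alpha> s T v0 v))"

section \<open>Maps of class C1 between normed function spaces\<close>

text \<open>
  The library has Frechet derivatives only between normed types. Here a normed space is a
  subspace \<open>E\<close> of a real vector space together with a function \<open>N\<close> whose restriction to \<open>E\<close>
  is a norm.
\<close>

definition bounded_linear_between ::
  "'a::real_vector set \<Rightarrow> ('a \<Rightarrow> real) \<Rightarrow> 'b::real_vector set \<Rightarrow> ('b \<Rightarrow> real) \<Rightarrow> ('a \<Rightarrow> 'b) \<Rightarrow> bool" where
  "bounded_linear_between E N F M A \<longleftrightarrow> A \<in> E \<rightarrow> F \<and>
     (\<forall>h\<in>E. \<forall>k\<in>E. A (h + k) = A h + A k) \<and>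
     (\<forall>c. \<forall>h\<in>E. A (c *\<^sub>R h) = c *\<^sub>R A h) \<and>
     (\<exists>K. \<forall>h\<in>E. M (A h) \<le> K * N h)"

text \<open>
  \<open>U\<close> is meant to be an open subset of \<open>E\<close>; \<open>Df u\<close> is the derivative of \<open>f\<close> at \<open>u\<close>. The last
  conjunct is continuity of \<open>Df\<close> for the operator norm.
\<close>

definition C1_map_between ::
  "'a::real_vector set \<Rightarrow> ('a \<Rightarrow> real) \<Rightarrow> 'b::real_vector set \<Rightarrow> ('b \<Rightarrow> real) \<Rightarrow>
   'a set \<Rightarrow> ('a \<Rightarrow> 'b) \<Rightarrow> bool" where
  "C1_map_between E N F M U f \<longleftrightarrow> f \<in> U \<rightarrow> F \<and>
     (\<exists>Df. (\<forall>u\<in>U. bounded_linear_between E N F M (Df u)) \<and>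
        (\<forall>u\<in>U. \<forall>e>0. \<exists>d>0. \<forall>w\<in>U. N (w - u) < d \<longrightarrow>
           M (f w - f u - Df u (w - u)) \<le> e * N (w - u)) \<and>
        (\<forall>u\<in>U. \<forall>e>0. \<exists>d>0. \<forall>w\<in>U. N (w - u) < d \<longrightarrow>
           (\<forall>h\<in>E. M (Df w h - Df u h) \<le> e * N h)))"

end

theory Submission
  imports Defs
begin

text \<open>
  Galilean invariance: if \<open>v\<close> solves the equation, then so does \<open>v (t, x - c t) + c\<close>. Hence adding a
  small constant \<open>c\<close> to the datum translates the solution at time \<open>T\<close> by \<open>c T\<close>. If the flow were
  uniformly continuous in \<open>H\<^sup>s\<close>, the solutions at time \<open>T\<close> would be equicontinuous under translations
  in \<open>H\<^sup>s\<close>, that is, have uniformly small Fourier tails. If it were \<open>C\<^sup>1\<close> into \<open>H\<^bsup>s-1+\<epsilon>\<^esup>\<close>, its derivative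
  in the direction of the constants, which contains \<open>- T \<partial>\<^sub>x v\<close>, would be locally bounded there, so
  the solutions near \<open>u\<^sub>0\<close> would be bounded in \<open>H\<^bsup>s+\<epsilon>\<^esup>\<close>; again the tails would be uniformly small. Apply
  this to the data \<open>u\<^sub>0 + \<eta> \<langle>N\<rangle>\<^bsup>-s\<^esup> cos (N x)\<close>. They converge to \<open>u\<^sub>0\<close> in \<open>L\<^sup>2\<close>, so by \<open>L\<^sup>2\<close> stability and the
  small tails their solutions at time \<open>T\<close> converge in \<open>H\<^sup>s\<close>. Since the equation is reversible in time and the
  flow is continuous in \<open>H\<^sup>s\<close>, the data would converge in \<open>H\<^sup>s\<close>, which they do not.

  Continuity in \<open>H\<^sup>s\<close> follows from energy estimates for the Fourier coefficients with slowly varying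
  weights. The dispersive term is skew and drops out, so only \<open>s > 5/2\<close> matters. Weights that
  are small at low frequencies, with constants uniform in the cut-off, propagate the smallness of the tails.
\<close>

section \<open>Weighted sequences indexed by the integers\<close>

text \<open>The boost by c changes the datum by |c| in every H^s, while the phase n c T that it
  produces is unbounded in n. The difficulty is to know that the solutions at time T really carry
  high frequencies, without computing them; this is why stability in H^s comes first and is then
  applied backwards.

  Stability has two obstacles. The H^s energy of a difference of two solutions loses a derivative,
  so differences are estimated in L^2 only, and at high frequencies the two solutions are estimated
  separately. Moreover, the energy estimate of a nearby solution b has a Wiener norm of b in its
  exponent, and well-posedness gives no bound on it that is uniform in b; a bootstrap supplies one.

  The time derivative of the H^s energy is a series with no absolutely summable majorant at hand.
  Hence the estimates are proved for bounded weights, then extended by truncation, and uniform tails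
  replace differentiation of an infinite sum.

  The threshold 5/2 is where H^s embeds into the sequences with summable (1 + n^2) |a_n|, which also
  controls the dispersive symbol of order \<alpha> < 2.\<close>

lemma dominated_summable:
  fixes f :: "'a \<Rightarrow> 'b::banach"
  assumes "g summable_on A" "\<And>x. x \<in> A \<Longrightarrow> norm (f x) \<le> g x"
  shows "f summable_on A" "(\<lambda>x. norm (f x)) summable_on A" "norm (infsum f A) \<le> infsum g A"
proof -
  show *: "(\<lambda>x. norm (f x)) summable_on A"
    by (rule Infinite_Sum.abs_summable_on_comparison_test'[OF assms])
  then show "f summable_on A" by (rule abs_summable_summable)
  have "norm (infsum f A) \<le> infsum (\<lambda>x. norm (f x)) A"
    by (rule norm_infsum_bound) (rule *)
  also have "\<dots> \<le> infsum g A" by (rule infsum_mono[OF * assms(1)]) (rule assms(2))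
  finally show "norm (infsum f A) \<le> infsum g A" .
qed

lemma Cauchy_Schwarz_infsum:
  fixes x y :: "'a \<Rightarrow> real"
  assumes x: "(\<lambda>n. (x n)\<^sup>2) summable_on A" and y: "(\<lambda>n. (y n)\<^sup>2) summable_on A"
  shows "(\<lambda>n. \<bar>x n * y n\<bar>) summable_on A"
    and "(\<Sum>\<^sub>\<infinity>n\<in>A. \<bar>x n * y n\<bar>) \<le> sqrt (\<Sum>\<^sub>\<infinity>n\<in>A. (x n)\<^sup>2) * sqrt (\<Sum>\<^sub>\<infinity>n\<in>A. (y n)\<^sup>2)"
proof -
  have "(\<lambda>n. (x n)\<^sup>2 + (y n)\<^sup>2) summable_on A" by (intro summable_on_add x y)
  then show S: "(\<lambda>n. \<bar>x n * y n\<bar>) summable_on A"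
  proof (rule summable_on_comparison_test)
    fix n
    have "0 \<le> (\<bar>x n\<bar> - \<bar>y n\<bar>)\<^sup>2" "0 \<le> \<bar>x n\<bar> * \<bar>y n\<bar>" by simp_all
    then show "\<bar>x n * y n\<bar> \<le> (x n)\<^sup>2 + (y n)\<^sup>2"
      unfolding power2_diff abs_mult power2_abs by linarith
  qed simp
  show "(\<Sum>\<^sub>\<infinity>n\<in>A. \<bar>x n * y n\<bar>) \<le> sqrt (\<Sum>\<^sub>\<infinity>n\<in>A. (x n)\<^sup>2) * sqrt (\<Sum>\<^sub>\<infinity>n\<in>A. (y n)\<^sup>2)"
  proof (rule infsum_le_finite_sums[OF S])
    fix F assume F: "finite F" "F \<subseteq> A"
    have "(\<Sum>n\<in>F. \<bar>x n * y n\<bar>) \<le> L2_set x F * L2_set y F"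
      using L2_set_mult_ineq[of x y F] by (simp add: abs_mult)
    also have "\<dots> \<le> sqrt (\<Sum>\<^sub>\<infinity>n\<in>A. (x n)\<^sup>2) * sqrt (\<Sum>\<^sub>\<infinity>n\<in>A. (y n)\<^sup>2)"
      unfolding L2_set_def
      by (intro mult_mono real_sqrt_le_mono finite_sum_le_infsum x y F)
        (auto intro!: sum_nonneg infsum_nonneg)
    finally show "(\<Sum>n\<in>F. \<bar>x n * y n\<bar>) \<le> \<dots>" .
  qed
qed

lemma summable_tail_less:
  fixes f :: "'a \<Rightarrow> real"
  assumes "f summable_on UNIV" "e > 0"
  obtains F where "finite F" "\<bar>\<Sum>\<^sub>\<infinity>n\<in>-F. f n\<bar> < e"
proof -
  from infsum_finite_approximation[OF assms] obtain F where
    F: "finite F" "dist (sum f F) (infsum f UNIV) \<le> e / 2"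
    by (metis assms half_gt_zero infsum_finite_approximation)
  have "infsum f UNIV = infsum f F + infsum f (-F)"
    using infsum_Un_disjoint[of f F "-F"] assms(1) F(1)
    by (simp add: summable_on_subset_banach[OF assms(1)])
  with F have "\<bar>infsum f (-F)\<bar> \<le> e / 2" by (simp add: dist_real_def)
  then show ?thesis using that[OF F(1)] assms(2) by simp
qed

text \<open>Young's inequality for one summable and two square summable factors. For fixed k the
  inner sum is bounded by the inequality of the means, since l -> - k - l permutes the integers.
  When \<open>y = z\<close>, as in the energy bounds, the mean of the two squared norms is the
  squared norm.\<close>

lemma trilinear_summable:
  fixes x y z :: "int \<Rightarrow> real"
  assumes x: "x summable_on UNIV" "\<And>n. 0 \<le> x n"
    and y: "(\<lambda>n. (y n)\<^sup>2) summable_on UNIV" "\<And>n. 0 \<le> y n"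
    and z: "(\<lambda>n. (z n)\<^sup>2) summable_on UNIV" "\<And>n. 0 \<le> z n"
  shows "(\<lambda>(k, l). x k * (y l * z (- k - l))) summable_on UNIV"
    and "(\<Sum>\<^sub>\<infinity>(k, l). x k * (y l * z (- k - l)))
           \<le> infsum x UNIV * (((\<Sum>\<^sub>\<infinity>n. (y n)\<^sup>2) + (\<Sum>\<^sub>\<infinity>n. (z n)\<^sup>2)) / 2)"
proof -
  define C where "C = ((\<Sum>\<^sub>\<infinity>n. (y n)\<^sup>2) + (\<Sum>\<^sub>\<infinity>n. (z n)\<^sup>2)) / 2"
  define I where "I k = (\<Sum>\<^sub>\<infinity>l. y l * z (- k - l))" for k
  have inner: "(\<lambda>l. y l * z (- k - l)) summable_on UNIV \<and> I k \<le> C" for k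
  proof -
    have bij: "bij_betw (\<lambda>l. - k - l) UNIV (UNIV :: int set)"
      by (rule bij_betwI[of _ _ _ "\<lambda>l. - k - l"]) auto
    have zk: "(\<lambda>l. (z (- k - l))\<^sup>2) summable_on UNIV" "(\<Sum>\<^sub>\<infinity>l. (z (- k - l))\<^sup>2) = (\<Sum>\<^sub>\<infinity>n. (z n)\<^sup>2)"
      using z(1) summable_on_reindex_bij_betw[OF bij, of "\<lambda>n. (z n)\<^sup>2"]
        infsum_reindex_bij_betw[OF bij, of "\<lambda>n. (z n)\<^sup>2"] by simp_all
    have sm: "(\<lambda>l. ((y l)\<^sup>2 + (z (- k - l))\<^sup>2) * (1/2)) summable_on UNIV"
      by (intro summable_on_cmult_left summable_on_add y zk)
    have le: "y l * z (- k - l) \<le> ((y l)\<^sup>2 + (z (- k - l))\<^sup>2) * (1/2)" for l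
      using zero_le_power2[of "y l - z (- k - l)"] unfolding power2_diff by simp
    have S: "(\<lambda>l. y l * z (- k - l)) summable_on UNIV"
      by (rule summable_on_comparison_test[OF sm le]) (simp add: y z)
    have "I k \<le> (\<Sum>\<^sub>\<infinity>l. ((y l)\<^sup>2 + (z (- k - l))\<^sup>2) * (1/2))"
      unfolding I_def by (rule infsum_mono[OF S sm]) (use le in auto)
    also have "\<dots> = C"
      by (simp only: infsum_cmult_left' infsum_add[OF y(1) zk(1)] zk(2) C_def)
    finally show ?thesis using S by simp
  qed
  have I0: "0 \<le> I k" for k unfolding I_def by (intro infsum_nonneg mult_nonneg_nonneg y z)
  have C0: "0 \<le> C" using inner[of 0] I0[of 0] by simp
  have xC: "(\<lambda>k. x k * C) summable_on UNIV" by (intro summable_on_cmult_left x)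
  have le: "x k * I k \<le> x k * C" for k using inner x(2) by (intro mult_left_mono) auto
  have xI: "(\<lambda>k. x k * I k) summable_on UNIV"
    by (rule summable_on_comparison_test[OF xC le]) (simp add: x I0)
  have "(\<lambda>(k, l). x k * (y l * z (- k - l))) summable_on (UNIV \<times> UNIV)"
  proof (rule summable_on_SigmaI)
    fix k :: int
    have "((\<lambda>l. x k * (y l * z (- k - l))) has_sum x k * I k) UNIV"
      unfolding I_def using inner by (intro has_sum_cmult_right has_sum_infsum) auto
    then show "((\<lambda>l. case (k, l) of (k, l) \<Rightarrow> x k * (y l * z (- k - l))) has_sum x k * I k) UNIV"
      by simp
  qed (use xI x y z in auto)
  then show S: "(\<lambda>(k, l). x k * (y l * z (- k - l))) summable_on UNIV" by simp
  have "(\<Sum>\<^sub>\<infinity>(k, l). x k * (y l * z (- k - l))) = (\<Sum>\<^sub>\<infinity>k. x k * I k)"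
    using infsum_Sigma_banach[of "\<lambda>(k, l). x k * (y l * z (- k - l))" UNIV "\<lambda>_. UNIV"] S
    by (simp add: infsum_cmult_right' I_def)
  also have "\<dots> \<le> (\<Sum>\<^sub>\<infinity>k. x k * C)" by (rule infsum_mono[OF xI xC le])
  finally show "(\<Sum>\<^sub>\<infinity>(k, l). x k * (y l * z (- k - l)))
           \<le> infsum x UNIV * (((\<Sum>\<^sub>\<infinity>n. (y n)\<^sup>2) + (\<Sum>\<^sub>\<infinity>n. (z n)\<^sup>2)) / 2)"
    by (simp only: infsum_cmult_left' C_def)
qed

text \<open>A pair (k, l) stands for the triple (k, l, - k - l) of frequencies with sum zero; this
  is the cyclic shift of that triple.\<close>

definition rot :: "int \<times> int \<Rightarrow> int \<times> int" where
  "rot = (\<lambda>(k, l). (l, - k - l))"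

lemma infsum_rot:
  fixes f :: "int \<times> int \<Rightarrow> real"
  assumes "f summable_on UNIV"
  shows "(\<lambda>x. f (rot x)) summable_on UNIV" "infsum (\<lambda>x. f (rot x)) UNIV = infsum f UNIV"
proof -
  have bij: "bij_betw rot UNIV UNIV"
    by (rule bij_betwI[of _ _ _ "\<lambda>(k, l). (- k - l, k)"]) (auto simp: rot_def)
  show "(\<lambda>x. f (rot x)) summable_on UNIV" "infsum (\<lambda>x. f (rot x)) UNIV = infsum f UNIV"
    using summable_on_reindex_bij_betw[OF bij, of f] infsum_reindex_bij_betw[OF bij, of f] assms
    by auto
qed

text \<open>Averaging the summand over the cyclic shifts leaves the sum unchanged, so cancellations
  between the three positions can be exploited term by term.\<close>

lemma infsum_cyclic:
  fixes f :: "int \<times> int \<Rightarrow> real"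
  assumes "f summable_on UNIV"
  shows "(\<lambda>x. f x + f (rot x) + f (rot (rot x))) summable_on UNIV"
    and "3 * infsum f UNIV = (\<Sum>\<^sub>\<infinity>x. f x + f (rot x) + f (rot (rot x)))"
  using infsum_rot[OF assms] infsum_rot[OF infsum_rot(1)[OF assms]] assms
  by (simp_all add: summable_on_add infsum_add)

section \<open>Convolution and norms of coefficient sequences\<close>

definition conv :: "(int \<Rightarrow> complex) \<Rightarrow> (int \<Rightarrow> complex) \<Rightarrow> int \<Rightarrow> complex" where
  "conv a b n = (\<Sum>\<^sub>\<infinity>k. a k * b (n - k))"

definition wsum :: "(int \<Rightarrow> real) \<Rightarrow> (int \<Rightarrow> complex) \<Rightarrow> real" where
  "wsum g a = (\<Sum>\<^sub>\<infinity>n. (g n * cmod (a n))\<^sup>2)"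

definition wfin :: "(int \<Rightarrow> real) \<Rightarrow> (int \<Rightarrow> complex) \<Rightarrow> bool" where
  "wfin g a \<longleftrightarrow> (\<lambda>n. (g n * cmod (a n))\<^sup>2) summable_on UNIV"

text \<open>Summability of this sequence means two derivatives in the Wiener algebra. Its sum
  dominates the supremum norms of u, of u' and, as \<alpha> < 2, of the dispersive term.\<close>

definition wien :: "(int \<Rightarrow> complex) \<Rightarrow> int \<Rightarrow> real" where
  "wien a n = (1 + (real_of_int n)\<^sup>2) * cmod (a n)"

abbreviation "wiener a \<equiv> wien a summable_on UNIV"
abbreviation "wiener_norm a \<equiv> infsum (wien a) UNIV"

lemma wsum_nonneg: "0 \<le> wsum g a"
  unfolding wsum_def by (intro infsum_nonneg) simp

lemma wien_nonneg: "0 \<le> wien a n"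
  by (simp add: wien_def)

lemma cmod_le_wien: "cmod (a n) \<le> wien a n"
  by (simp add: wien_def mult_le_cancel_right1)

lemma abs_int_le: "\<bar>real_of_int n\<bar> \<le> 1 + (real_of_int n)\<^sup>2"
proof -
  have "0 \<le> (\<bar>real_of_int n\<bar> - 1)\<^sup>2" by simp
  then have "0 \<le> (real_of_int n)\<^sup>2 + 1 - 2 * \<bar>real_of_int n\<bar>" by (simp add: power2_diff)
  then show ?thesis by linarith
qed

lemma abs_mult_le_wien: "\<bar>real_of_int n\<bar> * cmod (a n) \<le> wien a n"
  unfolding wien_def by (intro mult_right_mono abs_int_le) simp

lemma wiener_imp:
  assumes "wiener a"
  shows "(\<lambda>n. \<bar>real_of_int n\<bar> * cmod (a n)) summable_on UNIV"
    and "(\<Sum>\<^sub>\<infinity>n. \<bar>real_of_int n\<bar> * cmod (a n)) \<le> wiener_norm a"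
    and "(\<lambda>n. cmod (a n)) summable_on UNIV"
    and "(\<Sum>\<^sub>\<infinity>n. cmod (a n)) \<le> wiener_norm a"
    and "(\<lambda>n. (cmod (a n))\<^sup>2) summable_on UNIV"
    and "cmod (a n) \<le> wiener_norm a"
proof -
  show 1: "(\<lambda>n. \<bar>real_of_int n\<bar> * cmod (a n)) summable_on UNIV"
    by (rule summable_on_comparison_test[OF assms abs_mult_le_wien]) simp
  show "(\<Sum>\<^sub>\<infinity>n. \<bar>real_of_int n\<bar> * cmod (a n)) \<le> wiener_norm a"
    by (rule infsum_mono[OF 1 assms abs_mult_le_wien])
  show 2: "(\<lambda>n. cmod (a n)) summable_on UNIV"
    by (rule summable_on_comparison_test[OF assms cmod_le_wien]) simp
  show le: "(\<Sum>\<^sub>\<infinity>n. cmod (a n)) \<le> wiener_norm a"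
    by (rule infsum_mono[OF 2 assms cmod_le_wien])
  have b: "cmod (a n) \<le> wiener_norm a" for n
    using finite_sum_le_infsum[OF 2, of "{n}"] le by simp
  then show "cmod (a n) \<le> wiener_norm a" .
  show "(\<lambda>n. (cmod (a n))\<^sup>2) summable_on UNIV"
  proof (rule summable_on_comparison_test)
    show "(\<lambda>n. wiener_norm a * cmod (a n)) summable_on UNIV"
      by (intro summable_on_cmult_right 2)
  qed (use b in \<open>auto simp: power2_eq_square intro: mult_right_mono\<close>)
qed

lemma wiener_wfin_bounded:
  assumes "wiener a" "\<And>n. 0 \<le> g n" "\<And>n. g n \<le> G"
  shows "wfin g a"
  unfolding wfin_def
proof (rule summable_on_comparison_test)
  show "(\<lambda>n. G\<^sup>2 * (cmod (a n))\<^sup>2) summable_on UNIV"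
    by (intro summable_on_cmult_right wiener_imp assms)
qed (auto simp: power_mult_distrib intro!: mult_right_mono power_mono assms)

lemma conv_bound:
  assumes "wiener a" "wiener b"
  shows "(\<lambda>k. a k * b (n - k)) summable_on UNIV"
    and "cmod (conv a b n) \<le> wiener_norm a * wiener_norm b"
proof -
  have sm: "(\<lambda>k. cmod (a k) * wiener_norm b) summable_on UNIV"
    by (intro summable_on_cmult_left wiener_imp assms)
  have le: "norm (a k * b (n - k)) \<le> cmod (a k) * wiener_norm b" for k
    unfolding norm_mult by (intro mult_left_mono wiener_imp assms) simp
  show "(\<lambda>k. a k * b (n - k)) summable_on UNIV"
    by (rule dominated_summable[OF sm le])
  have "cmod (conv a b n) \<le> (\<Sum>\<^sub>\<infinity>k. cmod (a k) * wiener_norm b)"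
    unfolding conv_def by (rule dominated_summable[OF sm le])
  also have "\<dots> \<le> wiener_norm a * wiener_norm b"
    by (simp add: infsum_cmult_left', intro mult_right_mono wiener_imp assms infsum_nonneg wien_nonneg)
  finally show "cmod (conv a b n) \<le> wiener_norm a * wiener_norm b" .
qed

lemma conv_commute: "conv a b n = conv b a n"
proof -
  have bij: "bij_betw (\<lambda>k. n - k) UNIV (UNIV :: int set)"
    by (rule bij_betwI[of _ _ _ "\<lambda>k. n - k"]) auto
  have "conv a b n = (\<Sum>\<^sub>\<infinity>k. a (n - k) * b k)"
    unfolding conv_def using infsum_reindex_bij_betw[OF bij, of "\<lambda>k. a k * b (n - k)"] by simp
  then show ?thesis by (simp add: conv_def mult.commute)
qed

section \<open>Slowly varying weights\<close>

text \<open>The discrete form of x g'(x) \<le> K g(x) between |b| and 2 |b|, for weights that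
  increase with |n| and are therefore even. An increment of g absorbs the factor |b| and leaves only
  the gap |c| - |b|. The constant is explicit because the energy estimates depend on the weight only
  through K.\<close>

definition slow :: "real \<Rightarrow> (int \<Rightarrow> real) \<Rightarrow> bool" where
  "slow K g \<longleftrightarrow> 0 \<le> K \<and> (\<forall>n. 0 \<le> g n) \<and> (\<forall>b c. \<bar>b\<bar> \<le> \<bar>c\<bar> \<longrightarrow> g b \<le> g c) \<and>
     (\<forall>b c. \<bar>b\<bar> \<le> \<bar>c\<bar> \<and> \<bar>c\<bar> \<le> 2 * \<bar>b\<bar> \<longrightarrow>
        real_of_int \<bar>b\<bar> * (g c - g b) \<le> K * real_of_int (\<bar>c\<bar> - \<bar>b\<bar>) * g b)"

lemma slowD:
  assumes "slow K g"
  shows "0 \<le> K" "0 \<le> g n" "\<bar>b\<bar> \<le> \<bar>c\<bar> \<Longrightarrow> g b \<le> g c"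
    "\<bar>b\<bar> \<le> \<bar>c\<bar> \<Longrightarrow> \<bar>c\<bar> \<le> 2 * \<bar>b\<bar> \<Longrightarrow>
       real_of_int \<bar>b\<bar> * (g c - g b) \<le> K * real_of_int (\<bar>c\<bar> - \<bar>b\<bar>) * g b"
  using assms unfolding slow_def by blast+

lemma slow_minus: "slow K g \<Longrightarrow> g (- n) = g n"
  using slowD(3)[of K g n "-n"] slowD(3)[of K g "-n" n] by auto

lemma slow_doubling:
  assumes g: "slow K g" and bc: "\<bar>b\<bar> \<le> \<bar>c\<bar>" "\<bar>c\<bar> \<le> 2 * \<bar>b\<bar>"
  shows "g c \<le> (1 + K) * g b"
proof (cases "b = 0")
  case True
  then have "c = b" using bc by simp
  then show ?thesis using mult_right_mono[of 1 "1 + K" "g b"] slowD(1)[OF g] slowD(2)[OF g, of b] by simp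
next
  case False
  have "real_of_int \<bar>b\<bar> * (g c - g b) \<le> K * real_of_int (\<bar>c\<bar> - \<bar>b\<bar>) * g b"
    by (rule slowD(4)[OF g bc])
  also have "\<dots> \<le> K * real_of_int \<bar>b\<bar> * g b"
    using bc slowD(1,2)[OF g] by (intro mult_mono mult_nonneg_nonneg) auto
  finally have "real_of_int \<bar>b\<bar> * (g c - g b) \<le> real_of_int \<bar>b\<bar> * (K * g b)" by (simp add: mult_ac)
  then have "g c - g b \<le> K * g b" using False by simp
  then show ?thesis by (simp add: algebra_simps)
qed

lemma slow_const: "0 \<le> c \<Longrightarrow> slow 0 (\<lambda>_. c)"
  by (simp add: slow_def)

lemma slow_cmult:
  assumes "slow K g" "0 \<le> c"
  shows "slow K (\<lambda>n. c * g n)"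
proof -
  have "real_of_int \<bar>a\<bar> * (c * g b - c * g a) \<le> K * real_of_int (\<bar>b\<bar> - \<bar>a\<bar>) * (c * g a)"
    if "\<bar>a\<bar> \<le> \<bar>b\<bar>" "\<bar>b\<bar> \<le> 2 * \<bar>a\<bar>" for a b
    using mult_left_mono[OF slowD(4)[OF assms(1) that] assms(2)] by (simp add: algebra_simps)
  then show ?thesis using assms(2) slowD(1-3)[OF assms(1)]
    unfolding slow_def by (auto intro: mult_left_mono)
qed

text \<open>Truncation only shrinks the increments that it affects, so K does not depend on the
  level c. This uniformity later allows unbounded weights to be reached through bounded
  ones.\<close>

lemma slow_min:
  assumes "slow K g" "0 \<le> c"
  shows "slow K (\<lambda>n. min (g n) c)"
proof -
  have "real_of_int \<bar>a\<bar> * (min (g b) c - min (g a) c) \<le> K * real_of_int (\<bar>b\<bar> - \<bar>a\<bar>) * min (g a) c"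
    if ab: "\<bar>a\<bar> \<le> \<bar>b\<bar>" "\<bar>b\<bar> \<le> 2 * \<bar>a\<bar>" for a b
  proof (cases "g a \<ge> c")
    case True
    then have "min (g b) c = c" "min (g a) c = c" using slowD(3)[OF assms(1) ab(1)] by auto
    then show ?thesis using slowD(1)[OF assms(1)] assms(2) ab by simp
  next
    case False
    have "real_of_int \<bar>a\<bar> * (min (g b) c - min (g a) c) \<le> real_of_int \<bar>a\<bar> * (g b - g a)"
      using False by (intro mult_left_mono) auto
    also have "\<dots> \<le> K * real_of_int (\<bar>b\<bar> - \<bar>a\<bar>) * g a" by (rule slowD(4)[OF assms(1) ab])
    finally show ?thesis using False by simp
  qed
  moreover have "min (g a) c \<le> min (g b) c" if "\<bar>a\<bar> \<le> \<bar>b\<bar>" for a b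
    using slowD(3)[OF assms(1) that] by auto
  ultimately show ?thesis using assms(2) slowD(1-2)[OF assms(1)]
    unfolding slow_def by auto
qed

text \<open>Leibniz rule: the increment of g is multiplied by \<open>h b\<close>, and the factor
  \<open>1 + L\<close> is the doubling constant that brings \<open>h b\<close> back to
  \<open>h a\<close>.\<close>

lemma slow_mult:
  assumes g: "slow K g" and h: "slow L h"
  shows "slow (K * (1 + L) + L) (\<lambda>n. g n * h n)"
proof -
  have "real_of_int \<bar>a\<bar> * (g b * h b - g a * h a) \<le> (K * (1 + L) + L) * real_of_int (\<bar>b\<bar> - \<bar>a\<bar>) * (g a * h a)"
    if ab: "\<bar>a\<bar> \<le> \<bar>b\<bar>" "\<bar>b\<bar> \<le> 2 * \<bar>a\<bar>" for a b
  proof -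
    have "real_of_int \<bar>a\<bar> * (g b * h b - g a * h a)
        = (real_of_int \<bar>a\<bar> * (g b - g a)) * h b + g a * (real_of_int \<bar>a\<bar> * (h b - h a))"
      by (simp add: algebra_simps)
    also have "\<dots> \<le> (K * real_of_int (\<bar>b\<bar> - \<bar>a\<bar>) * g a) * ((1 + L) * h a)
        + g a * (L * real_of_int (\<bar>b\<bar> - \<bar>a\<bar>) * h a)"
    proof (rule add_mono)
      show "(real_of_int \<bar>a\<bar> * (g b - g a)) * h b \<le> (K * real_of_int (\<bar>b\<bar> - \<bar>a\<bar>) * g a) * ((1 + L) * h a)"
        by (rule mult_mono[OF slowD(4)[OF g ab] slow_doubling[OF h ab]])
          (use ab slowD(1,2)[OF g] slowD(2)[OF h] in auto)
      show "g a * (real_of_int \<bar>a\<bar> * (h b - h a)) \<le> g a * (L * real_of_int (\<bar>b\<bar> - \<bar>a\<bar>) * h a)"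
        by (rule mult_left_mono[OF slowD(4)[OF h ab] slowD(2)[OF g]])
    qed
    also have "\<dots> = (K * (1 + L) + L) * real_of_int (\<bar>b\<bar> - \<bar>a\<bar>) * (g a * h a)"
      by (simp add: algebra_simps)
    finally show ?thesis .
  qed
  moreover have "g a * h a \<le> g b * h b" if "\<bar>a\<bar> \<le> \<bar>b\<bar>" for a b
    using slowD[OF g] slowD[OF h] that by (intro mult_mono) auto
  ultimately show ?thesis using slowD[OF g] slowD[OF h]
    unfolding slow_def by auto
qed

text \<open>The right side is the chord over [0, 1] of the convex function on the left.\<close>

lemma power_one_plus_le:
  fixes x :: real
  assumes "0 \<le> x" "x \<le> 1"
  shows "(1 + x) ^ m \<le> 1 + (2 ^ m - 1) * x"
proof (induction m)
  case (Suc m)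
  have p: "(1::real) \<le> 2 ^ m" by simp
  have "(1 + x) ^ Suc m \<le> (1 + x) * (1 + (2 ^ m - 1) * x)"
    using Suc assms by (simp add: mult_left_mono)
  also have "\<dots> = 1 + 2 ^ m * x + (2 ^ m - 1) * (x * x)" by (simp add: algebra_simps)
  also have "\<dots> \<le> 1 + 2 ^ m * x + (2 ^ m - 1) * x"
    using assms p mult_left_mono[of x 1 x] by (intro add_left_mono mult_left_mono) auto
  also have "\<dots> = 1 + (2 ^ Suc m - 1) * x" by (simp add: algebra_simps)
  finally show ?case .
qed simp

text \<open>With \<open>\<langle>n\<rangle>\<^sup>2 = 1 + n\<^sup>2\<close>, \<open>hw p n\<close> is \<open>\<langle>n\<rangle>\<^bsup>2p\<^esup>\<close>; the weight of \<open>H\<^sup>s\<close> is therefore \<open>hw (s/2)\<close>.\<close>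

definition hw :: "real \<Rightarrow> int \<Rightarrow> real" where
  "hw p n = (1 + (real_of_int n)\<^sup>2) powr p"

lemma base_ge_1: "1 \<le> 1 + (real_of_int n)\<^sup>2" "0 < 1 + (real_of_int n)\<^sup>2"
  using zero_le_power2[of "real_of_int n"] by linarith+

lemma hw_pos: "0 < hw p n"
  using base_ge_1(2)[of n] unfolding hw_def powr_gt_zero by linarith

lemma hw_ge_1: "0 \<le> p \<Longrightarrow> 1 \<le> hw p n"
  unfolding hw_def using base_ge_1 by (intro ge_one_powr_ge_zero) auto

lemma hw_add: "hw (p + q) n = hw p n * hw q n"
  by (simp add: hw_def powr_add)

lemma hw_power2: "(hw p n)\<^sup>2 = hw (2 * p) n"
  by (simp add: power2_eq_square hw_add[symmetric])

lemma hw_1: "hw 1 n = 1 + (real_of_int n)\<^sup>2"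
  using base_ge_1[of n] by (simp add: hw_def)

lemma slow_hw:
  assumes p: "0 \<le> p"
  shows "\<exists>K. slow K (hw p)"
proof -
  \<comment> \<open>The real exponent 2p is rounded up to a natural number so that the chord
    inequality applies to the relative increment x = (|c| - |b|) / |b| \<le> 1; K is the slope of
    that chord.\<close>
  define m where "m = nat \<lceil>2 * p\<rceil>"
  define K where "K = (2 ^ m - 1 :: real)"
  have K0: "0 \<le> K" by (simp add: K_def)
  have mono: "hw p b \<le> hw p c" if "\<bar>b\<bar> \<le> \<bar>c\<bar>" for b c
  proof -
    have "(real_of_int b)\<^sup>2 \<le> (real_of_int c)\<^sup>2" using that by (simp flip: abs_le_square_iff)
    then show ?thesis unfolding hw_def using base_ge_1[of b] p by (intro powr_mono2) linarith+
  qed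
  have "real_of_int \<bar>b\<bar> * (hw p c - hw p b) \<le> K * real_of_int (\<bar>c\<bar> - \<bar>b\<bar>) * hw p b"
    if bc: "\<bar>b\<bar> \<le> \<bar>c\<bar>" "\<bar>c\<bar> \<le> 2 * \<bar>b\<bar>" for b c
  proof (cases "b = 0")
    case True then show ?thesis using bc by simp
  next
    case False
    define \<beta> \<gamma> where "\<beta> = real_of_int \<bar>b\<bar>" and "\<gamma> = real_of_int \<bar>c\<bar>"
    have bg: "0 < \<beta>" "\<beta> \<le> \<gamma>" "\<gamma> \<le> 2 * \<beta>" using False bc unfolding \<beta>_def \<gamma>_def by linarith+
    define x where "x = (\<gamma> - \<beta>) / \<beta>"
    have x: "0 \<le> x" "x \<le> 1" "\<gamma> = \<beta> * (1 + x)" using bg by (auto simp: x_def field_simps)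
    have "1 + \<gamma>\<^sup>2 \<le> (1 + \<beta>\<^sup>2) * (1 + x)\<^sup>2"
    proof -
      have "1 \<le> (1 + x)\<^sup>2" using x by simp
      then show ?thesis unfolding x(3) power_mult_distrib distrib_right by simp
    qed
    then have "(1 + \<gamma>\<^sup>2) powr p \<le> ((1 + \<beta>\<^sup>2) * (1 + x)\<^sup>2) powr p"
      using p by (intro powr_mono2) auto
    also have "\<dots> = (1 + \<beta>\<^sup>2) powr p * (1 + x) powr (2 * p)"
      using x by (simp add: powr_mult powr_powr[symmetric])
    also have "(1 + x) powr (2 * p) \<le> (1 + x) powr (real m)"
      using x unfolding m_def by (intro powr_mono) linarith+
    also have "\<dots> = (1 + x) ^ m" using x by (simp add: powr_realpow)
    also have "\<dots> \<le> 1 + K * x" unfolding K_def by (rule power_one_plus_le[OF x(1,2)])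
    finally have "(1 + \<gamma>\<^sup>2) powr p \<le> (1 + \<beta>\<^sup>2) powr p * (1 + K * x)"
      by (simp add: mult_left_mono)
    then have "hw p c \<le> hw p b * (1 + K * x)" by (simp add: hw_def \<beta>_def \<gamma>_def)
    then have "\<beta> * (hw p c - hw p b) \<le> \<beta> * (hw p b * (K * x))"
      using bg by (intro mult_left_mono) (auto simp: algebra_simps)
    also have "\<dots> = K * (\<gamma> - \<beta>) * hw p b" using bg by (simp add: x_def)
    finally show ?thesis by (simp add: \<beta>_def \<gamma>_def)
  qed
  then have "slow K (hw p)" using mono K0 less_imp_le[OF hw_pos] unfolding slow_def by auto
  then show ?thesis ..
qed

text \<open>A commutator estimate. Eliminating c by a + b + c = 0 leaves a (g(a)^2 - g(c)^2) + b
  (g(b)^2 - g(c)^2). The first term already has the small factor a. In the second, |c| - |b| \<le>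
  |a|, so \<open>slow\<close> exchanges the factor b for K |a|; doubling compares g(c) with
  g(b).\<close>

lemma symbol_bound_aux:
  assumes g: "slow K g" and abc: "a + b + c = (0::int)" "\<bar>a\<bar> \<le> \<bar>b\<bar>" "\<bar>b\<bar> \<le> \<bar>c\<bar>"
  shows "\<bar>real_of_int a * (g a)\<^sup>2 + real_of_int b * (g b)\<^sup>2 + real_of_int c * (g c)\<^sup>2\<bar>
           \<le> (1 + 3 * K) * (\<bar>real_of_int a\<bar> * g b * g c)"
proof -
  note D = slowD[OF g]
  have c2: "\<bar>c\<bar> \<le> 2 * \<bar>b\<bar>" "\<bar>c\<bar> - \<bar>b\<bar> \<le> \<bar>a\<bar>" using abc by linarith+
  have dbl: "g c \<le> (1 + K) * g b" by (rule slow_doubling[OF g abc(3) c2(1)])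
  have gab: "g a \<le> g b" "g b \<le> g c" using D(3) abc by auto
  have 1: "\<bar>real_of_int a * ((g a)\<^sup>2 - (g c)\<^sup>2)\<bar> \<le> (1 + K) * (\<bar>real_of_int a\<bar> * g b * g c)"
  proof -
    have "(g a)\<^sup>2 \<le> (g c)\<^sup>2" using gab D(2) by (intro power_mono) auto
    then have "\<bar>(g a)\<^sup>2 - (g c)\<^sup>2\<bar> \<le> g c * g c"
      using zero_le_power2[of "g a"] by (simp add: power2_eq_square)
    also have "\<dots> \<le> (1 + K) * g b * g c" using dbl D(2) by (intro mult_right_mono)
    finally have "\<bar>real_of_int a\<bar> * \<bar>(g a)\<^sup>2 - (g c)\<^sup>2\<bar> \<le> \<bar>real_of_int a\<bar> * ((1 + K) * g b * g c)"
      by (intro mult_left_mono) auto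
    then show ?thesis by (simp add: abs_mult mult_ac)
  qed
  have 2: "\<bar>real_of_int b * ((g b)\<^sup>2 - (g c)\<^sup>2)\<bar> \<le> 2 * K * (\<bar>real_of_int a\<bar> * g b * g c)"
  proof -
    have "\<bar>real_of_int b * ((g b)\<^sup>2 - (g c)\<^sup>2)\<bar> = (real_of_int \<bar>b\<bar> * (g c - g b)) * (g c + g b)"
    proof -
      have "(g b)\<^sup>2 - (g c)\<^sup>2 = - ((g c - g b) * (g c + g b))" by (simp add: power2_eq_square algebra_simps)
      then show ?thesis using gab D(2)[of c] D(2)[of b] by (simp add: abs_mult)
    qed
    also have "\<dots> \<le> (K * real_of_int \<bar>a\<bar> * g b) * (2 * g c)"
    proof (rule mult_mono)
      have "real_of_int \<bar>b\<bar> * (g c - g b) \<le> K * real_of_int (\<bar>c\<bar> - \<bar>b\<bar>) * g b"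
        by (rule D(4)[OF abc(3) c2(1)])
      also have "\<dots> \<le> K * real_of_int \<bar>a\<bar> * g b"
        using c2(2) D(1,2) by (intro mult_right_mono mult_left_mono) auto
      finally show "real_of_int \<bar>b\<bar> * (g c - g b) \<le> K * real_of_int \<bar>a\<bar> * g b" .
    qed (use gab D(1) D(2)[of b] D(2)[of c] in auto)
    finally show ?thesis by (simp add: mult_ac)
  qed
  have "c = - a - b" using abc by simp
  then have c: "real_of_int c = - real_of_int a - real_of_int b" by simp
  have "real_of_int a * (g a)\<^sup>2 + real_of_int b * (g b)\<^sup>2 + real_of_int c * (g c)\<^sup>2
     = real_of_int a * ((g a)\<^sup>2 - (g c)\<^sup>2) + real_of_int b * ((g b)\<^sup>2 - (g c)\<^sup>2)"
    unfolding c by (simp add: algebra_simps)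
  then show ?thesis using 1 2 by (simp add: algebra_simps)
qed

text \<open>In each of the six orderings \<open>symbol_bound_aux\<close> gives one of the three
  summands on the right. Their sum is symmetric and can thus be summed over all triples without
  regard to the ordering.\<close>

lemma symbol_bound:
  assumes g: "slow K g" and abc: "a + b + c = (0::int)"
  shows "\<bar>real_of_int a * (g a)\<^sup>2 + real_of_int b * (g b)\<^sup>2 + real_of_int c * (g c)\<^sup>2\<bar>
    \<le> (1 + 3 * K) * (\<bar>real_of_int a\<bar> * g b * g c + \<bar>real_of_int b\<bar> * g c * g a + \<bar>real_of_int c\<bar> * g a * g b)"
proof -
  note D = slowD[OF g]
  let ?A = "\<bar>real_of_int a\<bar> * g b * g c" and ?B = "\<bar>real_of_int b\<bar> * g c * g a"
    and ?C = "\<bar>real_of_int c\<bar> * g a * g b"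
  let ?S = "\<bar>real_of_int a * (g a)\<^sup>2 + real_of_int b * (g b)\<^sup>2 + real_of_int c * (g c)\<^sup>2\<bar>"
  have nn: "0 \<le> ?A" "0 \<le> ?B" "0 \<le> ?C" by (simp_all add: D(2))
  have "?S \<le> (1 + 3 * K) * ?A \<or> ?S \<le> (1 + 3 * K) * ?B \<or> ?S \<le> (1 + 3 * K) * ?C"
  proof -
    consider "\<bar>a\<bar> \<le> \<bar>b\<bar>" "\<bar>b\<bar> \<le> \<bar>c\<bar>" | "\<bar>a\<bar> \<le> \<bar>c\<bar>" "\<bar>c\<bar> \<le> \<bar>b\<bar>" | "\<bar>b\<bar> \<le> \<bar>a\<bar>" "\<bar>a\<bar> \<le> \<bar>c\<bar>"
      | "\<bar>b\<bar> \<le> \<bar>c\<bar>" "\<bar>c\<bar> \<le> \<bar>a\<bar>" | "\<bar>c\<bar> \<le> \<bar>a\<bar>" "\<bar>a\<bar> \<le> \<bar>b\<bar>" | "\<bar>c\<bar> \<le> \<bar>b\<bar>" "\<bar>b\<bar> \<le> \<bar>a\<bar>"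
      by linarith
    then show ?thesis
      by cases (use symbol_bound_aux[OF g, of a b c] symbol_bound_aux[OF g, of a c b]
        symbol_bound_aux[OF g, of b a c] symbol_bound_aux[OF g, of b c a]
        symbol_bound_aux[OF g, of c a b] symbol_bound_aux[OF g, of c b a] abc in \<open>simp_all add: ac_simps\<close>)
  qed
  moreover have "(1 + 3 * K) * ?A \<le> (1 + 3 * K) * (?A + ?B + ?C)"
    "(1 + 3 * K) * ?B \<le> (1 + 3 * K) * (?A + ?B + ?C)" "(1 + 3 * K) * ?C \<le> (1 + 3 * K) * (?A + ?B + ?C)"
    using nn D(1) by (intro mult_left_mono; simp)+
  ultimately show ?thesis by linarith
qed

section \<open>Cubic forms\<close>

text \<open>The substitution n = - m turns \<open>cnj (d n)\<close> into \<open>d m\<close>, and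
  oddness of f gives the sign. Linear growth of f against the Wiener bound makes the double series
  absolutely summable, which justifies the exchange of summations and all later
  rearrangements.\<close>

lemma cubic_form_series:
  fixes d z :: "int \<Rightarrow> complex" and f :: "int \<Rightarrow> real"
  assumes cnj: "\<And>n. d (- n) = cnj (d n)" and d: "wiener d" and z: "wiener z"
    and f: "\<And>n. f (- n) = - f n" "\<And>n. \<bar>f n\<bar> \<le> C * \<bar>real_of_int n\<bar>" "0 \<le> C"
  shows "(\<lambda>(m, k). f m * Im (d m * z k * d (- m - k))) summable_on UNIV"
    and "(\<lambda>n. f n * Im (cnj (d n) * conv z d n)) summable_on UNIV"
    and "(\<Sum>\<^sub>\<infinity>n. f n * Im (cnj (d n) * conv z d n))
           = - (\<Sum>\<^sub>\<infinity>(m, k). f m * Im (d m * z k * d (- m - k)))"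
proof -
  define P where "P = (\<lambda>(m, k). f m * Im (d m * z k * d (- m - k)))"
  define x where "x n = C * (\<bar>real_of_int n\<bar> * cmod (d n))" for n
  have S: "P summable_on UNIV"
  proof (rule dominated_summable)
    show "(\<lambda>(m, k). x m * (cmod (z k) * cmod (d (- m - k)))) summable_on UNIV"
      unfolding x_def by (intro trilinear_summable summable_on_cmult_right wiener_imp d z) (use f in auto)
    fix q :: "int \<times> int"
    obtain m k where q: "q = (m, k)" by (cases q)
    have "\<bar>f m * Im (d m * z k * d (- m - k))\<bar> \<le> (C * \<bar>real_of_int m\<bar>) * (cmod (d m) * cmod (z k) * cmod (d (- m - k)))"
      unfolding abs_mult[of "f m"] using abs_Im_le_cmod[of "d m * z k * d (- m - k)"] f
      by (intro mult_mono) (auto simp: norm_mult)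
    then show "norm (P q) \<le> (case q of (m, k) \<Rightarrow> x m * (cmod (z k) * cmod (d (- m - k))))"
      by (simp add: P_def q x_def mult_ac)
  qed
  then have S': "P summable_on UNIV \<times> UNIV" by simp
  show "(\<lambda>(m, k). f m * Im (d m * z k * d (- m - k))) summable_on UNIV"
    using S by (simp add: P_def)
  let ?\<Phi> = "\<lambda>n. f n * Im (cnj (d n) * conv z d n)"
  have *: "?\<Phi> (- m) = - (\<Sum>\<^sub>\<infinity>k. P (m, k))" for m
  proof -
    have sm: "(\<lambda>k. z k * d (- m - k)) summable_on UNIV" by (rule conv_bound[OF z d])
    have "Im (d m * conv z d (- m)) = (\<Sum>\<^sub>\<infinity>k. Im (d m * (z k * d (- m - k))))"
      unfolding conv_def infsum_cmult_right'[symmetric]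
      by (rule infsum_Im[symmetric]) (rule summable_on_cmult_right[OF sm])
    then have "f m * Im (d m * conv z d (- m)) = (\<Sum>\<^sub>\<infinity>k. P (m, k))"
      by (simp add: P_def infsum_cmult_right' mult.assoc)
    moreover have "cnj (d (- m)) = d m" by (simp add: cnj)
    ultimately show ?thesis by (simp only: f(1))
  qed
  have bij: "bij_betw uminus UNIV (UNIV :: int set)"
    by (rule bij_betwI[of _ _ _ uminus]) auto
  have "(\<lambda>m. \<Sum>\<^sub>\<infinity>k. P (m, k)) summable_on UNIV"
    using summable_on_Sigma_banach[of "\<lambda>m k. P (m, k)" UNIV "\<lambda>_. UNIV"] S' by (simp add: case_prod_unfold)
  then have "(\<lambda>m. ?\<Phi> (- m)) summable_on UNIV"
    unfolding * by (simp add: summable_on_uminus)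
  then show "?\<Phi> summable_on UNIV" using summable_on_reindex_bij_betw[OF bij, of ?\<Phi>] by blast
  have "infsum ?\<Phi> UNIV = (\<Sum>\<^sub>\<infinity>m. ?\<Phi> (- m))" using infsum_reindex_bij_betw[OF bij, of ?\<Phi>] by simp
  also have "\<dots> = - infsum P UNIV"
    unfolding * infsum_uminus using infsum_Sigma_banach[OF S'] by simp
  finally show "infsum ?\<Phi> UNIV = - (\<Sum>\<^sub>\<infinity>(m, k). f m * Im (d m * z k * d (- m - k)))"
    by (simp add: P_def)
qed

lemma weighted_trilinear_bound:
  fixes a d :: "int \<Rightarrow> complex"
  assumes a: "wiener a" and g: "\<And>n. 0 \<le> g n" and d: "wfin g d"
  shows "(\<lambda>(k, l). \<bar>real_of_int k\<bar> * cmod (a k) * (g l * cmod (d l) * (g (- k - l) * cmod (d (- k - l))))) summable_on UNIV"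
    and "(\<Sum>\<^sub>\<infinity>(k, l). \<bar>real_of_int k\<bar> * cmod (a k) * (g l * cmod (d l) * (g (- k - l) * cmod (d (- k - l)))))
           \<le> wiener_norm a * wsum g d"
proof -
  note t = trilinear_summable[of "\<lambda>k. \<bar>real_of_int k\<bar> * cmod (a k)" "\<lambda>l. g l * cmod (d l)" "\<lambda>l. g l * cmod (d l)"]
  have gd: "(\<lambda>l. (g l * cmod (d l))\<^sup>2) summable_on UNIV" using d by (simp add: wfin_def)
  show "(\<lambda>(k, l). \<bar>real_of_int k\<bar> * cmod (a k) * (g l * cmod (d l) * (g (- k - l) * cmod (d (- k - l))))) summable_on UNIV"
    by (rule t(1)) (use wiener_imp(1)[OF a] gd g in auto)
  have "(\<Sum>\<^sub>\<infinity>(k, l). \<bar>real_of_int k\<bar> * cmod (a k) * (g l * cmod (d l) * (g (- k - l) * cmod (d (- k - l)))))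
     \<le> (\<Sum>\<^sub>\<infinity>k. \<bar>real_of_int k\<bar> * cmod (a k)) * ((wsum g d + wsum g d) / 2)"
    unfolding wsum_def by (rule t(2)) (use wiener_imp(1)[OF a] gd g in auto)
  also have "\<dots> \<le> wiener_norm a * wsum g d"
    using mult_right_mono[OF wiener_imp(2)[OF a] wsum_nonneg[of g d]] by simp
  finally show "(\<Sum>\<^sub>\<infinity>(k, l). \<bar>real_of_int k\<bar> * cmod (a k) * (g l * cmod (d l) * (g (- k - l) * cmod (d (- k - l)))))
           \<le> wiener_norm a * wsum g d" .
qed

text \<open>
  The symbol of the cubic form is fully symmetrised over the triples of frequencies with sum zero;
  \<open>symbol_bound\<close> then moves the derivative to the smallest of the three frequencies.
\<close>

lemma energy_form:
  assumes cnj: "\<And>n. a (- n) = cnj (a n)" and a: "wiener a"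
    and g: "slow K g" and G: "\<And>n. g n \<le> G"
  shows "(\<lambda>n. real_of_int n * (g n)\<^sup>2 * Im (cnj (a n) * conv a a n)) summable_on UNIV"
    and "\<bar>\<Sum>\<^sub>\<infinity>n. real_of_int n * (g n)\<^sup>2 * Im (cnj (a n) * conv a a n)\<bar>
           \<le> (1 + 3 * K) * (wiener_norm a * wsum g a)"
proof -
  define f where "f n = real_of_int n * (g n)\<^sup>2" for n
  have f: "f (- n) = - f n" "\<bar>f n\<bar> \<le> G\<^sup>2 * \<bar>real_of_int n\<bar>" for n
    using slow_minus[OF g] slowD(2)[OF g, of n] G[of n]
    by (auto simp: f_def abs_mult mult.commute[of "G\<^sup>2"] intro!: mult_left_mono power_mono)
  define P where "P = (\<lambda>(m, k). f m * Im (a m * a k * a (- m - k)))"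
  \<comment> \<open>The majorant carries the derivative on the first frequency; its three cyclic
    shifts make up the right side of \<open>symbol_bound\<close>.\<close>
  define R where "R = (\<lambda>(k, l). \<bar>real_of_int k\<bar> * cmod (a k) * (g l * cmod (a l) * (g (- k - l) * cmod (a (- k - l)))))"
  note cf = cubic_form_series[OF cnj a a f, simplified]
  have P: "P summable_on UNIV" using cf(1) by (simp add: P_def)
  show "(\<lambda>n. real_of_int n * (g n)\<^sup>2 * Im (cnj (a n) * conv a a n)) summable_on UNIV"
    using cf(2) by (simp add: f_def)
  have eq: "(\<Sum>\<^sub>\<infinity>n. real_of_int n * (g n)\<^sup>2 * Im (cnj (a n) * conv a a n)) = - infsum P UNIV"
    using cf(3) by (simp add: f_def P_def)
  have gfin: "wfin g a" by (rule wiener_wfin_bounded[OF a slowD(2)[OF g] G])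
  have R: "R summable_on UNIV" "infsum R UNIV \<le> wiener_norm a * wsum g a"
    using weighted_trilinear_bound[OF a slowD(2)[OF g] gfin] by (simp_all add: R_def)
  note Rc = infsum_cyclic[OF R(1)] and Pc = infsum_cyclic[OF P]
  have bd: "norm (P x + P (rot x) + P (rot (rot x))) \<le> (1 + 3 * K) * (R x + R (rot x) + R (rot (rot x)))" for x
  proof -
    obtain k l where x: "x = (k, l)" by (cases x)
    define m where "m = - k - l"
    have m: "- l - m = k" "- m - k = l" "k + l + m = 0" by (auto simp: m_def)
    have rx: "rot (k, l) = (l, m)" "rot (l, m) = (m, k)" by (auto simp: rot_def m_def)
    have "P x + P (rot x) + P (rot (rot x)) = (f k + f l + f m) * Im (a k * a l * a m)"
      unfolding x rx P_def prod.case m m_def[symmetric] by (simp only: mult_ac distrib_right)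
    also have "\<bar>\<dots>\<bar> \<le> ((1 + 3 * K) * (\<bar>real_of_int k\<bar> * g l * g m + \<bar>real_of_int l\<bar> * g m * g k + \<bar>real_of_int m\<bar> * g k * g l))
        * (cmod (a k) * cmod (a l) * cmod (a m))"
      unfolding abs_mult f_def
      by (intro mult_mono symbol_bound g m order_trans[OF abs_Im_le_cmod])
        (auto simp: norm_mult slowD[OF g] intro!: mult_nonneg_nonneg add_nonneg_nonneg)
    also have "\<dots> = (1 + 3 * K) * (R x + R (rot x) + R (rot (rot x)))"
      unfolding x rx R_def prod.case m m_def[symmetric] by (simp add: algebra_simps)
    finally show ?thesis by simp
  qed
  have "\<bar>3 * infsum P UNIV\<bar> \<le> (\<Sum>\<^sub>\<infinity>x. (1 + 3 * K) * (R x + R (rot x) + R (rot (rot x))))"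
    unfolding Pc(2) real_norm_def[symmetric]
    by (rule dominated_summable(3)) (use bd Rc(1) in \<open>auto intro: summable_on_cmult_right\<close>)
  also have "\<dots> = (1 + 3 * K) * (3 * infsum R UNIV)"
    by (simp only: infsum_cmult_right' Rc(2))
  also have "\<dots> \<le> (1 + 3 * K) * (3 * (wiener_norm a * wsum g a))"
    using R(2) slowD(1)[OF g] by (intro mult_left_mono) auto
  finally show "\<bar>\<Sum>\<^sub>\<infinity>n. real_of_int n * (g n)\<^sup>2 * Im (cnj (a n) * conv a a n)\<bar>
           \<le> (1 + 3 * K) * (wiener_norm a * wsum g a)"
    unfolding eq by simp
qed

abbreviation l2 :: "(int \<Rightarrow> complex) \<Rightarrow> real" where
  "l2 \<equiv> wsum (\<lambda>_. 1)"

text \<open>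
  The part of the form that is cubic in \<open>d\<close> vanishes, so only \<open>a\<close> enters the bound.
\<close>

lemma difference_form:
  assumes cnj: "\<And>n. d (- n) = cnj (d n)" and a: "wiener a" and d: "wiener d"
    and z: "wiener z" "\<And>n. z n = 2 * a n + d n"
  shows "\<bar>\<Sum>\<^sub>\<infinity>n. real_of_int n * Im (cnj (d n) * conv z d n)\<bar> \<le> wiener_norm a * l2 d"
proof -
  define Q where "Q = (\<lambda>(m, k). real_of_int m * Im (d m * z k * d (- m - k)))"
  define U where "U x = (\<lambda>(k, m). real_of_int k * Im (x k * d m * d (- k - m)))" for x
  have Q: "Q summable_on UNIV" and eq: "(\<Sum>\<^sub>\<infinity>n. real_of_int n * Im (cnj (d n) * conv z d n)) = - infsum Q UNIV"
    using cubic_form_series[OF cnj d z(1), of real_of_int 1] by (simp_all add: Q_def)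
  have fd: "wfin (\<lambda>_. 1) d" by (rule wiener_wfin_bounded[OF d]) auto
  have U: "U x summable_on UNIV" "\<bar>infsum (U x) UNIV\<bar> \<le> wiener_norm x * l2 d" if "wiener x" for x
  proof -
    note W = weighted_trilinear_bound[OF that _ fd, simplified]
    have le: "norm (U x q) \<le> (case q of (k, l) \<Rightarrow> \<bar>real_of_int k\<bar> * cmod (x k) * (cmod (d l) * cmod (d (- k - l))))" for q
    proof -
      obtain k l where q: "q = (k, l)" by (cases q)
      show ?thesis unfolding q U_def prod.case norm_mult
        using abs_Im_le_cmod[of "x k * d l * d (- k - l)"]
        by (simp add: norm_mult mult.assoc mult_left_mono)
    qed
    show "U x summable_on UNIV" by (rule dominated_summable[OF W(1) le])
    have "\<bar>infsum (U x) UNIV\<bar> \<le> (\<Sum>\<^sub>\<infinity>(k, l). \<bar>real_of_int k\<bar> * cmod (x k) * (cmod (d l) * cmod (d (- k - l))))"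
      using dominated_summable(3)[OF W(1) le] by simp
    with W(2) show "\<bar>infsum (U x) UNIV\<bar> \<le> wiener_norm x * l2 d" by linarith
  qed
  \<comment> \<open>The symmetrised symbol is k + l + m = 0: the counterpart of the vanishing
    integral of d^2 d'.\<close>
  have Ud0: "infsum (U d) UNIV = 0"
  proof -
    have "U d x + U d (rot x) + U d (rot (rot x)) = 0" for x
    proof -
      obtain k l where x: "x = (k, l)" by (cases x)
      define m where "m = - k - l"
      have m: "- l - m = k" "- m - k = l" by (auto simp: m_def)
      have rx: "rot (k, l) = (l, m)" "rot (l, m) = (m, k)" by (auto simp: rot_def m_def)
      have "U d x + U d (rot x) + U d (rot (rot x)) = real_of_int (k + l + m) * Im (d k * d l * d m)"
        unfolding x rx U_def prod.case m m_def[symmetric] by (simp only: mult_ac distrib_right of_int_add)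
      then show ?thesis by (simp add: m_def)
    qed
    then show ?thesis using infsum_cyclic(2)[OF U(1)[OF d]] by simp
  qed
  \<comment> \<open>This exchanges the two factors d and fixes z. Averaging over it replaces the
    derivative m on d by (m + l) / 2 = - k / 2, that is, integrates by parts so that the derivative
    falls on z.\<close>
  let ?\<sigma> = "\<lambda>(m, k). (- m - k, k :: int)"
  have bij: "bij_betw ?\<sigma> UNIV (UNIV :: (int \<times> int) set)"
    by (rule bij_betwI[of _ _ _ ?\<sigma>]) auto
  have bij2: "bij_betw prod.swap UNIV (UNIV :: (int \<times> int) set)"
    by (rule bij_betwI[of _ _ _ prod.swap]) auto
  have Qs: "(\<lambda>x. Q (?\<sigma> x)) summable_on UNIV" "infsum (\<lambda>x. Q (?\<sigma> x)) UNIV = infsum Q UNIV"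
    using summable_on_reindex_bij_betw[OF bij, of Q] infsum_reindex_bij_betw[OF bij, of Q] Q by auto
  have "2 * infsum Q UNIV = (\<Sum>\<^sub>\<infinity>x. Q x + Q (?\<sigma> x))"
    using infsum_add[OF Q Qs(1)] Qs(2) by simp
  also have "\<dots> = (\<Sum>\<^sub>\<infinity>x. - (2 * U a (prod.swap x) + U d (prod.swap x)))"
  proof (rule infsum_cong)
    fix x :: "int \<times> int"
    obtain m k where x: "x = (m, k)" by (cases x)
    define l where "l = - m - k"
    have l: "- l - k = m" "- k - m = l" by (auto simp: l_def)
    have rl: "real_of_int l = - real_of_int m - real_of_int k" by (simp add: l_def)
    have "Q x + Q (?\<sigma> x) = (real_of_int m + real_of_int l) * Im (z k * d m * d l)"
      unfolding x Q_def prod.case l_def[symmetric] l(1)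
      by (simp only: mult_ac distrib_right)
    also have "\<dots> = - real_of_int k * Im ((2 * a k + d k) * d m * d l)" by (simp add: rl z(2))
    also have "\<dots> = - (2 * U a (k, m) + U d (k, m))"
    proof -
      have "(2 * a k + d k) * d m * d l = 2 * (a k * d m * d l) + d k * d m * d l"
        by (simp add: algebra_simps)
      then have "Im ((2 * a k + d k) * d m * d l) = 2 * Im (a k * d m * d l) + Im (d k * d m * d l)"
        by (simp only: plus_complex.sel) simp
      then show ?thesis unfolding U_def prod.case l(2) by (simp add: algebra_simps)
    qed
    finally show "Q x + Q (?\<sigma> x) = - (2 * U a (prod.swap x) + U d (prod.swap x))" by (simp add: x)
  qed
  also have "\<dots> = (\<Sum>\<^sub>\<infinity>x. - (2 * U a x + U d x))"
    by (rule infsum_reindex_bij_betw[OF bij2])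
  also have "\<dots> = - (2 * infsum (U a) UNIV + infsum (U d) UNIV)"
    by (simp only: infsum_uminus infsum_cmult_right'
        infsum_add[OF summable_on_cmult_right[OF U(1)[OF a]] U(1)[OF d]])
  finally have "infsum Q UNIV = - infsum (U a) UNIV" by (simp add: Ud0)
  then show ?thesis using U(2)[OF a] eq by simp
qed

section \<open>Gronwall's inequality for series\<close>

lemma nonincreasing_within:
  fixes h :: "real \<Rightarrow> real"
  assumes "a \<le> b" "\<And>t. t \<in> {a..b} \<Longrightarrow> (h has_real_derivative h' t) (at t within {a..b})"
    "\<And>t. t \<in> {a..b} \<Longrightarrow> h' t \<le> 0"
  shows "h b \<le> h a"
proof (cases "a = b")
  case False
  then have "a < b" using assms(1) by simp
  then obtain x where x: "x \<in> {a<..<b}" "h b - h a = h' x * (b - a)"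
    using mvt_simple[of a b h "\<lambda>x y. h' x * y"] assms(2) by (auto simp: has_field_derivative_def)
  moreover have "h' x * (b - a) \<le> 0" using x assms(1,3) by (intro mult_nonpos_nonneg) auto
  ultimately show ?thesis by linarith
qed simp

text \<open>The infinite sum need not be differentiated. Uniformly in time it differs by at most
  \<epsilon> from a finite partial sum, and so does the sum of the derivatives; the differential
  inequality for the partial sum holds up to a multiple of \<epsilon>, which tends to 0 at the
  end.\<close>

lemma gronwall_series:
  fixes e e' m :: "'i \<Rightarrow> real \<Rightarrow> real"
  assumes deriv: "\<And>n t. t \<in> {0..T} \<Longrightarrow> (e n has_real_derivative e' n t) (at t within {0..T})"
    and e: "\<And>n t. t \<in> {0..T} \<Longrightarrow> \<bar>e n t\<bar> \<le> m n t"
    and e': "\<And>n t. t \<in> {0..T} \<Longrightarrow> \<bar>e' n t\<bar> \<le> m n t"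
    and m: "\<And>t. t \<in> {0..T} \<Longrightarrow> (\<lambda>n. m n t) summable_on UNIV"
    and tail: "\<And>\<epsilon>. \<epsilon> > 0 \<Longrightarrow> \<exists>F. finite F \<and> (\<forall>t\<in>{0..T}. (\<Sum>\<^sub>\<infinity>n\<in>-F. m n t) \<le> \<epsilon>)"
    and le: "\<And>t. t \<in> {0..T} \<Longrightarrow> (\<Sum>\<^sub>\<infinity>n. e' n t) \<le> \<kappa> * (\<Sum>\<^sub>\<infinity>n. e n t)"
    and \<kappa>: "0 \<le> \<kappa>" and t: "t \<in> {0..T}"
  shows "(\<Sum>\<^sub>\<infinity>n. e n t) \<le> exp (\<kappa> * t) * (\<Sum>\<^sub>\<infinity>n. e n 0)"
proof -
  define D where "D = 1 + exp (\<kappa> * t) * (1 + (\<kappa> + 1) * t)"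
  have D: "D > 0" using t \<kappa> by (simp add: D_def add_pos_nonneg)
  have main: "(\<Sum>\<^sub>\<infinity>n. e n t) \<le> exp (\<kappa> * t) * (\<Sum>\<^sub>\<infinity>n. e n 0) + \<epsilon> * D" if "\<epsilon> > 0" for \<epsilon>
  proof -
    from tail[OF that] obtain F where F: "finite F" "\<And>t. t \<in> {0..T} \<Longrightarrow> (\<Sum>\<^sub>\<infinity>n\<in>-F. m n t) \<le> \<epsilon>" by blast
    have close: "\<bar>(\<Sum>\<^sub>\<infinity>n. x n \<tau>) - (\<Sum>n\<in>F. x n \<tau>)\<bar> \<le> \<epsilon>"
      if x: "\<And>n. \<bar>x n \<tau>\<bar> \<le> m n \<tau>" and \<tau>: "\<tau> \<in> {0..T}" for x :: "'i \<Rightarrow> real \<Rightarrow> real" and \<tau>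
    proof -
      have s: "(\<lambda>n. x n \<tau>) summable_on UNIV" by (rule dominated_summable(1)[OF m[OF \<tau>]]) (use x in auto)
      have s': "(\<lambda>n. x n \<tau>) summable_on (-F)" by (rule summable_on_subset_banach[OF s]) simp
      have "(\<Sum>\<^sub>\<infinity>n. x n \<tau>) = (\<Sum>n\<in>F. x n \<tau>) + (\<Sum>\<^sub>\<infinity>n\<in>-F. x n \<tau>)"
        using infsum_Un_disjoint[OF summable_on_finite[OF F(1), of "\<lambda>n. x n \<tau>"] s'] F(1) by simp
      moreover have "norm (\<Sum>\<^sub>\<infinity>n\<in>-F. x n \<tau>) \<le> (\<Sum>\<^sub>\<infinity>n\<in>-F. m n \<tau>)"
        by (rule dominated_summable(3)) (use x summable_on_subset_banach[OF m[OF \<tau>]] in auto)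
      ultimately show ?thesis using F(2)[OF \<tau>] by simp
    qed
    define S where "S t = (\<Sum>n\<in>F. e n t)" for t
    define S' where "S' t = (\<Sum>n\<in>F. e' n t)" for t
    have t0: "0 \<in> {0..T}" using t by auto
    \<comment> \<open>One \<epsilon> comes from cutting off the derivatives, \<kappa> \<epsilon>
      from cutting off the energies.\<close>
    define c where "c = (\<kappa> + 1) * \<epsilon>"
    have c: "0 \<le> c" using \<kappa> that by (simp add: c_def)
    have dS: "(S has_real_derivative S' \<tau>) (at \<tau> within {0..T})" if "\<tau> \<in> {0..T}" for \<tau>
      unfolding S_def S'_def by (intro DERIV_sum deriv that)
    have S'le: "S' \<tau> \<le> \<kappa> * S \<tau> + c" if "\<tau> \<in> {0..T}" for \<tau>
    proof -
      have 1: "\<bar>(\<Sum>\<^sub>\<infinity>n. e n \<tau>) - S \<tau>\<bar> \<le> \<epsilon>" "\<bar>(\<Sum>\<^sub>\<infinity>n. e' n \<tau>) - S' \<tau>\<bar> \<le> \<epsilon>"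
        unfolding S_def S'_def by (rule close[of e \<tau>, OF e[OF that] that] close[of e' \<tau>, OF e'[OF that] that])+
      then have "\<kappa> * (\<Sum>\<^sub>\<infinity>n. e n \<tau>) \<le> \<kappa> * (S \<tau> + \<epsilon>)" using \<kappa> by (intro mult_left_mono) linarith+
      then show ?thesis using le[OF that] 1 by (simp add: c_def algebra_simps)
    qed
    have "exp (- \<kappa> * t) * S t - c * t \<le> exp (- \<kappa> * 0) * S 0 - c * 0"
    proof (rule nonincreasing_within[where h = "\<lambda>t. exp (- \<kappa> * t) * S t - c * t" and a = 0 and b = t and h' = "\<lambda>\<tau>. exp (- \<kappa> * \<tau>) * (S' \<tau> - \<kappa> * S \<tau>) - c"])
      fix \<tau> assume \<tau>: "\<tau> \<in> {0..t}"
      then have \<tau>T: "\<tau> \<in> {0..T}" using t by auto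
      show "((\<lambda>t. exp (- \<kappa> * t) * S t - c * t) has_real_derivative exp (- \<kappa> * \<tau>) * (S' \<tau> - \<kappa> * S \<tau>) - c) (at \<tau> within {0..t})"
      proof -
        have "(S has_real_derivative S' \<tau>) (at \<tau> within {0..t})"
          by (rule DERIV_subset[OF dS[OF \<tau>T]]) (use t in auto)
        note [derivative_intros] = this
        show ?thesis by (rule derivative_eq_intros refl)+ (simp add: algebra_simps)
      qed
      have "exp (- \<kappa> * \<tau>) * (S' \<tau> - \<kappa> * S \<tau>) \<le> exp (- \<kappa> * \<tau>) * c"
        using S'le[OF \<tau>T] by (intro mult_left_mono) auto
      also have "\<dots> \<le> 1 * c" using \<tau> \<kappa> c by (intro mult_right_mono) auto
      finally show "exp (- \<kappa> * \<tau>) * (S' \<tau> - \<kappa> * S \<tau>) - c \<le> 0" by simp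
    qed (use t in auto)
    then have "exp (\<kappa> * t) * (exp (- \<kappa> * t) * S t) \<le> exp (\<kappa> * t) * (S 0 + c * t)"
      by (intro mult_left_mono) auto
    then have "S t \<le> exp (\<kappa> * t) * (S 0 + c * t)"
      by (simp add: mult.assoc[symmetric] exp_add[symmetric])
    also have "\<dots> \<le> exp (\<kappa> * t) * ((\<Sum>\<^sub>\<infinity>n. e n 0) + \<epsilon> + c * t)"
      using close[of e, OF e[OF t0] t0] unfolding S_def by (intro mult_left_mono) (linarith | simp)+
    finally have "S t \<le> exp (\<kappa> * t) * ((\<Sum>\<^sub>\<infinity>n. e n 0) + \<epsilon> + c * t)" .
    moreover have "(\<Sum>\<^sub>\<infinity>n. e n t) \<le> S t + \<epsilon>" using close[of e, OF e[OF t] t] unfolding S_def by linarith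
    ultimately show ?thesis by (simp add: D_def c_def algebra_simps)
  qed
  show ?thesis
  proof (rule field_le_epsilon)
    fix \<delta> :: real assume "\<delta> > 0"
    then show "(\<Sum>\<^sub>\<infinity>n. e n t) \<le> exp (\<kappa> * t) * (\<Sum>\<^sub>\<infinity>n. e n 0) + \<delta>"
      using main[of "\<delta> / D"] D by simp
  qed
qed

section \<open>Sobolev weights against the Wiener norm\<close>

lemma hw_summable:
  assumes p: "p < - (1/2)"
  shows "hw p summable_on UNIV"
proof -
  have "summable (\<lambda>n. hw p (int n))"
  proof (rule summable_comparison_test'[of "\<lambda>n. real n powr (2 * p)" 1])
    show "summable (\<lambda>n. real n powr (2 * p))" using p by (simp add: summable_real_powr_iff)
    fix n :: nat assume n: "1 \<le> n"
    have "hw p (int n) \<le> ((real n)\<^sup>2) powr p"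
      unfolding hw_def using n p by (intro powr_mono2') auto
    also have "\<dots> = real n powr (2 * p)"
      using n by (simp add: powr_powr[symmetric])
    finally show "norm (hw p (int n)) \<le> real n powr (2 * p)" using less_imp_le[OF hw_pos[of p "int n"]] by simp
  qed
  then have N: "(\<lambda>n. hw p (int n)) summable_on UNIV"
    by (rule summable_nonneg_imp_summable_on) (simp add: less_imp_le[OF hw_pos])
  have "hw p summable_on range int" "hw p summable_on range (\<lambda>n. - int n)"
    using N by (simp_all add: summable_on_reindex inj_def o_def) (simp add: hw_def)
  then have "hw p summable_on (range int \<union> range (\<lambda>n. - int n))" by (rule summable_on_union)
  moreover have "range int \<union> range (\<lambda>n. - int n) = UNIV"
    by (auto intro: int_cases)
  ultimately show ?thesis by simp
qed

text \<open>With <n>^2 = <n>^(2-s) <n>^s, the first factor is square summable when 2 (2 - s) < -1;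
  this is the origin of 5/2. General index sets A serve to make tails small uniformly on bounded
  sets of H^s.\<close>

lemma wien_Cauchy_Schwarz:
  assumes s: "5/2 < s" and a: "wfin (hw (s/2)) a"
  shows "wien a summable_on A"
    and "infsum (wien a) A \<le> sqrt (infsum (hw (2 - s)) A) * sqrt (wsum (hw (s/2)) a)"
proof -
  have eq: "wien a n = \<bar>hw (1 - s/2) n * (hw (s/2) n * cmod (a n))\<bar>" for n
    using hw_pos[of "1 - s/2" n] hw_pos[of "s/2" n] hw_add[of "1 - s/2" "s/2" n]
    by (simp add: wien_def hw_1)
  have h2: "(hw (1 - s/2) n)\<^sup>2 = hw (2 - s) n" for n by (simp add: hw_power2)
  have 1: "(\<lambda>n. (hw (1 - s/2) n)\<^sup>2) summable_on A"
    unfolding h2 using hw_summable[of "2 - s"] s by (auto intro: summable_on_subset_banach)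
  have 2: "(\<lambda>n. (hw (s/2) n * cmod (a n))\<^sup>2) summable_on UNIV"
    using a by (simp add: wfin_def)
  have 3: "(\<lambda>n. (hw (s/2) n * cmod (a n))\<^sup>2) summable_on A"
    by (rule summable_on_subset_banach[OF 2]) simp
  show "wien a summable_on A" using Cauchy_Schwarz_infsum(1)[OF 1 3] by (simp add: eq[abs_def])
  have "infsum (wien a) A \<le> sqrt (infsum (hw (2 - s)) A) * sqrt (\<Sum>\<^sub>\<infinity>n\<in>A. (hw (s/2) n * cmod (a n))\<^sup>2)"
    using Cauchy_Schwarz_infsum(2)[OF 1 3] by (simp add: eq[abs_def] h2)
  also have "\<dots> \<le> sqrt (infsum (hw (2 - s)) A) * sqrt (wsum (hw (s/2)) a)"
    unfolding wsum_def
    by (intro mult_left_mono real_sqrt_le_mono infsum_mono_neutral 2 3)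
      (auto intro!: infsum_nonneg less_imp_le[OF hw_pos])
  finally show "infsum (wien a) A \<le> sqrt (infsum (hw (2 - s)) A) * sqrt (wsum (hw (s/2)) a)" .
qed

lemma hw_tail:
  assumes s: "5/2 < s" and e: "0 < e" and B: "0 \<le> B"
  obtains F where "finite F" "sqrt (infsum (hw (2 - s)) (- F)) * sqrt B \<le> e"
proof -
  define q where "q = e / (1 + sqrt B)"
  have q: "q > 0" using e B by (simp add: q_def add_pos_nonneg)
  obtain F where F: "finite F" "\<bar>infsum (hw (2 - s)) (- F)\<bar> < q\<^sup>2"
    by (rule summable_tail_less[of "hw (2 - s)" "q\<^sup>2"]) (use hw_summable[of "2 - s"] s q in auto)
  have "sqrt (infsum (hw (2 - s)) (- F)) \<le> q"
    using F(2) q by (intro real_le_lsqrt) auto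
  then have "sqrt (infsum (hw (2 - s)) (- F)) * sqrt B \<le> q * (1 + sqrt B)"
    using q B by (intro mult_mono) auto
  also have "\<dots> = e"
  proof -
    have "0 < 1 + sqrt B" using B by (simp add: add_pos_nonneg)
    then show ?thesis by (simp add: q_def)
  qed
  finally show ?thesis using that F(1) by blast
qed

lemma wfin_mono:
  assumes "wfin h a" "\<And>n. 0 \<le> g n" "\<And>n. g n \<le> h n"
  shows "wfin g a" "wsum g a \<le> wsum h a"
proof -
  have le: "(g n * cmod (a n))\<^sup>2 \<le> (h n * cmod (a n))\<^sup>2" for n
    using assms by (intro power_mono mult_right_mono) auto
  show "wfin g a" unfolding wfin_def
    by (rule summable_on_comparison_test[OF _ le]) (use assms(1) in \<open>auto simp: wfin_def\<close>)
  then show "wsum g a \<le> wsum h a"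
    using assms(1) unfolding wsum_def wfin_def by (intro infsum_mono le)
qed

lemma weighted_square_le:
  assumes "0 \<le> g" "cmod c \<le> cmod a + cmod b"
  shows "(g * cmod c)\<^sup>2 \<le> 2 * (g * cmod a)\<^sup>2 + 2 * (g * cmod b)\<^sup>2"
proof -
  have "g * cmod c \<le> g * cmod a + g * cmod b"
    using mult_left_mono[OF assms(2,1)] by (simp add: distrib_left)
  then have "(g * cmod c)\<^sup>2 \<le> (g * cmod a + g * cmod b)\<^sup>2"
    using assms(1) by (intro power_mono) auto
  also have "\<dots> \<le> 2 * (g * cmod a)\<^sup>2 + 2 * (g * cmod b)\<^sup>2"
    using zero_le_power2[of "g * cmod a - g * cmod b"] unfolding power2_sum power2_diff by linarith
  finally show ?thesis .
qed

lemma wfin_combination: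
  assumes a: "wfin g a" and b: "wfin g b" and le: "\<And>n. cmod (c n) \<le> cmod (a n) + cmod (b n)"
    and g: "\<And>n. 0 \<le> g n"
  shows "wfin g c" "wsum g c \<le> 2 * wsum g a + 2 * wsum g b"
proof -
  note le2 = weighted_square_le[OF g le]
  have sm: "(\<lambda>n. 2 * (g n * cmod (a n))\<^sup>2 + 2 * (g n * cmod (b n))\<^sup>2) summable_on UNIV"
    using a b by (auto simp: wfin_def intro!: summable_on_add summable_on_cmult_right)
  show c: "wfin g c" unfolding wfin_def by (rule summable_on_comparison_test[OF sm le2]) simp
  have "wsum g c \<le> (\<Sum>\<^sub>\<infinity>n. 2 * (g n * cmod (a n))\<^sup>2 + 2 * (g n * cmod (b n))\<^sup>2)"
    unfolding wsum_def using c by (intro infsum_mono sm le2) (simp add: wfin_def)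
  also have "\<dots> = 2 * wsum g a + 2 * wsum g b"
    using a b by (simp add: wfin_def wsum_def infsum_add summable_on_cmult_right infsum_cmult_right')
  finally show "wsum g c \<le> 2 * wsum g a + 2 * wsum g b" .
qed

lemma wfin_diff:
  assumes "wfin g a" "wfin g b" "\<And>n. 0 \<le> g n"
  shows "wfin g (\<lambda>n. a n - b n)" "wsum g (\<lambda>n. a n - b n) \<le> 2 * wsum g a + 2 * wsum g b"
  using wfin_combination[of g a b "\<lambda>n. a n - b n"] assms norm_triangle_ineq4 by blast+

lemma cmod_le_l2: "wfin (\<lambda>_. 1) d \<Longrightarrow> cmod (d n) \<le> sqrt (l2 d)"
  using finite_sum_le_infsum[of "\<lambda>n. (cmod (d n))\<^sup>2" UNIV "{n}"]
  by (simp add: wfin_def wsum_def real_le_rsqrt)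

section \<open>The equation for the Fourier coefficients\<close>

text \<open>The nonlinearity is written as half the derivative of v^2, whence the factor n/2 before
  the convolution. The class consists of coefficientwise differentiable curves bounded in H^s; it is
  preserved by Galilean boosts and by time reversal, and the real symbol p keeps the linear term
  skew.\<close>

definition csol :: "(int \<Rightarrow> real) \<Rightarrow> real \<Rightarrow> real \<Rightarrow> (real \<Rightarrow> int \<Rightarrow> complex) \<Rightarrow> bool" where
  "csol p T s a \<longleftrightarrow>
     (\<forall>t\<in>{0..T}. \<forall>n. a t (- n) = cnj (a t n)) \<and>
     (\<exists>B. \<forall>t\<in>{0..T}. wfin (hw (s/2)) (a t) \<and> wsum (hw (s/2)) (a t) \<le> B) \<and>
     (\<forall>t\<in>{0..T}. \<forall>n. ((\<lambda>\<tau>. a \<tau> n) has_vector_derivative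
        (- (\<i> * of_int n / 2) * conv (a t) (a t) n - \<i> * of_real (p n) * a t n)) (at t within {0..T}))"

lemma csolD:
  assumes "csol p T s a" "t \<in> {0..T}"
  shows "a t (- n) = cnj (a t n)" "wfin (hw (s/2)) (a t)"
    "((\<lambda>\<tau>. a \<tau> n) has_vector_derivative
        (- (\<i> * of_int n / 2) * conv (a t) (a t) n - \<i> * of_real (p n) * a t n)) (at t within {0..T})"
  using assms unfolding csol_def by blast+

lemma csol_bound:
  assumes "csol p T s a"
  obtains B where "0 \<le> B" "\<And>t. t \<in> {0..T} \<Longrightarrow> wsum (hw (s/2)) (a t) \<le> B"
proof -
  obtain B where "\<forall>t\<in>{0..T}. wsum (hw (s/2)) (a t) \<le> B" using assms unfolding csol_def by blast
  then show ?thesis using that[of "max B 0"] by force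
qed

lemma csol_restrict:
  assumes "csol p T s a" "t \<le> T"
  shows "csol p t s a"
proof -
  have sub: "{0..t} \<subseteq> {0..T}" using assms(2) by auto
  show ?thesis
    using assms(1) has_vector_derivative_within_subset[OF _ sub] subsetD[OF sub]
    unfolding csol_def by meson
qed

lemma csol_wiener:
  assumes "csol p T s a" "5/2 < s"
  obtains M where "0 \<le> M" "\<And>t. t \<in> {0..T} \<Longrightarrow> wiener (a t)" "\<And>t. t \<in> {0..T} \<Longrightarrow> wiener_norm (a t) \<le> M"
proof -
  obtain B where B: "0 \<le> B" "\<And>t. t \<in> {0..T} \<Longrightarrow> wsum (hw (s/2)) (a t) \<le> B"
    by (rule csol_bound[OF assms(1)]) blast
  define M where "M = sqrt (infsum (hw (2 - s)) UNIV) * sqrt B"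
  have i0: "0 \<le> infsum (hw (2 - s)) UNIV" by (intro infsum_nonneg less_imp_le[OF hw_pos])
  show ?thesis
  proof (rule that[of M])
    show "0 \<le> M" using i0 B by (simp add: M_def)
    fix t assume t: "t \<in> {0..T}"
    note CS = wien_Cauchy_Schwarz[OF assms(2) csolD(2)[OF assms(1) t], of UNIV]
    show "wiener (a t)" by (rule CS)
    have "sqrt (infsum (hw (2 - s)) UNIV) * sqrt (wsum (hw (s/2)) (a t)) \<le> M"
      unfolding M_def using B(2)[OF t] i0 by (intro mult_left_mono) auto
    then show "wiener_norm (a t) \<le> M" using CS(2) by linarith
  qed
qed

text \<open>The H^s bound is uniform in time, hence so are the Wiener tails. This supplies the
  hypothesis \<open>tail\<close> of \<open>gronwall_series\<close>.\<close>

lemma csol_tail: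
  assumes "csol p T s a" "5/2 < s" "0 < e"
  shows "\<exists>F. finite F \<and> (\<forall>t\<in>{0..T}. infsum (wien (a t)) (- F) \<le> e)"
proof -
  obtain B where B: "0 \<le> B" "\<And>t. t \<in> {0..T} \<Longrightarrow> wsum (hw (s/2)) (a t) \<le> B"
    by (rule csol_bound[OF assms(1)]) blast
  obtain F where F: "finite F" "sqrt (infsum (hw (2 - s)) (- F)) * sqrt B \<le> e"
    by (rule hw_tail[OF assms(2,3) B(1)])
  have "infsum (wien (a t)) (- F) \<le> e" if t: "t \<in> {0..T}" for t
  proof -
    have "infsum (wien (a t)) (- F) \<le> sqrt (infsum (hw (2 - s)) (- F)) * sqrt (wsum (hw (s/2)) (a t))"
      by (rule wien_Cauchy_Schwarz[OF assms(2) csolD(2)[OF assms(1) t]])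
    also have "\<dots> \<le> sqrt (infsum (hw (2 - s)) (- F)) * sqrt B"
      using B(2)[OF t] by (intro mult_left_mono) (auto intro!: infsum_nonneg less_imp_le[OF hw_pos])
    finally show ?thesis using F(2) by linarith
  qed
  then show ?thesis using F(1) by blast
qed

text \<open>Twice the real part of \<open>cnj (x t)\<close> times the derivative of x: the term with
  the real number q contributes the real part of an imaginary number. This is where the dispersion
  leaves the estimates.\<close>

lemma has_derivative_cmod_square:
  assumes "(x has_vector_derivative (- (\<i> * of_int n / 2) * c - \<i> * of_real q * x t)) (at t within S)"
  shows "((\<lambda>t. (cmod (x t))\<^sup>2) has_real_derivative (of_int n * Im (cnj (x t) * c))) (at t within S)"
proof -
  let ?x' = "- (\<i> * of_int n / 2) * c - \<i> * of_real q * x t"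
  have R: "((\<lambda>t. Re (x t)) has_real_derivative Re ?x') (at t within S)"
    and I: "((\<lambda>t. Im (x t)) has_real_derivative Im ?x') (at t within S)"
    using bounded_linear.has_vector_derivative[OF bounded_linear_Re assms]
      bounded_linear.has_vector_derivative[OF bounded_linear_Im assms]
    by (simp_all add: has_real_derivative_iff_has_vector_derivative)
  have eq: "of_int n * Im (cnj (x t) * c) = 2 * Re (x t) * Re ?x' + 2 * Im (x t) * Im ?x'"
    by (simp add: algebra_simps)
  show ?thesis unfolding eq cmod_power2
    by (rule derivative_eq_intros R I refl)+ simp
qed

text \<open>For a bounded weight a multiple of \<open>wien (a t) n\<close> dominates both the n-th
  energy and its time derivative, so \<open>gronwall_series\<close> can be fed with
  \<open>energy_form\<close>.\<close>

lemma energy_estimate_bounded: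
  assumes a: "csol p T s a" and s: "5/2 < s" and g: "slow K g" and G: "\<And>n. g n \<le> G"
    and A0: "\<And>t. t \<in> {0..T} \<Longrightarrow> wiener_norm (a t) \<le> A0" and t: "t \<in> {0..T}"
  shows "wsum g (a t) \<le> exp ((1 + 3 * K) * A0 * t) * wsum g (a 0)"
proof -
  obtain M where M: "0 \<le> M" "\<And>t. t \<in> {0..T} \<Longrightarrow> wiener (a t)" "\<And>t. t \<in> {0..T} \<Longrightarrow> wiener_norm (a t) \<le> M"
    by (rule csol_wiener[OF a s]) blast
  \<comment> \<open>One constant for both majorants: the energies need the factor M, their
    derivatives the factor M^2.\<close>
  define C where "C = G\<^sup>2 * (M * (1 + M))"
  have C0: "0 \<le> C" using M(1) by (simp add: C_def)
  have g0: "0 \<le> g n" for n by (rule slowD(2)[OF g])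
  have gG: "(g n)\<^sup>2 \<le> G\<^sup>2" for n using g0 G by (intro power_mono)
  define e where "e n t = (g n * cmod (a t n))\<^sup>2" for n t
  define e' where "e' n t = real_of_int n * (g n)\<^sup>2 * Im (cnj (a t n) * conv (a t) (a t) n)" for n t
  define m where "m n t = C * wien (a t) n" for n t
  have A00: "0 \<le> A0" using A0[OF t] infsum_nonneg[of UNIV "wien (a t)"] wien_nonneg order_trans by blast
  have "(\<Sum>\<^sub>\<infinity>n. e n t) \<le> exp ((1 + 3 * K) * A0 * t) * (\<Sum>\<^sub>\<infinity>n. e n 0)"
  proof (rule gronwall_series[where e' = e' and m = m and T = T])
    fix n t assume t: "t \<in> {0..T}"
    show "(e n has_real_derivative e' n t) (at t within {0..T})"
      using DERIV_cmult[OF has_derivative_cmod_square[OF csolD(3)[OF a t, of n]], of "(g n)\<^sup>2"]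
      by (simp add: e_def[abs_def] e'_def power_mult_distrib mult_ac)
    have an: "cmod (a t n) \<le> M" "cmod (a t n) \<le> wien (a t) n"
      using wiener_imp(6)[OF M(2)[OF t], of n] M(3)[OF t] cmod_le_wien[of "a t" n] by linarith+
    have "cmod (a t n) * cmod (a t n) \<le> (M * (1 + M)) * wien (a t) n"
    proof -
      have "cmod (a t n) * cmod (a t n) \<le> M * wien (a t) n" by (intro mult_mono an M(1)) simp
      also have "\<dots> \<le> (M * (1 + M)) * wien (a t) n"
        using M(1) wien_nonneg[of "a t" n] by (intro mult_right_mono) (auto simp: algebra_simps)
      finally show ?thesis .
    qed
    then have "(g n)\<^sup>2 * (cmod (a t n) * cmod (a t n)) \<le> G\<^sup>2 * ((M * (1 + M)) * wien (a t) n)"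
      by (rule mult_mono[OF gG]) auto
    moreover have "e n t = (g n)\<^sup>2 * (cmod (a t n) * cmod (a t n))" "0 \<le> e n t"
      by (simp_all add: e_def power_mult_distrib power2_eq_square)
    moreover have "m n t = G\<^sup>2 * ((M * (1 + M)) * wien (a t) n)" by (simp add: m_def C_def)
    ultimately show "\<bar>e n t\<bar> \<le> m n t" by linarith
    have cv: "cmod (conv (a t) (a t) n) \<le> M * M"
      using conv_bound(2)[OF M(2)[OF t] M(2)[OF t], of n] mult_mono[OF M(3)[OF t] M(3)[OF t] M(1)]
      by (simp add: infsum_nonneg wien_nonneg)
    have "\<bar>e' n t\<bar> = (g n)\<^sup>2 * (\<bar>real_of_int n\<bar> * \<bar>Im (cnj (a t n) * conv (a t) (a t) n)\<bar>)"
      by (simp add: e'_def abs_mult)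
    also have "\<dots> \<le> G\<^sup>2 * (\<bar>real_of_int n\<bar> * (cmod (a t n) * (M * M)))"
      by (intro mult_mono gG order_refl order_trans[OF abs_Im_le_cmod])
        (auto simp: norm_mult intro!: mult_left_mono cv)
    also have "\<dots> = G\<^sup>2 * ((\<bar>real_of_int n\<bar> * cmod (a t n)) * (M * M))" by (simp add: mult_ac)
    also have "\<dots> \<le> G\<^sup>2 * (wien (a t) n * (M * (1 + M)))"
      using M(1) by (intro mult_left_mono mult_mono abs_mult_le_wien wien_nonneg) auto
    finally show "\<bar>e' n t\<bar> \<le> m n t" by (simp add: m_def C_def mult_ac)
  next
    fix t assume t: "t \<in> {0..T}"
    show "(\<lambda>n. m n t) summable_on UNIV" unfolding m_def by (intro summable_on_cmult_right M t)
    have "infsum (\<lambda>n. e' n t) UNIV \<le> (1 + 3 * K) * (wiener_norm (a t) * wsum g (a t))"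
      using energy_form(2)[OF csolD(1)[OF a t] M(2)[OF t] g G] unfolding e'_def by linarith
    also have "\<dots> \<le> (1 + 3 * K) * (A0 * wsum g (a t))"
      using slowD(1)[OF g] by (intro mult_left_mono mult_right_mono A0 t wsum_nonneg) auto
    finally show "infsum (\<lambda>n. e' n t) UNIV \<le> (1 + 3 * K) * A0 * infsum (\<lambda>n. e n t) UNIV"
      by (simp add: e_def wsum_def mult_ac)
  next
    fix \<epsilon> :: real assume "0 < \<epsilon>"
    then obtain F where F: "finite F" "\<forall>t\<in>{0..T}. infsum (wien (a t)) (- F) \<le> \<epsilon> / (C + 1)"
      using csol_tail[OF a s, of "\<epsilon> / (C + 1)"] C0 by auto
    have "(\<Sum>\<^sub>\<infinity>n\<in>-F. m n t) \<le> \<epsilon>" if "t \<in> {0..T}" for t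
    proof -
      have "(\<Sum>\<^sub>\<infinity>n\<in>-F. m n t) = C * infsum (wien (a t)) (- F)" by (simp add: m_def infsum_cmult_right')
      also have "\<dots> \<le> (C + 1) * (\<epsilon> / (C + 1))"
        using F(2) that C0 by (intro mult_mono) (auto intro!: infsum_nonneg wien_nonneg)
      also have "\<dots> = \<epsilon>" using C0 by simp
      finally show ?thesis .
    qed
    then show "\<exists>F. finite F \<and> (\<forall>t\<in>{0..T}. (\<Sum>\<^sub>\<infinity>n\<in>-F. m n t) \<le> \<epsilon>)" using F(1) by blast
  qed (use slowD(1)[OF g] A00 t in auto)
  then show ?thesis by (simp add: e_def wsum_def)
qed

text \<open>A finite partial sum over F sees only the weight truncated at its maximum on F. By
  \<open>slow_min\<close> the truncated weight has the same K, so the bounded case applies with a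
  constant independent of F.\<close>

lemma energy_estimate:
  assumes a: "csol p T s a" and s: "5/2 < s" and g: "slow K g" and fin: "wfin g (a 0)"
    and A0: "\<And>t. t \<in> {0..T} \<Longrightarrow> wiener_norm (a t) \<le> A0" and t: "t \<in> {0..T}"
  shows "wfin g (a t)" "wsum g (a t) \<le> exp ((1 + 3 * K) * A0 * t) * wsum g (a 0)"
proof -
  define E where "E = exp ((1 + 3 * K) * A0 * t) * wsum g (a 0)"
  have g0: "0 \<le> g n" for n by (rule slowD(2)[OF g])
  obtain M where M: "\<And>t. t \<in> {0..T} \<Longrightarrow> wiener (a t)"
    by (rule csol_wiener[OF a s]) blast
  have bd: "(\<Sum>n\<in>F. (g n * cmod (a t n))\<^sup>2) \<le> E" if F: "finite F" for F
  proof -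
    define c where "c = Max (insert 0 (g ` F))"
    have c: "0 \<le> c" "\<And>n. n \<in> F \<Longrightarrow> g n \<le> c" using F by (auto simp: c_def)
    let ?h = "\<lambda>n. min (g n) c"
    have h: "slow K ?h" by (rule slow_min[OF g c(1)])
    have hfin: "wfin ?h (a t)"
      by (rule wiener_wfin_bounded[OF M[OF t], of _ c]) (use g0 c in auto)
    have "(\<Sum>n\<in>F. (g n * cmod (a t n))\<^sup>2) = (\<Sum>n\<in>F. (?h n * cmod (a t n))\<^sup>2)"
      by (intro sum.cong refl) (use c in \<open>auto simp: min_def dest: antisym\<close>)
    also have "\<dots> \<le> wsum ?h (a t)"
      unfolding wsum_def using hfin F by (intro finite_sum_le_infsum) (auto simp: wfin_def)
    also have "\<dots> \<le> exp ((1 + 3 * K) * A0 * t) * wsum ?h (a 0)"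
      by (rule energy_estimate_bounded[OF a s h, of c]) (use A0 t in auto)
    also have "\<dots> \<le> E"
      unfolding E_def using g0 c(1) by (intro mult_left_mono wfin_mono(2) fin) auto
    finally show ?thesis .
  qed
  show fin: "wfin g (a t)" unfolding wfin_def
    by (rule nonneg_bdd_above_summable_on) (auto intro!: bdd_aboveI2 bd)
  show "wsum g (a t) \<le> exp ((1 + 3 * K) * A0 * t) * wsum g (a 0)"
    unfolding E_def[symmetric] unfolding wsum_def
    by (rule infsum_le_finite_sums) (use fin bd in \<open>auto simp: wfin_def\<close>)
qed

section \<open>Stability in L^2 and uniqueness\<close>

lemma infsum_diff_banach:
  fixes f g :: "'a \<Rightarrow> 'b::banach"
  assumes "f summable_on A" "g summable_on A"
  shows "(\<lambda>x. f x - g x) summable_on A" "(\<Sum>\<^sub>\<infinity>x\<in>A. f x - g x) = infsum f A - infsum g A"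
  using summable_on_add[OF assms(1), of "\<lambda>x. - g x"] infsum_add[OF assms(1), of "\<lambda>x. - g x"] assms(2)
  by (simp_all add: summable_on_uminus infsum_uminus)

lemma conv_square_diff:
  assumes "wiener a" "wiener b"
  shows "conv b b n - conv a a n = conv (\<lambda>k. a k + b k) (\<lambda>k. b k - a k) n"
proof -
  have "conv (\<lambda>k. a k + b k) (\<lambda>k. b k - a k) n
      = (\<Sum>\<^sub>\<infinity>k. (a k * b (n - k) - a k * a (n - k)) + (b k * b (n - k) - b k * a (n - k)))"
    unfolding conv_def by (intro infsum_cong) (simp add: algebra_simps)
  also have "\<dots> = (conv a b n - conv a a n) + (conv b b n - conv b a n)"
    unfolding conv_def
      infsum_add[OF infsum_diff_banach(1)[OF conv_bound(1)[OF assms] conv_bound(1)[OF assms(1,1)]]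
        infsum_diff_banach(1)[OF conv_bound(1)[OF assms(2,2)] conv_bound(1)[OF assms(2,1)]]]
      infsum_diff_banach(2)[OF conv_bound(1)[OF assms] conv_bound(1)[OF assms(1,1)]]
      infsum_diff_banach(2)[OF conv_bound(1)[OF assms(2,2)] conv_bound(1)[OF assms(2,1)]] ..
  finally show ?thesis by (simp add: conv_commute[of b a])
qed

lemma wiener_add_diff:
  assumes "wiener a" "wiener b"
  shows "wiener (\<lambda>k. a k + b k)" "wiener (\<lambda>k. b k - a k)"
    "wiener_norm (\<lambda>k. a k + b k) \<le> wiener_norm a + wiener_norm b"
    "wiener_norm (\<lambda>k. b k - a k) \<le> wiener_norm a + wiener_norm b"
proof -
  have sm: "(\<lambda>n. wien a n + wien b n) summable_on UNIV" by (intro summable_on_add assms)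
  have le: "wien (\<lambda>k. a k + b k) n \<le> wien a n + wien b n" "wien (\<lambda>k. b k - a k) n \<le> wien a n + wien b n" for n
    using mult_left_mono[OF norm_triangle_ineq[of "a n" "b n"], of "1 + (real_of_int n)\<^sup>2"]
      mult_left_mono[OF norm_triangle_ineq4[of "b n" "a n"], of "1 + (real_of_int n)\<^sup>2"]
    by (simp_all add: wien_def algebra_simps)
  show S: "wiener (\<lambda>k. a k + b k)" "wiener (\<lambda>k. b k - a k)"
    by (rule summable_on_comparison_test[OF sm le(1)] summable_on_comparison_test[OF sm le(2)], rule wien_nonneg)+
  show "wiener_norm (\<lambda>k. a k + b k) \<le> wiener_norm a + wiener_norm b"
    "wiener_norm (\<lambda>k. b k - a k) \<le> wiener_norm a + wiener_norm b"
    using infsum_mono[OF S(1) sm le(1)] infsum_mono[OF S(2) sm le(2)] by (simp_all add: infsum_add assms)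
qed

text \<open>The difference d solves a linear equation with coefficient z = a + b = 2 a + d, so
  \<open>difference_form\<close> applies. The exponent depends on a alone; the estimate is therefore
  available before anything uniform is known about b.\<close>

lemma l2_stability:
  assumes a: "csol p T s a" and b: "csol p T s b" and s: "5/2 < s"
    and A0: "\<And>t. t \<in> {0..T} \<Longrightarrow> wiener_norm (a t) \<le> A0" and t: "t \<in> {0..T}"
  shows "l2 (\<lambda>n. b t n - a t n) \<le> exp (A0 * t) * l2 (\<lambda>n. b 0 n - a 0 n)"
proof -
  obtain M1 where M1: "0 \<le> M1" "\<And>t. t \<in> {0..T} \<Longrightarrow> wiener (a t)" "\<And>t. t \<in> {0..T} \<Longrightarrow> wiener_norm (a t) \<le> M1"
    by (rule csol_wiener[OF a s]) blast
  obtain M2 where M2: "0 \<le> M2" "\<And>t. t \<in> {0..T} \<Longrightarrow> wiener (b t)" "\<And>t. t \<in> {0..T} \<Longrightarrow> wiener_norm (b t) \<le> M2"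
    by (rule csol_wiener[OF b s]) blast
  \<comment> \<open>Large enough to dominate both the factor M1 + M2 of the energies and the factor
    (M1 + M2)^2 of their derivatives.\<close>
  define C where "C = (M1 + M2) * (1 + (M1 + M2)) + (M1 + M2)"
  have C0: "0 \<le> C" using M1(1) M2(1) by (simp add: C_def)
  define d where "d t n = b t n - a t n" for t n
  define z where "z t n = a t n + b t n" for t n
  define e where "e n t = (cmod (d t n))\<^sup>2" for n t
  define e' where "e' n t = real_of_int n * Im (cnj (d t n) * conv (z t) (d t) n)" for n t
  define m where "m n t = C * (wien (a t) n + wien (b t) n)" for n t
  have A00: "0 \<le> A0" using A0[OF t] infsum_nonneg[of UNIV "wien (a t)"] wien_nonneg order_trans by blast
  have dz: "wiener (d t)" "wiener (z t)" "wiener_norm (d t) \<le> M1 + M2" "wiener_norm (z t) \<le> M1 + M2"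
    if "t \<in> {0..T}" for t
    unfolding d_def z_def using wiener_add_diff[OF M1(2)[OF that] M2(2)[OF that]] M1(3)[OF that] M2(3)[OF that]
    by auto
  have "(\<Sum>\<^sub>\<infinity>n. e n t) \<le> exp (A0 * t) * (\<Sum>\<^sub>\<infinity>n. e n 0)"
  proof (rule gronwall_series[where e' = e' and m = m and T = T])
    fix n t assume t: "t \<in> {0..T}"
    have "((\<lambda>\<tau>. d \<tau> n) has_vector_derivative (- (\<i> * of_int n / 2) * conv (z t) (d t) n - \<i> * of_real (p n) * d t n))
      (at t within {0..T})"
    proof -
      have "conv (z t) (d t) n = conv (b t) (b t) n - conv (a t) (a t) n"
        unfolding z_def d_def by (rule conv_square_diff[OF M1(2)[OF t] M2(2)[OF t], symmetric])
      then have eq: "- (\<i> * of_int n / 2) * conv (z t) (d t) n - \<i> * of_real (p n) * d t n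
         = (- (\<i> * of_int n / 2) * conv (b t) (b t) n - \<i> * of_real (p n) * b t n)
         - (- (\<i> * of_int n / 2) * conv (a t) (a t) n - \<i> * of_real (p n) * a t n)"
        unfolding \<open>conv (z t) (d t) n = _\<close> by (simp add: d_def algebra_simps)
      show ?thesis unfolding eq unfolding d_def
        by (intro has_vector_derivative_diff csolD(3)[OF a t] csolD(3)[OF b t])
    qed
    from has_derivative_cmod_square[OF this]
    show "(e n has_real_derivative e' n t) (at t within {0..T})"
      by (simp add: e_def[abs_def] e'_def)
    have w: "\<bar>real_of_int n\<bar> * cmod (d t n) \<le> wien (a t) n + wien (b t) n" "cmod (d t n) \<le> wien (a t) n + wien (b t) n"
    proof -
      have "wien (d t) n \<le> wien (a t) n + wien (b t) n"
        using mult_left_mono[OF norm_triangle_ineq4[of "b t n" "a t n"], of "1 + (real_of_int n)\<^sup>2"]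
        by (simp add: wien_def d_def algebra_simps)
      then show "\<bar>real_of_int n\<bar> * cmod (d t n) \<le> wien (a t) n + wien (b t) n" "cmod (d t n) \<le> wien (a t) n + wien (b t) n"
        using abs_mult_le_wien[of n "d t"] cmod_le_wien[of "d t" n] by linarith+
    qed
    have w0: "0 \<le> wien (a t) n + wien (b t) n" by (intro add_nonneg_nonneg wien_nonneg)
    have dM: "cmod (d t n) \<le> M1 + M2" using wiener_imp(6)[OF dz(1)[OF t], of n] dz(3)[OF t] by linarith
    have "cmod (d t n) * cmod (d t n) \<le> (M1 + M2) * (wien (a t) n + wien (b t) n)"
      using M1(1) M2(1) by (intro mult_mono dM w) auto
    also have "\<dots> \<le> C * (wien (a t) n + wien (b t) n)"
      using M1(1) M2(1) by (intro mult_right_mono w0) (simp add: C_def)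
    finally show "\<bar>e n t\<bar> \<le> m n t" by (simp add: e_def m_def power2_eq_square)
    have cv: "cmod (conv (z t) (d t) n) \<le> (M1 + M2) * (M1 + M2)"
      using conv_bound(2)[OF dz(2)[OF t] dz(1)[OF t], of n] mult_mono[OF dz(4)[OF t] dz(3)[OF t]] M1(1) M2(1)
      by (simp add: infsum_nonneg wien_nonneg)
    have "\<bar>e' n t\<bar> = \<bar>real_of_int n\<bar> * \<bar>Im (cnj (d t n) * conv (z t) (d t) n)\<bar>"
      by (simp add: e'_def abs_mult)
    also have "\<dots> \<le> \<bar>real_of_int n\<bar> * (cmod (d t n) * ((M1 + M2) * (M1 + M2)))"
      by (intro mult_left_mono order_trans[OF abs_Im_le_cmod])
        (auto simp: norm_mult intro!: mult_left_mono cv)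
    also have "\<dots> = (\<bar>real_of_int n\<bar> * cmod (d t n)) * ((M1 + M2) * (M1 + M2))" by (simp add: mult_ac)
    also have "\<dots> \<le> (wien (a t) n + wien (b t) n) * C"
      using M1(1) M2(1) by (intro mult_mono w w0) (auto simp: C_def algebra_simps)
    finally show "\<bar>e' n t\<bar> \<le> m n t" by (simp add: m_def mult_ac)
  next
    fix t assume t: "t \<in> {0..T}"
    show "(\<lambda>n. m n t) summable_on UNIV" unfolding m_def by (intro summable_on_cmult_right summable_on_add M1 M2 t)
    have dc: "d t (- n) = cnj (d t n)" for n
      using csolD(1)[OF a t, of n] csolD(1)[OF b t, of n] by (simp add: d_def)
    have "infsum (\<lambda>n. e' n t) UNIV \<le> wiener_norm (a t) * l2 (d t)"
      using difference_form[OF dc M1(2)[OF t] dz(1,2)[OF t]] unfolding e'_def by (simp add: z_def d_def abs_le_iff)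
    also have "\<dots> \<le> A0 * l2 (d t)" by (intro mult_right_mono A0 t wsum_nonneg)
    finally show "infsum (\<lambda>n. e' n t) UNIV \<le> A0 * infsum (\<lambda>n. e n t) UNIV"
      by (simp add: e_def wsum_def)
  next
    fix \<epsilon> :: real assume "0 < \<epsilon>"
    then have "0 < \<epsilon> / (2 * (C + 1))" using C0 by simp
    then obtain F1 F2 where F: "finite F1" "\<forall>t\<in>{0..T}. infsum (wien (a t)) (- F1) \<le> \<epsilon> / (2 * (C + 1))"
        "finite F2" "\<forall>t\<in>{0..T}. infsum (wien (b t)) (- F2) \<le> \<epsilon> / (2 * (C + 1))"
      using csol_tail[OF a s] csol_tail[OF b s] by meson
    have "(\<Sum>\<^sub>\<infinity>n\<in>-(F1 \<union> F2). m n t) \<le> \<epsilon>" if t: "t \<in> {0..T}" for t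
    proof -
      have sub: "wien (a t) summable_on A" "wien (b t) summable_on A" for A
        by (rule summable_on_subset_banach[OF M1(2)[OF t]] summable_on_subset_banach[OF M2(2)[OF t]], simp)+
      have 1: "infsum (wien (a t)) (- (F1 \<union> F2)) \<le> infsum (wien (a t)) (- F1)"
        "infsum (wien (b t)) (- (F1 \<union> F2)) \<le> infsum (wien (b t)) (- F2)"
        by (intro infsum_mono2 sub; use wien_nonneg in auto)+
      have "(\<Sum>\<^sub>\<infinity>n\<in>-(F1 \<union> F2). m n t) = C * (infsum (wien (a t)) (- (F1 \<union> F2)) + infsum (wien (b t)) (- (F1 \<union> F2)))"
        unfolding m_def infsum_cmult_right' by (simp only: infsum_add[OF sub])
      also have "\<dots> \<le> (C + 1) * (\<epsilon> / (C + 1))"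
      proof (intro mult_mono)
        have "infsum (wien (a t)) (- (F1 \<union> F2)) + infsum (wien (b t)) (- (F1 \<union> F2)) \<le> \<epsilon> / (2 * (C + 1)) + \<epsilon> / (2 * (C + 1))"
          using 1 bspec[OF F(2) t] bspec[OF F(4) t] by linarith
        also have "\<dots> = \<epsilon> / (C + 1)" using field_sum_of_halves[of "\<epsilon> / (C + 1)"]
          by (simp only: divide_divide_eq_left mult.commute)
        finally show "infsum (wien (a t)) (- (F1 \<union> F2)) + infsum (wien (b t)) (- (F1 \<union> F2)) \<le> \<epsilon> / (C + 1)" .
      qed (use C0 in \<open>auto intro!: add_nonneg_nonneg infsum_nonneg wien_nonneg\<close>)
      also have "\<dots> = \<epsilon>" using C0 by simp
      finally show ?thesis .
    qed
    then show "\<exists>F. finite F \<and> (\<forall>t\<in>{0..T}. (\<Sum>\<^sub>\<infinity>n\<in>-F. m n t) \<le> \<epsilon>)" using F(1,3) by blast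
  qed (use A00 t in auto)
  then show ?thesis by (simp add: e_def wsum_def d_def)
qed

lemma csol_unique:
  assumes a: "csol p T s a" and b: "csol p T s b" and s: "5/2 < s" and "b 0 = a 0" and t: "t \<in> {0..T}"
  shows "b t = a t"
proof -
  obtain M where M: "0 \<le> M" "\<And>t. t \<in> {0..T} \<Longrightarrow> wiener (a t)" "\<And>t. t \<in> {0..T} \<Longrightarrow> wiener_norm (a t) \<le> M"
    by (rule csol_wiener[OF a s]) blast
  obtain M2 where M2: "\<And>t. t \<in> {0..T} \<Longrightarrow> wiener (b t)"
    by (rule csol_wiener[OF b s]) blast
  have "l2 (\<lambda>n. b t n - a t n) \<le> 0"
    using l2_stability[OF a b s M(3) t] assms(4) by (simp add: wsum_def)
  moreover have "wfin (\<lambda>_. 1) (\<lambda>n. b t n - a t n)"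
    by (rule wiener_wfin_bounded[OF wiener_add_diff(2)[OF M(2)[OF t] M2[OF t]]]) auto
  ultimately have "cmod (b t n - a t n) \<le> 0" for n
    using cmod_le_l2[of "\<lambda>n. b t n - a t n" n] wsum_nonneg[of "\<lambda>_. 1" "\<lambda>n. b t n - a t n"] by simp
  then show ?thesis by (intro ext) simp
qed

section \<open>Stability in the Sobolev norm\<close>

text \<open>At the first time where h reaches c, the bound h \<le> c has held so far, and
  \<open>step\<close> then contradicts equality.\<close>

lemma bootstrap:
  fixes h :: "real \<Rightarrow> real"
  assumes cont: "continuous_on {0..T} h" and h0: "h 0 < c"
    and step: "\<And>t. t \<in> {0..T} \<Longrightarrow> (\<And>\<tau>. \<tau> \<in> {0..t} \<Longrightarrow> h \<tau> \<le> c) \<Longrightarrow> h t < c"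
    and t: "t \<in> {0..T}"
  shows "h t < c"
proof (rule ccontr)
  assume "\<not> h t < c"
  define S where "S = {x \<in> {0..T}. c \<le> h x}"
  have "closed S" unfolding S_def
    by (intro continuous_on_closed_Collect_le cont continuous_intros)
  then have "compact ({0..T} \<inter> S)" by (intro compact_Int_closed compact_Icc)
  moreover have "{0..T} \<inter> S = S" by (auto simp: S_def)
  ultimately have "compact S" by simp
  moreover have "S \<noteq> {}" using t \<open>\<not> h t < c\<close> by (auto simp: S_def)
  ultimately obtain x where x: "x \<in> S" "\<And>y. y \<in> S \<Longrightarrow> x \<le> y" using compact_attains_inf by metis
  have xT: "x \<in> {0..T}" "c \<le> h x" using x(1) by (auto simp: S_def)
  have "continuous_on {0..x} h" by (rule continuous_on_subset[OF cont]) (use xT in auto)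
  then obtain y where y: "0 \<le> y" "y \<le> x" "h y = c" using IVT'[of h 0 c x] h0 xT by auto
  then have "y \<in> S" using xT by (auto simp: S_def)
  then have "y = x" using x(2) y by force
  then have hx: "h x = c" using y by simp
  have "h x < c"
  proof (rule step[OF xT(1)])
    fix \<tau> assume \<tau>: "\<tau> \<in> {0..x}"
    show "h \<tau> \<le> c"
    proof (rule ccontr)
      assume "\<not> h \<tau> \<le> c"
      then have "\<tau> \<in> S" using \<tau> xT by (auto simp: S_def)
      then have "\<tau> = x" using x(2) \<tau> by force
      then show False using \<open>\<not> h \<tau> \<le> c\<close> hx by simp
    qed
  qed
  then show False using hx by simp
qed

text \<open>On the finite set F the L^2 norm controls every mode; off F the small tail of
  \<open>hw (2 - s)\<close> is played against the H^s norm. Hence closeness in L^2 together with an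
  H^s bound gives closeness in the Wiener norm.\<close>

lemma wiener_interpolation:
  assumes s: "5/2 < s" and d: "wfin (hw (s/2)) d" and F: "finite F"
  shows "wiener_norm d \<le> (\<Sum>n\<in>F. hw 1 n) * sqrt (l2 d) + sqrt (infsum (hw (2 - s)) (- F)) * sqrt (wsum (hw (s/2)) d)"
proof -
  have l2: "wfin (\<lambda>_. 1) d" using wfin_mono(1)[OF d, of "\<lambda>_. 1"] hw_ge_1[of "s/2"] s by simp
  have "wiener_norm d = sum (wien d) F + infsum (wien d) (- F)"
    using infsum_Un_disjoint[OF summable_on_finite[OF F, of "wien d"] wien_Cauchy_Schwarz(1)[OF s d, of "- F"]] F by simp
  moreover have "sum (wien d) F \<le> (\<Sum>n\<in>F. hw 1 n) * sqrt (l2 d)"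
    unfolding sum_distrib_right wien_def hw_1[symmetric]
    by (intro sum_mono mult_left_mono cmod_le_l2 l2 less_imp_le[OF hw_pos])
  ultimately show ?thesis using wien_Cauchy_Schwarz(2)[OF s d, of "- F"] by simp
qed

lemma l2_le_hs:
  assumes "0 \<le> s" "wfin (hw (s/2)) d"
  shows "wfin (\<lambda>_. 1) d" "l2 d \<le> wsum (hw (s/2)) d"
  using wfin_mono[OF assms(2), of "\<lambda>_. 1"] hw_ge_1[of "s/2"] assms(1) by simp_all

lemma wiener_norm_nonneg: "0 \<le> wiener_norm a"
  by (intro infsum_nonneg wien_nonneg)

lemma csol_initial_bound:
  assumes a: "csol p T s a" and b: "csol p T s b" and T: "0 \<le> T"
  shows "wfin (hw (s/2)) (\<lambda>n. b 0 n - a 0 n)"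
    and "wsum (hw (s/2)) (b 0) \<le> 2 * wsum (hw (s/2)) (a 0) + 2 * wsum (hw (s/2)) (\<lambda>n. b 0 n - a 0 n)"
proof -
  have 0: "0 \<in> {0..T}" using T by simp
  have g: "0 \<le> hw (s/2) n" for n by (rule less_imp_le[OF hw_pos])
  show d: "wfin (hw (s/2)) (\<lambda>n. b 0 n - a 0 n)"
    by (rule wfin_diff(1)[OF csolD(2)[OF b 0] csolD(2)[OF a 0] g])
  show "wsum (hw (s/2)) (b 0) \<le> 2 * wsum (hw (s/2)) (a 0) + 2 * wsum (hw (s/2)) (\<lambda>n. b 0 n - a 0 n)"
    by (rule wfin_combination(2)[OF csolD(2)[OF a 0] d _ g])
      (metis add.commute diff_add_cancel norm_triangle_ineq)
qed

text \<open>A bootstrap: as long as the Wiener norm of b is at most M + 1, the energy estimate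
  bounds b in H^s by a constant fixed beforehand; with L^2 stability, interpolation brings b within
  1/2 of a in the Wiener norm, which improves the assumed bound.\<close>

lemma wiener_stability:
  assumes a: "csol p T s a" and s: "5/2 < s" and T: "0 \<le> T"
    and M: "\<And>t. t \<in> {0..T} \<Longrightarrow> wiener_norm (a t) \<le> M"
  shows "\<exists>\<delta>>0. \<forall>b. csol p T s b \<and> wsum (hw (s/2)) (\<lambda>n. b 0 n - a 0 n) < \<delta> \<longrightarrow>
           (\<forall>t\<in>{0..T}. wiener_norm (b t) \<le> M + 1)"
proof -
  obtain B where B: "0 \<le> B" "\<And>t. t \<in> {0..T} \<Longrightarrow> wsum (hw (s/2)) (a t) \<le> B"
    by (rule csol_bound[OF a]) blast
  obtain Ma where Ma: "\<And>t. t \<in> {0..T} \<Longrightarrow> wiener (a t)" by (rule csol_wiener[OF a s]) blast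
  obtain K where K: "slow K (hw (s/2))" using slow_hw[of "s/2"] s by auto
  have T0: "0 \<in> {0..T}" using T by simp
  have M0: "0 \<le> M" using wiener_norm_nonneg M[OF T0] by (rule order_trans)
  define \<kappa> where "\<kappa> = (1 + 3 * K) * (M + 1)"
  have \<kappa>: "0 \<le> \<kappa>" using slowD(1)[OF K] M0 by (simp add: \<kappa>_def)
  \<comment> \<open>The bound on b in H^s during the bootstrap; 2B + 2 bounds the initial energy of
    b when its distance from that of a is at most 1.\<close>
  define B' where "B' = exp (\<kappa> * T) * (2 * B + 2)"
  have B': "0 \<le> B'" using B by (simp add: B'_def)
  obtain F where F: "finite F" "sqrt (infsum (hw (2 - s)) (- F)) * sqrt (2 * B' + 2 * B) \<le> 1/4"
    by (rule hw_tail[OF s, of "1/4" "2 * B' + 2 * B"]) (use B B' in auto)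
  define C where "C = (\<Sum>n\<in>F. hw 1 n)"
  have C: "0 \<le> C" by (auto simp: C_def intro!: sum_nonneg less_imp_le[OF hw_pos])
  define Z where "Z = infsum (hw (2 - s)) UNIV"
  have Z: "0 \<le> Z" by (auto simp: Z_def intro!: infsum_nonneg less_imp_le[OF hw_pos])
  define q where "q = 1 / (4 * (1 + C) * sqrt (exp (M * T)))"
  have q: "0 < q" using C by (simp add: q_def)
  \<comment> \<open>The entry 1 is used for B'; \<open>q\<^sup>2\<close> keeps the part of the
    Wiener distance on F below 1/4 up to time T; the last entry keeps the initial Wiener distance
    below 1/2.\<close>
  define \<delta> where "\<delta> = min 1 (min (q\<^sup>2) ((1 / (2 * (1 + sqrt Z)))\<^sup>2))"
  have sZ: "0 < 1 + sqrt Z" using Z by (simp add: add_pos_nonneg)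
  have \<delta>: "0 < \<delta>" using q sZ by (simp add: \<delta>_def)
  show ?thesis
  proof (intro exI[of _ \<delta>] conjI \<delta> allI impI ballI)
    fix b t assume "csol p T s b \<and> wsum (hw (s/2)) (\<lambda>n. b 0 n - a 0 n) < \<delta>" and t: "t \<in> {0..T}"
    then have b: "csol p T s b" and small: "wsum (hw (s/2)) (\<lambda>n. b 0 n - a 0 n) < \<delta>" by auto
    define d where "d t = (\<lambda>n. b t n - a t n)" for t
    have hd: "wfin (hw (s/2)) (d t)" "wsum (hw (s/2)) (d t) \<le> 2 * wsum (hw (s/2)) (b t) + 2 * wsum (hw (s/2)) (a t)"
      if "t \<in> {0..T}" for t
      unfolding d_def using wfin_diff[OF csolD(2)[OF b that] csolD(2)[OF a that]] less_imp_le[OF hw_pos] by blast+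
    obtain Mb where Mb: "\<And>t. t \<in> {0..T} \<Longrightarrow> wiener (b t)" by (rule csol_wiener[OF b s]) blast
    have ba: "wiener_norm (b t) \<le> M + wiener_norm (d t)" if "t \<in> {0..T}" for t
    proof -
      have "wiener_norm (\<lambda>k. a t k + d t k) \<le> wiener_norm (a t) + wiener_norm (d t)"
        using wiener_add_diff(3)[OF Ma[OF that], of "d t"] wiener_add_diff(2)[OF Ma[OF that] Mb[OF that]] by (simp add: d_def)
      then show ?thesis using M[OF that] by (simp add: d_def)
    qed
    have l2d: "l2 (d t) \<le> exp (M * t) * l2 (d 0)" if "t \<in> {0..T}" for t
      unfolding d_def by (rule l2_stability[OF a b s M that])
    have l20: "l2 (d 0) \<le> \<delta>" using l2_le_hs(2)[of s "d 0"] hd(1)[OF T0] s small by (simp add: d_def)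
    have start: "wiener_norm (b 0) \<le> M + 1/2"
    proof -
      have "wiener_norm (d 0) \<le> sqrt Z * sqrt \<delta>"
      proof -
        have "wiener_norm (d 0) \<le> sqrt Z * sqrt (wsum (hw (s/2)) (d 0))"
          unfolding Z_def by (rule wien_Cauchy_Schwarz(2)[OF s hd(1)[OF T0]])
        also have "\<dots> \<le> sqrt Z * sqrt \<delta>" using small Z by (intro mult_left_mono) (auto simp: d_def)
        finally show ?thesis .
      qed
      also have "sqrt \<delta> \<le> 1 / (2 * (1 + sqrt Z))"
        using sZ by (intro real_le_lsqrt) (auto simp: \<delta>_def)
      then have "sqrt Z * sqrt \<delta> \<le> (1 + sqrt Z) * (1 / (2 * (1 + sqrt Z)))"
        using Z \<delta> by (intro mult_mono) auto
      also have "\<dots> = 1/2" using sZ by simp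
      finally show ?thesis using ba[OF T0] by linarith
    qed
    obtain G where G: "finite G" "\<forall>t\<in>{0..T}. infsum (wien (b t)) (- G) \<le> 1/4"
      using csol_tail[OF b s, of "1/4"] by auto
    \<comment> \<open>A finite partial sum is continuous in time because each coefficient is. The
      omitted tail is at most 1/4, so the threshold M + 3/4 for h amounts to M + 1 for the full
      norm, and the improved bound M + 1/2 lies strictly below it.\<close>
    define h where "h t = sum (wien (b t)) G" for t
    have split: "wiener_norm (b t) = h t + infsum (wien (b t)) (- G)" if "t \<in> {0..T}" for t
      using infsum_Un_disjoint[OF summable_on_finite[OF G(1), of "wien (b t)"] summable_on_subset_banach[OF Mb[OF that]], of "- G"] G(1)
      by (simp add: h_def)
    have h_le: "h t \<le> wiener_norm (b t)" if "t \<in> {0..T}" for t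
      using split[OF that] infsum_nonneg[of "- G" "wien (b t)"] wien_nonneg by auto
    have hc: "h t < M + 3/4"
    proof (rule bootstrap[OF _ _ _ t])
      have "continuous_on {0..T} (\<lambda>t. b t n)" for n
        by (rule continuous_on_vector_derivative) (rule csolD(3)[OF b])
      then show "continuous_on {0..T} h"
        unfolding h_def wien_def by (intro continuous_intros)
      show "h 0 < M + 3/4" using start h_le[OF T0] by linarith
      fix t assume t: "t \<in> {0..T}" and le: "\<And>\<tau>. \<tau> \<in> {0..t} \<Longrightarrow> h \<tau> \<le> M + 3/4"
      have w: "wiener_norm (b \<tau>) \<le> M + 1" if "\<tau> \<in> {0..t}" for \<tau>
      proof -
        have \<tau>: "\<tau> \<in> {0..T}" using that t by auto
        then show ?thesis using split[OF \<tau>] bspec[OF G(2) \<tau>] le[OF that] by linarith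
      qed
      have "wsum (hw (s/2)) (b t) \<le> exp (\<kappa> * t) * wsum (hw (s/2)) (b 0)"
        unfolding \<kappa>_def
        by (rule energy_estimate(2)[OF csol_restrict[OF b] s K csolD(2)[OF b T0] w]) (use t in auto)
      also have "\<dots> \<le> exp (\<kappa> * T) * (2 * B + 2)"
      proof (rule mult_mono)
        show "exp (\<kappa> * t) \<le> exp (\<kappa> * T)" using t \<kappa> by (auto intro: mult_left_mono)
        show "wsum (hw (s/2)) (b 0) \<le> 2 * B + 2"
          using csol_initial_bound(2)[OF a b T] B(2)[OF T0] small by (simp add: \<delta>_def)
      qed (auto simp: wsum_nonneg)
      finally have bB': "wsum (hw (s/2)) (b t) \<le> B'" by (simp add: B'_def)
      have "wiener_norm (d t) \<le> C * sqrt (l2 (d t)) + sqrt (infsum (hw (2 - s)) (- F)) * sqrt (wsum (hw (s/2)) (d t))"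
        unfolding C_def by (rule wiener_interpolation[OF s hd(1)[OF t] F(1)])
      also have "C * sqrt (l2 (d t)) \<le> 1/4"
      proof -
        have "l2 (d t) \<le> exp (M * T) * q\<^sup>2"
        proof -
          have "l2 (d t) \<le> exp (M * t) * l2 (d 0)" by (rule l2d[OF t])
          also have "\<dots> \<le> exp (M * T) * q\<^sup>2"
          proof (rule mult_mono)
            show "exp (M * t) \<le> exp (M * T)" using t M0 by (auto intro: mult_left_mono)
          qed (use l20 in \<open>auto simp: wsum_nonneg \<delta>_def\<close>)
          finally show ?thesis .
        qed
        then have "sqrt (l2 (d t)) \<le> sqrt (exp (M * T) * q\<^sup>2)" by (rule real_sqrt_le_mono)
        also have "\<dots> = sqrt (exp (M * T)) * q" using q by (simp add: real_sqrt_mult)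
        finally have "C * sqrt (l2 (d t)) \<le> (1 + C) * (sqrt (exp (M * T)) * q)"
          using C by (intro mult_mono) (auto simp: wsum_nonneg)
        also have "\<dots> = 1/4" using C by (simp add: q_def)
        finally show ?thesis .
      qed
      also have "sqrt (infsum (hw (2 - s)) (- F)) * sqrt (wsum (hw (s/2)) (d t)) \<le> 1/4"
      proof -
        have "wsum (hw (s/2)) (d t) \<le> 2 * B' + 2 * B" using hd(2)[OF t] bB' B(2)[OF t] by linarith
        then have "sqrt (infsum (hw (2 - s)) (- F)) * sqrt (wsum (hw (s/2)) (d t))
           \<le> sqrt (infsum (hw (2 - s)) (- F)) * sqrt (2 * B' + 2 * B)"
          by (intro mult_left_mono) (auto intro!: infsum_nonneg less_imp_le[OF hw_pos])
        then show ?thesis using F(2) by linarith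
      qed
      finally have "wiener_norm (d t) \<le> 1/2" by simp
      then show "h t < M + 3/4" using ba[OF t] h_le[OF t] by linarith
    qed
    then show "wiener_norm (b t) \<le> M + 1" using split[OF t] bspec[OF G(2) t] by linarith
  qed
qed

section \<open>Propagation of small tails\<close>

text \<open>This weight is small below frequency \<open>R\<close> and equals the Sobolev weight above.\<close>

definition highpass :: "real \<Rightarrow> real \<Rightarrow> int \<Rightarrow> real" where
  "highpass s R n = hw (s/2) n * min (1 / R * hw (1/2) n) 1"

text \<open>The constant has to be independent of R, since R is chosen only after the growth factor
  of the energy estimate is known.\<close>

lemma slow_highpass:
  assumes "0 \<le> s"
  shows "\<exists>K. \<forall>R>0. slow K (highpass s R)"
proof -
  obtain K L where "slow K (hw (s/2))" "slow L (hw (1/2))"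
    using slow_hw[of "s/2"] slow_hw[of "1/2"] assms by auto
  then have "slow (K * (1 + L) + L) (highpass s R)" if "R > 0" for R
    unfolding highpass_def using that by (intro slow_mult slow_min slow_cmult) auto
  then show ?thesis by blast
qed

lemma highpass_le: "highpass s R n \<le> hw (s/2) n"
  unfolding highpass_def using hw_pos[of "s/2" n] by (simp add: mult_le_cancel_left1)

lemma highpass_nonneg: "0 < R \<Longrightarrow> 0 \<le> highpass s R n"
  unfolding highpass_def using hw_pos[of "s/2" n] hw_pos[of "1/2" n] by simp

lemma highpass_small:
  assumes x: "wfin (hw (s/2)) x" and e: "0 < e"
  obtains R where "1 \<le> R" "wsum (highpass s R) x \<le> e"
proof -
  let ?f = "\<lambda>n. (hw (s/2) n * cmod (x n))\<^sup>2"
  have fs: "?f summable_on UNIV" using x by (simp add: wfin_def)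
  obtain F where F: "finite F" "\<bar>infsum ?f (- F)\<bar> < e/2"
    by (rule summable_tail_less[OF fs, of "e/2"]) (use e in auto)
  define C where "C = (\<Sum>n\<in>F. (hw (s/2) n * hw (1/2) n * cmod (x n))\<^sup>2)"
  have C: "0 \<le> C" by (simp add: C_def sum_nonneg)
  \<comment> \<open>Then R \<ge> 1 gives (1/R)^2 \<le> 1/R, and the modes in F contribute at most C
    / R \<le> e/2.\<close>
  define R where "R = 1 + 2 * C / e"
  have R1: "1 \<le> R" using C e by (simp add: R_def)
  have R0: "0 < R" using R1 by simp
  let ?g = "\<lambda>n. (highpass s R n * cmod (x n))\<^sup>2"
  have g_le: "?g n \<le> ?f n" for n
    by (intro power_mono mult_right_mono highpass_le mult_nonneg_nonneg highpass_nonneg R0) auto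
  have gs: "?g summable_on UNIV" by (rule summable_on_comparison_test[OF fs g_le]) simp
  have "wsum (highpass s R) x = sum ?g F + infsum ?g (- F)"
    using infsum_Un_disjoint[OF summable_on_finite[OF F(1), of ?g] summable_on_subset_banach[OF gs], of "- F"] F(1)
    by (simp add: wsum_def)
  also have "infsum ?g (- F) \<le> infsum ?f (- F)"
    by (rule infsum_mono[OF summable_on_subset_banach[OF gs] summable_on_subset_banach[OF fs] g_le]) auto
  also have "sum ?g F \<le> C * (1 / R)"
  proof -
    have "?g n \<le> (hw (s/2) n * hw (1/2) n * cmod (x n))\<^sup>2 * (1 / R)" for n
    proof -
      have "highpass s R n \<le> hw (s/2) n * (1 / R * hw (1/2) n)"
        unfolding highpass_def using hw_pos[of "s/2" n] by (intro mult_left_mono) auto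
      then have "highpass s R n * cmod (x n) \<le> (hw (s/2) n * (1 / R * hw (1/2) n)) * cmod (x n)"
        by (intro mult_right_mono) auto
      then have "?g n \<le> ((hw (s/2) n * (1 / R * hw (1/2) n)) * cmod (x n))\<^sup>2"
        using highpass_nonneg[OF R0, of s n] by (intro power_mono) auto
      also have "\<dots> = (hw (s/2) n * hw (1/2) n * cmod (x n))\<^sup>2 * (1 / R)\<^sup>2"
        by (simp add: power_mult_distrib power_divide)
      also have "\<dots> \<le> (hw (s/2) n * hw (1/2) n * cmod (x n))\<^sup>2 * (1 / R)"
      proof (rule mult_left_mono)
        have "(1 / R) * (1 / R) \<le> 1 * (1 / R)" using R1 by (intro mult_right_mono) auto
        then show "(1 / R)\<^sup>2 \<le> 1 / R" by (simp add: power2_eq_square)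
      qed simp
      finally show ?thesis .
    qed
    then show ?thesis unfolding C_def sum_distrib_right by (intro sum_mono)
  qed
  also have "C * (1 / R) \<le> e/2"
  proof -
    have "C \<le> e/2 * R" using e C by (simp add: R_def algebra_simps)
    then show ?thesis using R0 by (simp add: divide_le_eq)
  qed
  finally show ?thesis using that[OF R1] F(2) by linarith
qed

text \<open>Here \<open>hw (1/2) n\<close> is <n>. Where <n> \<ge> R the two weights coincide;
  elsewhere the Sobolev weight is at most R^s, and the L^2 norm takes over.\<close>

lemma highpass_split:
  assumes s: "0 \<le> s" and R: "1 \<le> R" and x: "wfin (hw (s/2)) x" and y: "wfin (hw (s/2)) y"
  shows "wsum (hw (s/2)) (\<lambda>n. x n - y n)
     \<le> (R powr s)\<^sup>2 * l2 (\<lambda>n. x n - y n) + 2 * wsum (highpass s R) x + 2 * wsum (highpass s R) y"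
proof -
  have g: "0 \<le> hw (s/2) n" for n by (rule less_imp_le[OF hw_pos])
  have hp: "0 \<le> highpass s R n" for n using highpass_nonneg[of R] R by simp
  note d = wfin_diff(1)[OF x y g]
  have hx: "wfin (highpass s R) x" and hy: "wfin (highpass s R) y"
    using wfin_mono(1)[OF x hp highpass_le] wfin_mono(1)[OF y hp highpass_le] by auto
  note hd = wfin_diff[OF hx hy hp]
  note ld = l2_le_hs(1)[OF s d]
  have le: "(hw (s/2) n * cmod (x n - y n))\<^sup>2 \<le> (R powr s)\<^sup>2 * (cmod (x n - y n))\<^sup>2 + (highpass s R n * cmod (x n - y n))\<^sup>2" for n
  proof (cases "R \<le> hw (1/2) n")
    case True
    then have "highpass s R n = hw (s/2) n" using R by (simp add: highpass_def)
    then show ?thesis by simp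
  next
    case False
    have "hw (s/2) n = hw (1/2) n powr s"
      by (simp add: hw_def powr_powr)
    also have "\<dots> \<le> R powr s" using False s hw_pos[of "1/2" n] by (intro powr_mono2) auto
    finally have "(hw (s/2) n * cmod (x n - y n))\<^sup>2 \<le> (R powr s * cmod (x n - y n))\<^sup>2"
      by (intro power_mono mult_right_mono mult_nonneg_nonneg g) auto
    then show ?thesis unfolding power_mult_distrib[of "R powr s"] by (rule order_trans) simp
  qed
  have sm: "(\<lambda>n. (R powr s)\<^sup>2 * (cmod (x n - y n))\<^sup>2) summable_on UNIV" "(\<lambda>n. (highpass s R n * cmod (x n - y n))\<^sup>2) summable_on UNIV"
    using ld hd(1) by (auto simp: wfin_def intro: summable_on_cmult_right)
  have "wsum (hw (s/2)) (\<lambda>n. x n - y n)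
     \<le> (\<Sum>\<^sub>\<infinity>n. (R powr s)\<^sup>2 * (cmod (x n - y n))\<^sup>2 + (highpass s R n * cmod (x n - y n))\<^sup>2)"
    unfolding wsum_def using d by (intro infsum_mono summable_on_add sm le) (simp add: wfin_def)
  also have "\<dots> = (R powr s)\<^sup>2 * l2 (\<lambda>n. x n - y n) + wsum (highpass s R) (\<lambda>n. x n - y n)"
    by (simp add: infsum_add[OF sm] wsum_def infsum_cmult_right')
  finally show ?thesis using hd(2) by linarith
qed

text \<open>Choose R so that the datum of a has little energy above R; a nearby datum then has
  little as well. The energy estimate with the weight \<open>highpass\<close> keeps both small at
  all times, and below the now fixed R the difference is governed by L^2 stability. In this way no
  H^s estimate of the difference itself is required.\<close>

theorem csol_stability:
  assumes a: "csol p T s a" and s: "5/2 < s" and T: "0 \<le> T" and e: "0 < e"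
  shows "\<exists>\<delta>>0. \<forall>b. csol p T s b \<and> wsum (hw (s/2)) (\<lambda>n. b 0 n - a 0 n) < \<delta> \<longrightarrow>
           (\<forall>t\<in>{0..T}. wsum (hw (s/2)) (\<lambda>n. b t n - a t n) \<le> e)"
proof -
  obtain M where M: "0 \<le> M" "\<And>t. t \<in> {0..T} \<Longrightarrow> wiener (a t)" "\<And>t. t \<in> {0..T} \<Longrightarrow> wiener_norm (a t) \<le> M"
    by (rule csol_wiener[OF a s]) blast
  obtain \<delta>1 where \<delta>1: "0 < \<delta>1" "\<And>b t. csol p T s b \<Longrightarrow> wsum (hw (s/2)) (\<lambda>n. b 0 n - a 0 n) < \<delta>1 \<Longrightarrow> t \<in> {0..T} \<Longrightarrow>
      wiener_norm (b t) \<le> M + 1"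
    using wiener_stability[OF a s T M(3)] by blast
  obtain K where K: "\<And>R. 0 < R \<Longrightarrow> slow K (highpass s R)" using slow_highpass[of s] s by auto
  have T0: "0 \<in> {0..T}" using T by simp
  have K0: "0 \<le> K" using slowD(1)[OF K[of 1]] by simp
  define \<kappa> where "\<kappa> = (1 + 3 * K) * (M + 1)"
  have \<kappa>: "0 \<le> \<kappa>" using K0 M by (simp add: \<kappa>_def)
  define E where "E = exp (\<kappa> * T)"
  have E: "0 < E" by (simp add: E_def)
  \<comment> \<open>In the final sum the high frequencies of a contribute two and those of b four
    copies of \<open>E * (e / (12 * E))\<close>, together e/2.\<close>
  obtain R where R: "1 \<le> R" "wsum (highpass s R) (a 0) \<le> e / (12 * E)"
    by (rule highpass_small[OF csolD(2)[OF a T0], of "e / (12 * E)"]) (use e E in auto)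
  have R0: "0 < R" using R by simp
  \<comment> \<open>The total factor of \<delta>: the low frequencies through L^2 stability, and 4E
    from the difference of the data inside the high-frequency energy of b.\<close>
  define D where "D = (R powr s)\<^sup>2 * exp (M * T) + 4 * E"
  have D: "0 < D" using E by (simp add: D_def add_nonneg_pos)
  define \<delta> where "\<delta> = min \<delta>1 (e / (2 * D))"
  have \<delta>: "0 < \<delta>" using \<delta>1 e D by (simp add: \<delta>_def)
  have hp: "0 \<le> highpass s R n" for n by (rule highpass_nonneg[OF R0])
  show ?thesis
  proof (intro exI[of _ \<delta>] conjI \<delta> allI impI ballI)
    fix b t assume "csol p T s b \<and> wsum (hw (s/2)) (\<lambda>n. b 0 n - a 0 n) < \<delta>" and t: "t \<in> {0..T}"
    then have b: "csol p T s b" and small: "wsum (hw (s/2)) (\<lambda>n. b 0 n - a 0 n) < \<delta>" by auto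
    have wb: "wiener_norm (b t) \<le> M + 1" if "t \<in> {0..T}" for t
      by (rule \<delta>1(2)[OF b _ that]) (use small in \<open>simp add: \<delta>_def\<close>)
    have wa: "wiener_norm (a t) \<le> M + 1" if "t \<in> {0..T}" for t using M(3)[OF that] by simp
    have hfin: "wfin (highpass s R) (a 0)" "wfin (highpass s R) (b 0)"
      using wfin_mono(1)[OF csolD(2)[OF a T0] hp highpass_le] wfin_mono(1)[OF csolD(2)[OF b T0] hp highpass_le] by auto
    have Et: "exp ((1 + 3 * K) * (M + 1) * t) \<le> E"
      unfolding E_def \<kappa>_def[symmetric] using t \<kappa> by (auto intro: mult_left_mono)
    note fd = csol_initial_bound(1)[OF a b T]
    have d0: "wsum (highpass s R) (\<lambda>n. b 0 n - a 0 n) \<le> \<delta>"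
      using wfin_mono(2)[OF fd hp highpass_le] small by linarith
    have b0: "wsum (highpass s R) (b 0) \<le> 2 * wsum (highpass s R) (a 0) + 2 * wsum (highpass s R) (\<lambda>n. b 0 n - a 0 n)"
      by (rule wfin_combination(2)[OF hfin(1) wfin_mono(1)[OF fd hp highpass_le] _ hp])
        (metis add.commute diff_add_cancel norm_triangle_ineq)
    have ea: "wsum (highpass s R) (a t) \<le> E * (e / (12 * E))"
      by (rule order_trans[OF energy_estimate(2)[OF a s K[OF R0] hfin(1) wa t]])
        (assumption, intro mult_mono Et R wsum_nonneg less_imp_le[OF E])
    have eb: "wsum (highpass s R) (b t) \<le> E * (2 * (e / (12 * E)) + 2 * \<delta>)"
    proof (rule order_trans[OF energy_estimate(2)[OF b s K[OF R0] hfin(2) wb t]])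
      show "exp ((1 + 3 * K) * (M + 1) * t) * wsum (highpass s R) (b 0) \<le> E * (2 * (e / (12 * E)) + 2 * \<delta>)"
        using b0 d0 R(2) by (intro mult_mono Et wsum_nonneg less_imp_le[OF E]) linarith
    qed
    have l2: "l2 (\<lambda>n. b t n - a t n) \<le> exp (M * T) * \<delta>"
    proof -
      have "l2 (\<lambda>n. b t n - a t n) \<le> exp (M * t) * l2 (\<lambda>n. b 0 n - a 0 n)"
        by (rule l2_stability[OF a b s M(3) t])
      also have "\<dots> \<le> exp (M * T) * \<delta>"
        using t M(1) l2_le_hs(2)[OF _ fd] s small
        by (intro mult_mono) (auto intro: mult_left_mono wsum_nonneg)
      finally show ?thesis .
    qed
    have "wsum (hw (s/2)) (\<lambda>n. b t n - a t n)
       \<le> (R powr s)\<^sup>2 * l2 (\<lambda>n. b t n - a t n) + 2 * wsum (highpass s R) (b t) + 2 * wsum (highpass s R) (a t)"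
      by (rule highpass_split[OF _ R(1) csolD(2)[OF b t] csolD(2)[OF a t]]) (use s in simp)
    also have "(R powr s)\<^sup>2 * l2 (\<lambda>n. b t n - a t n) \<le> (R powr s)\<^sup>2 * (exp (M * T) * \<delta>)"
      by (intro mult_left_mono l2) simp
    finally have "wsum (hw (s/2)) (\<lambda>n. b t n - a t n) \<le> D * \<delta> + 6 * (E * (e / (12 * E)))"
      using ea eb E by (simp add: D_def algebra_simps)
    also have "6 * (E * (e / (12 * E))) = e / 2" using E by simp
    also have "D * \<delta> \<le> D * (e / (2 * D))" using D by (intro mult_left_mono) (auto simp: \<delta>_def)
    also have "D * (e / (2 * D)) = e / 2" using D by simp
    finally show "wsum (hw (s/2)) (\<lambda>n. b t n - a t n) \<le> e" by simp
  qed
qed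

section \<open>Galilean invariance and time reversal\<close>

lemma has_sum_single: "(\<And>k. k \<noteq> i \<Longrightarrow> f k = 0) \<Longrightarrow> (f has_sum f i) UNIV"
  by (rule has_sum_finite_neutralI[of "{i}"]) auto

lemma cis_int_add: "cis (of_int (m + n) * x) = cis (of_int m * x) * cis (of_int n * x)"
  by (simp add: cis_mult distrib_right)

lemma conv_galilei:
  assumes a: "wiener a" and \<theta>: "\<And>k l. \<theta> (k + l) = \<theta> k * \<theta> l"
  shows "conv (\<lambda>n. \<theta> n * a n + (if n = 0 then c else 0)) (\<lambda>n. \<theta> n * a n + (if n = 0 then c else 0)) n
     = \<theta> n * conv a a n + 2 * c * (\<theta> n * a n) + (if n = 0 then c\<^sup>2 else 0)"
proof -
  let ?\<delta> = "\<lambda>n::int. if n = 0 then c else 0"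
  have 1: "((\<lambda>k. \<theta> n * (a k * a (n - k))) has_sum \<theta> n * conv a a n) UNIV"
    unfolding conv_def by (intro has_sum_cmult_right has_sum_infsum conv_bound a)
  have 2: "((\<lambda>k. (\<theta> k * a k) * ?\<delta> (n - k)) has_sum (\<theta> n * a n) * c) UNIV"
    using has_sum_single[of n "\<lambda>k. (\<theta> k * a k) * ?\<delta> (n - k)"] by simp
  have 3: "((\<lambda>k. ?\<delta> k * (\<theta> (n - k) * a (n - k))) has_sum c * (\<theta> n * a n)) UNIV"
    using has_sum_single[of 0 "\<lambda>k. ?\<delta> k * (\<theta> (n - k) * a (n - k))"] by simp
  have 4: "((\<lambda>k. ?\<delta> k * ?\<delta> (n - k)) has_sum c * ?\<delta> n) UNIV"
    using has_sum_single[of 0 "\<lambda>k. ?\<delta> k * ?\<delta> (n - k)"] by simp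
  have eq: "(\<theta> k * a k + ?\<delta> k) * (\<theta> (n - k) * a (n - k) + ?\<delta> (n - k))
     = \<theta> n * (a k * a (n - k)) + (\<theta> k * a k) * ?\<delta> (n - k) + ?\<delta> k * (\<theta> (n - k) * a (n - k)) + ?\<delta> k * ?\<delta> (n - k)" for k
  proof -
    have "\<theta> n = \<theta> k * \<theta> (n - k)" using \<theta>[of k "n - k"] by simp
    then show ?thesis by (simp only: ring_distribs ac_simps)
  qed
  have "((\<lambda>k. (\<theta> k * a k + ?\<delta> k) * (\<theta> (n - k) * a (n - k) + ?\<delta> (n - k))) has_sum
     (\<theta> n * conv a a n + (\<theta> n * a n) * c + c * (\<theta> n * a n) + c * ?\<delta> n)) UNIV"
    unfolding eq by (intro has_sum_add 1 2 3 4)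
  from infsumI[OF this] show ?thesis by (cases "n = 0") (simp_all add: conv_def algebra_simps power2_eq_square)
qed

text \<open>The cross term 2 c in the convolution yields - i n c, which is exactly the derivative of
  the phase. The term c^2 sits at n = 0 and is killed by the factor n, and \<open>p 0 = 0\<close>
  keeps the added constant at rest.\<close>

lemma csol_galilei:
  fixes c :: real
  assumes a: "csol p T s a" and s: "5/2 < s" and p: "p 0 = 0"
  shows "csol p T s (\<lambda>t n. cis (of_int n * (- c * t)) * a t n + (if n = 0 then of_real c else 0))"
    (is "csol p T s ?b")
  unfolding csol_def
proof (intro conjI ballI allI)
  fix t n assume t: "t \<in> {0..T}"
  show "?b t (- n) = cnj (?b t n)"
    using csolD(1)[OF a t, of n] by (simp add: cis_cnj)
  define \<theta> where "\<theta> k = cis (of_int k * (- c * t))" for k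
  obtain M where M: "\<And>t. t \<in> {0..T} \<Longrightarrow> wiener (a t)" by (rule csol_wiener[OF a s]) blast
  have conv: "conv (?b t) (?b t) n = \<theta> n * conv (a t) (a t) n + 2 * of_real c * (\<theta> n * a t n) + (if n = 0 then (complex_of_real c)\<^sup>2 else 0)"
    unfolding \<theta>_def by (rule conv_galilei[OF M[OF t]]) (rule cis_int_add)
  have d\<theta>: "((\<lambda>\<tau>. cis (of_int n * (- c * \<tau>))) has_vector_derivative (- \<i> * of_int n * c) * \<theta> n) (at t within {0..T})"
  proof -
    have "((\<lambda>\<tau>. of_int n * (- c * \<tau>)) has_derivative (\<lambda>h. of_int n * (- c * h))) (at t within {0..T})"
      by (intro derivative_intros)
    from has_derivative_cis[OF this]
    have "((\<lambda>\<tau>. cis (of_int n * (- c * \<tau>))) has_derivative (\<lambda>h. (of_int n * (- c * h)) *\<^sub>R (\<i> * \<theta> n))) (at t within {0..T})"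
      by (simp add: \<theta>_def)
    then show ?thesis by (simp add: has_vector_derivative_def scaleR_conv_of_real mult_ac)
  qed
  have "((\<lambda>\<tau>. ?b \<tau> n) has_vector_derivative
      cis (of_int n * (- c * t)) * (- (\<i> * of_int n / 2) * conv (a t) (a t) n - \<i> * of_real (p n) * a t n)
      + (- \<i> * of_int n * c) * \<theta> n * a t n + 0) (at t within {0..T})"
    by (intro has_vector_derivative_add has_vector_derivative_mult d\<theta> csolD(3)[OF a t] has_vector_derivative_const)
  also have "cis (of_int n * (- c * t)) * (- (\<i> * of_int n / 2) * conv (a t) (a t) n - \<i> * of_real (p n) * a t n)
      + (- \<i> * of_int n * c) * \<theta> n * a t n + 0
    = - (\<i> * of_int n / 2) * conv (?b t) (?b t) n - \<i> * of_real (p n) * ?b t n"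
    unfolding conv unfolding \<theta>_def[symmetric] using p by (cases "n = 0") (simp_all add: algebra_simps)
  finally show "((\<lambda>\<tau>. ?b \<tau> n) has_vector_derivative
     - (\<i> * of_int n / 2) * conv (?b t) (?b t) n - \<i> * of_real (p n) * ?b t n) (at t within {0..T})" .
next
  let ?\<delta> = "\<lambda>n::int. if n = 0 then complex_of_real c else 0"
  obtain B where B: "0 \<le> B" "\<And>t. t \<in> {0..T} \<Longrightarrow> wsum (hw (s/2)) (a t) \<le> B"
    by (rule csol_bound[OF a]) blast
  have \<delta>: "wfin (hw (s/2)) ?\<delta>"
    unfolding wfin_def by (rule has_sum_imp_summable, rule has_sum_single[of 0]) simp
  have le: "cmod (?b t n) \<le> cmod (a t n) + cmod (?\<delta> n)" for t n
    by (rule order_trans[OF norm_triangle_ineq]) (simp add: norm_mult)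
  show "\<exists>B. \<forall>t\<in>{0..T}. wfin (hw (s/2)) (?b t) \<and> wsum (hw (s/2)) (?b t) \<le> B"
  proof (intro exI ballI conjI)
    fix t assume t: "t \<in> {0..T}"
    note wc = wfin_combination[OF csolD(2)[OF a t] \<delta> le[where t = t] less_imp_le[OF hw_pos]]
    show "wfin (hw (s/2)) (?b t)" by (rule wc)
    show "wsum (hw (s/2)) (?b t) \<le> 2 * B + 2 * wsum (hw (s/2)) ?\<delta>" using wc(2) B(2)[OF t] by linarith
  qed
qed

text \<open>Conjugating the coefficients of a real function reflects x. Reversing time alone flips
  the sign of the time derivative; the reflection flips that of the remaining terms and restores the
  equation.\<close>

lemma csol_reverse:
  assumes a: "csol p T s a"
  shows "csol p T s (\<lambda>t n. cnj (a (T - t) n))" (is "csol p T s ?b")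
  unfolding csol_def
proof (intro conjI ballI allI)
  fix t n assume t: "t \<in> {0..T}"
  then have Tt: "T - t \<in> {0..T}" by auto
  show "?b t (- n) = cnj (?b t n)" using csolD(1)[OF a Tt, of n] by simp
  have conv: "conv (?b t) (?b t) n = cnj (conv (a (T - t)) (a (T - t)) n)"
    unfolding conv_def infsum_cnj[symmetric] by simp
  have im: "(\<lambda>\<tau>. T - \<tau>) ` {0..T} \<subseteq> {0..T}" by auto
  have "((\<lambda>\<tau>. T - \<tau>) has_vector_derivative -1) (at t within {0..T})"
    by (auto intro!: derivative_eq_intros simp: has_real_derivative_iff_has_vector_derivative[symmetric])
  from vector_diff_chain_within[OF this has_vector_derivative_within_subset[OF csolD(3)[OF a Tt] im]]
  have "((\<lambda>\<tau>. a (T - \<tau>) n) has_vector_derivative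
      - (- (\<i> * of_int n / 2) * conv (a (T - t)) (a (T - t)) n - \<i> * of_real (p n) * a (T - t) n)) (at t within {0..T})"
    by (simp add: o_def)
  from bounded_linear.has_vector_derivative[OF bounded_linear_cnj this]
  show "((\<lambda>\<tau>. ?b \<tau> n) has_vector_derivative
     - (\<i> * of_int n / 2) * conv (?b t) (?b t) n - \<i> * of_real (p n) * ?b t n) (at t within {0..T})"
    unfolding conv by (rule back_subst) (simp add: algebra_simps)
next
  obtain B where B: "0 \<le> B" "\<And>t. t \<in> {0..T} \<Longrightarrow> wsum (hw (s/2)) (a t) \<le> B"
    by (rule csol_bound[OF a]) blast
  have "wfin (hw (s/2)) (?b t) \<and> wsum (hw (s/2)) (?b t) \<le> B" if "t \<in> {0..T}" for t
    using B(2)[of "T - t"] csolD(2)[OF a, of "T - t"] that by (simp add: wfin_def wsum_def)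
  then show "\<exists>B. \<forall>t\<in>{0..T}. wfin (hw (s/2)) (?b t) \<and> wsum (hw (s/2)) (?b t) \<le> B" by blast
qed

section \<open>No smoothing of the high frequencies\<close>

text \<open>
  If the solutions at time \<open>T\<close> have uniformly small tails, they converge in the Sobolev norm, and
  by stability of the reversed flow so do the data.
\<close>

lemma initial_convergence:
  fixes b :: "nat \<Rightarrow> real \<Rightarrow> int \<Rightarrow> complex"
  assumes a: "csol p T s a" and b: "\<And>N. csol p T s (b N)" and s: "5/2 < s" and T: "0 \<le> T"
    and conv: "(\<lambda>N. l2 (\<lambda>n. b N 0 n - a 0 n)) \<longlonglongrightarrow> 0"
    and tail: "\<And>\<epsilon>. 0 < \<epsilon> \<Longrightarrow> \<exists>F. finite F \<and> (\<forall>N. (\<Sum>\<^sub>\<infinity>n\<in>-F. (hw (s/2) n * cmod (b N T n))\<^sup>2) \<le> \<epsilon>)"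
  shows "(\<lambda>N. wsum (hw (s/2)) (\<lambda>n. b N 0 n - a 0 n)) \<longlonglongrightarrow> 0"
proof -
  have TT: "T \<in> {0..T}" using T by simp
  obtain M where M: "0 \<le> M" "\<And>t. t \<in> {0..T} \<Longrightarrow> wiener (a t)" "\<And>t. t \<in> {0..T} \<Longrightarrow> wiener_norm (a t) \<le> M"
    by (rule csol_wiener[OF a s]) blast
  have g: "0 \<le> hw (s/2) n" for n by (rule less_imp_le[OF hw_pos])
  define d where "d N = (\<lambda>n. b N T n - a T n)" for N
  have fd: "wfin (hw (s/2)) (d N)" for N
    unfolding d_def by (rule wfin_diff(1)[OF csolD(2)[OF b TT] csolD(2)[OF a TT] g])
  have l2d: "(\<lambda>N. l2 (d N)) \<longlonglongrightarrow> 0"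
  proof (rule tendsto_sandwich[OF _ _ tendsto_const])
    show "\<forall>\<^sub>F N in sequentially. l2 (d N) \<le> exp (M * T) * l2 (\<lambda>n. b N 0 n - a 0 n)"
      unfolding d_def by (intro always_eventually allI l2_stability[OF a b s M(3) TT])
    show "(\<lambda>N. exp (M * T) * l2 (\<lambda>n. b N 0 n - a 0 n)) \<longlonglongrightarrow> 0"
      using tendsto_mult_right_zero[OF conv] by simp
  qed (simp add: wsum_nonneg)
  have main: "\<forall>\<^sub>F N in sequentially. wsum (hw (s/2)) (d N) < \<epsilon>" if \<epsilon>: "0 < \<epsilon>" for \<epsilon>
  proof -
    obtain F1 where F1: "finite F1" "\<And>N. (\<Sum>\<^sub>\<infinity>n\<in>-F1. (hw (s/2) n * cmod (b N T n))\<^sup>2) \<le> \<epsilon> / 8"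
      using tail[of "\<epsilon> / 8"] \<epsilon> by auto
    have sa: "(\<lambda>n. (hw (s/2) n * cmod (a T n))\<^sup>2) summable_on UNIV"
      and sb: "(\<lambda>n. (hw (s/2) n * cmod (b N T n))\<^sup>2) summable_on UNIV"
      and sd: "(\<lambda>n. (hw (s/2) n * cmod (d N n))\<^sup>2) summable_on UNIV" for N
      using csolD(2)[OF a TT] csolD(2)[OF b TT] fd by (auto simp: wfin_def)
    obtain F2 where F2: "finite F2" "\<bar>\<Sum>\<^sub>\<infinity>n\<in>-F2. (hw (s/2) n * cmod (a T n))\<^sup>2\<bar> < \<epsilon> / 8"
      by (rule summable_tail_less[OF sa, of "\<epsilon> / 8"]) (use \<epsilon> in auto)
    define F where "F = F1 \<union> F2"
    have F: "finite F" using F1 F2 by (simp add: F_def)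
    define C where "C = (\<Sum>n\<in>F. (hw (s/2) n)\<^sup>2)"
    have C: "0 \<le> C" by (simp add: C_def sum_nonneg)
    have bound: "wsum (hw (s/2)) (d N) \<le> C * l2 (d N) + \<epsilon> / 2" for N
    proof -
      have "wsum (hw (s/2)) (d N) = (\<Sum>n\<in>F. (hw (s/2) n * cmod (d N n))\<^sup>2) + (\<Sum>\<^sub>\<infinity>n\<in>-F. (hw (s/2) n * cmod (d N n))\<^sup>2)"
        using infsum_Un_disjoint[OF summable_on_finite[OF F] summable_on_subset_banach[OF sd, of "- F"]] F
        by (simp add: wsum_def)
      also have "(\<Sum>n\<in>F. (hw (s/2) n * cmod (d N n))\<^sup>2) \<le> C * l2 (d N)"
      proof -
        have "s \<ge> 0" using s by simp
        then have "wfin (\<lambda>_. 1) (d N)" by (rule l2_le_hs(1)[OF _ fd])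
        then have "(cmod (d N n))\<^sup>2 \<le> l2 (d N)" for n
          using finite_sum_le_infsum[of "\<lambda>n. (cmod (d N n))\<^sup>2" UNIV "{n}"] by (simp add: wfin_def wsum_def)
        then show ?thesis unfolding C_def sum_distrib_right power_mult_distrib
          by (intro sum_mono mult_left_mono) auto
      qed
      also have "(\<Sum>\<^sub>\<infinity>n\<in>-F. (hw (s/2) n * cmod (d N n))\<^sup>2) \<le> \<epsilon> / 2"
      proof -
        have le: "(hw (s/2) n * cmod (d N n))\<^sup>2 \<le> 2 * (hw (s/2) n * cmod (b N T n))\<^sup>2 + 2 * (hw (s/2) n * cmod (a T n))\<^sup>2" for n
          unfolding d_def by (rule weighted_square_le[OF g norm_triangle_ineq4])
        have sub: "(\<lambda>n. (hw (s/2) n * cmod (b N T n))\<^sup>2) summable_on A" "(\<lambda>n. (hw (s/2) n * cmod (a T n))\<^sup>2) summable_on A"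
          "(\<lambda>n. (hw (s/2) n * cmod (d N n))\<^sup>2) summable_on A" for A
          using summable_on_subset_banach[OF sa, of A] summable_on_subset_banach[OF sb, of A] summable_on_subset_banach[OF sd, of A] by auto
        have "(\<Sum>\<^sub>\<infinity>n\<in>-F. (hw (s/2) n * cmod (d N n))\<^sup>2)
           \<le> (\<Sum>\<^sub>\<infinity>n\<in>-F. 2 * (hw (s/2) n * cmod (b N T n))\<^sup>2 + 2 * (hw (s/2) n * cmod (a T n))\<^sup>2)"
          by (intro infsum_mono summable_on_add summable_on_cmult_right sub le)
        also have "\<dots> = 2 * (\<Sum>\<^sub>\<infinity>n\<in>-F. (hw (s/2) n * cmod (b N T n))\<^sup>2) + 2 * (\<Sum>\<^sub>\<infinity>n\<in>-F. (hw (s/2) n * cmod (a T n))\<^sup>2)"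
          by (simp only: infsum_add[OF summable_on_cmult_right[OF sub(1)] summable_on_cmult_right[OF sub(2)]] infsum_cmult_right')
        also have "(\<Sum>\<^sub>\<infinity>n\<in>-F. (hw (s/2) n * cmod (b N T n))\<^sup>2) \<le> (\<Sum>\<^sub>\<infinity>n\<in>-F1. (hw (s/2) n * cmod (b N T n))\<^sup>2)"
          by (intro infsum_mono2 sub) (auto simp: F_def)
        also have "(\<Sum>\<^sub>\<infinity>n\<in>-F. (hw (s/2) n * cmod (a T n))\<^sup>2) \<le> (\<Sum>\<^sub>\<infinity>n\<in>-F2. (hw (s/2) n * cmod (a T n))\<^sup>2)"
          by (intro infsum_mono2 sub) (auto simp: F_def)
        finally show ?thesis using F1(2)[of N] F2(2) by linarith
      qed
      finally show ?thesis by simp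
    qed
    have "(\<lambda>N. C * l2 (d N) + \<epsilon> / 2) \<longlonglongrightarrow> C * 0 + \<epsilon> / 2" by (rule tendsto_add[OF tendsto_mult[OF tendsto_const l2d] tendsto_const])
    then have "\<forall>\<^sub>F N in sequentially. C * l2 (d N) + \<epsilon> / 2 < \<epsilon>" by (rule order_tendstoD(2)) (use \<epsilon> in simp)
    then show ?thesis by eventually_elim (rule le_less_trans[OF bound])
  qed
  have cd: "wsum (hw (s/2)) (\<lambda>n. cnj (x n) - cnj (y n)) = wsum (hw (s/2)) (\<lambda>n. x n - y n)" for x y
    by (simp add: wsum_def flip: complex_cnj_diff)
  show ?thesis
  proof (rule order_tendstoI)
    fix e :: real assume "e < 0"
    then show "\<forall>\<^sub>F N in sequentially. e < wsum (hw (s/2)) (\<lambda>n. b N 0 n - a 0 n)"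
      by (intro always_eventually allI) (rule less_le_trans[OF _ wsum_nonneg])
  next
    fix e :: real assume e: "0 < e"
    \<comment> \<open>Time 0 of the reversed solutions is time T of the original ones, so the
      convergence at T just proved is convergence of data here; the conclusion is then read off at
      reversed time T.\<close>
    obtain \<delta> where \<delta>: "0 < \<delta>" "\<forall>c. csol p T s c \<and> wsum (hw (s/2)) (\<lambda>n. c 0 n - cnj (a (T - 0) n)) < \<delta> \<longrightarrow>
        (\<forall>t\<in>{0..T}. wsum (hw (s/2)) (\<lambda>n. c t n - cnj (a (T - t) n)) \<le> e / 2)"
      using csol_stability[OF csol_reverse[OF a] s T, of "e / 2"] e by auto
    from main[OF \<delta>(1)] show "\<forall>\<^sub>F N in sequentially. wsum (hw (s/2)) (\<lambda>n. b N 0 n - a 0 n) < e"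
    proof eventually_elim
      case (elim N)
      have "wsum (hw (s/2)) (\<lambda>n. cnj (b N (T - T) n) - cnj (a (T - T) n)) \<le> e / 2"
        by (rule \<delta>(2)[rule_format, OF conjI TT, OF csol_reverse[OF b]]) (use elim in \<open>simp add: cd d_def\<close>)
      then show ?case using e by (simp add: cd)
    qed
  qed
qed

section \<open>Fourier series\<close>

definition fser :: "(int \<Rightarrow> complex) \<Rightarrow> real \<Rightarrow> complex" where
  "fser h x = (\<Sum>\<^sub>\<infinity>n. h n * cis (of_int n * x))"

abbreviation l1 :: "(int \<Rightarrow> complex) \<Rightarrow> bool" where
  "l1 h \<equiv> (\<lambda>n. cmod (h n)) summable_on UNIV"

lemma fser_summable: "l1 h \<Longrightarrow> (\<lambda>n. h n * cis (of_int n * x)) summable_on UNIV"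
  by (rule dominated_summable) (auto simp: norm_mult)

lemma fser_uniform_limit:
  assumes h: "l1 h"
  shows "uniform_limit A (\<lambda>F x. \<Sum>n\<in>F. h n * cis (of_int n * x)) (fser h) (finite_subsets_at_top UNIV)"
  unfolding fser_def[abs_def]
  by (rule Weierstrass_m_test_general[OF _ h]) (simp add: norm_mult)

lemma fser_continuous:
  assumes h: "l1 h"
  shows "continuous_on A (fser h)"
  by (rule uniform_limit_theorem[OF _ fser_uniform_limit[OF h]])
    (auto intro!: always_eventually continuous_intros)

lemma fser_integral:
  assumes h: "l1 h" and g: "continuous_on {a..b} g"
  shows "((\<lambda>n. h n * integral {a..b} (\<lambda>x. cis (of_int n * x) * g x)) has_sum
           integral {a..b} (\<lambda>x. fser h x * g x)) UNIV"
proof -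
  obtain G where "\<forall>y\<in>g ` {a..b}. cmod y \<le> G"
    using compact_imp_bounded[OF compact_continuous_image[OF g compact_Icc]] unfolding bounded_iff by blast
  then have G: "\<And>x. x \<in> {a..b} \<Longrightarrow> cmod (g x) \<le> G" by blast
  let ?f = "\<lambda>n x. h n * cis (of_int n * x) * g x"
  have lim: "uniform_limit {a..b} (\<lambda>F x. \<Sum>n\<in>F. ?f n x) (\<lambda>x. \<Sum>\<^sub>\<infinity>n. ?f n x) (finite_subsets_at_top UNIV)"
  proof (rule Weierstrass_m_test_general)
    show "(\<lambda>n. cmod (h n) * G) summable_on UNIV" by (intro summable_on_cmult_left h)
  qed (auto simp: norm_mult intro!: mult_left_mono G)
  have eq: "(\<Sum>\<^sub>\<infinity>n. ?f n x) = fser h x * g x" for x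
    by (simp add: fser_def infsum_cmult_left')
  obtain I J where IJ: "\<And>F. ((\<lambda>x. \<Sum>n\<in>F. ?f n x) has_integral I F) {a..b}"
      "((\<lambda>x. fser h x * g x) has_integral J) {a..b}" "(I \<longlongrightarrow> J) (finite_subsets_at_top UNIV)"
    by (rule uniform_limit_integral[OF lim[unfolded eq]]) (auto intro!: continuous_intros g)
  have int: "(\<lambda>x. cis (of_int n * x) * g x) integrable_on {a..b}" for n
    by (intro integrable_continuous_interval continuous_intros g)
  have "I F = (\<Sum>n\<in>F. h n * integral {a..b} (\<lambda>x. cis (of_int n * x) * g x))" if "finite F" for F
  proof -
    have "((\<lambda>x. \<Sum>n\<in>F. h n * (cis (of_int n * x) * g x)) has_integral
       (\<Sum>n\<in>F. h n * integral {a..b} (\<lambda>x. cis (of_int n * x) * g x))) {a..b}"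
      by (intro has_integral_sum that has_integral_mult_right integrable_integral int)
    then show ?thesis using IJ(1)[of F] by (auto simp: mult.assoc intro: has_integral_unique)
  qed
  then have "\<forall>\<^sub>F F in finite_subsets_at_top UNIV. I F = (\<Sum>n\<in>F. h n * integral {a..b} (\<lambda>x. cis (of_int n * x) * g x))"
    by (intro eventually_finite_subsets_at_top_weakI) auto
  then have "((\<lambda>F. \<Sum>n\<in>F. h n * integral {a..b} (\<lambda>x. cis (of_int n * x) * g x)) \<longlongrightarrow> J) (finite_subsets_at_top UNIV)"
    using IJ(3) by (rule Lim_transform_eventually[rotated])
  then show ?thesis using IJ(2) by (simp add: has_sum_def integral_unique)
qed

lemma cis_has_vector_derivative:
  "((\<lambda>x. cis (c * x)) has_vector_derivative \<i> * of_real c * cis (c * x)) (at x within A)"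
proof -
  have "((\<lambda>x. c * x) has_derivative (\<lambda>h. c * h)) (at x within A)" by (intro derivative_intros)
  from has_derivative_cis[OF this] show ?thesis
    by (simp add: has_vector_derivative_def scaleR_conv_of_real mult_ac)
qed

lemma integral_cis:
  assumes "a \<le> b"
  shows "\<i> * of_int n * integral {a..b} (\<lambda>x. cis (of_int n * x)) = cis (of_int n * b) - cis (of_int n * a)"
proof -
  have "((\<lambda>x. \<i> * of_real (of_int n) * cis (of_int n * x)) has_integral cis (of_int n * b) - cis (of_int n * a)) {a..b}"
    by (rule fundamental_theorem_of_calculus[OF assms cis_has_vector_derivative])
  then show ?thesis by (simp add: has_integral_iff)
qed

lemma integral_cis_period: "integral {0..2*pi} (\<lambda>x. cis (of_int n * x)) = (if n = 0 then of_real (2 * pi) else 0)"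
proof (cases "n = 0")
  case False
  have "cis (of_int n * (2 * pi)) = 1"
    by (metis cis_multiple_2pi Ints_of_int mult.commute)
  then have "\<i> * of_int n * integral {0..2*pi} (\<lambda>x. cis (of_int n * x)) = 0"
    using integral_cis[of 0 "2 * pi" n] by simp
  then show ?thesis using False by simp
qed (simp add: scaleR_conv_of_real)

lemma fser_coeff:
  assumes h: "l1 h" and u: "\<And>x. complex_of_real (u x) = fser h x"
  shows "fourier_coeff u n = h n"
proof -
  have "((\<lambda>k. h k * integral {0..2*pi} (\<lambda>x. cis (of_int k * x) * cis (- (of_int n * x)))) has_sum
     integral {0..2*pi} (\<lambda>x. fser h x * cis (- (of_int n * x)))) UNIV"
    by (rule fser_integral[OF h]) (intro continuous_intros)
  moreover have "integral {0..2*pi} (\<lambda>x. cis (of_int k * x) * cis (- (of_int n * x))) = (if k = n then of_real (2 * pi) else 0)" for k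
    using integral_cis_period[of "k - n"] by (simp add: cis_mult algebra_simps)
  ultimately have "((\<lambda>k. h k * (if k = n then of_real (2 * pi) else 0)) has_sum
     integral {0..2*pi} (\<lambda>x. of_real (u x) * cis (- (of_int n * x)))) UNIV"
    by (simp only: u)
  moreover have "((\<lambda>k. h k * (if k = n then of_real (2 * pi) else 0)) has_sum h n * of_real (2 * pi)) UNIV"
    using has_sum_single[of n "\<lambda>k. h k * (if k = n then of_real (2 * pi) else 0)"] by simp
  ultimately have "integral {0..2*pi} (\<lambda>x. of_real (u x) * cis (- (of_int n * x))) = h n * of_real (2 * pi)"
    by (rule has_sum_unique)
  then show ?thesis by (simp add: fourier_coeff_def)
qed

lemma fser_real:
  assumes "\<And>n. h (- n) = cnj (h n)"
  shows "fser h x = of_real (Re (fser h x))"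
proof -
  have bij: "bij_betw uminus UNIV (UNIV :: int set)"
    by (rule bij_betwI[of _ _ _ uminus]) auto
  have "cnj (fser h x) = (\<Sum>\<^sub>\<infinity>n. h (- n) * cis (of_int (- n) * x))"
    unfolding fser_def infsum_cnj[symmetric] by (simp add: assms cis_cnj)
  also have "\<dots> = fser h x"
    unfolding fser_def using infsum_reindex_bij_betw[OF bij, of "\<lambda>n. h n * cis (of_int n * x)"] by simp
  finally show ?thesis by (simp add: complex_eq_iff)
qed

lemma fourier_coeff_cnj: "fourier_coeff u (- n) = cnj (fourier_coeff u n)"
  unfolding fourier_coeff_def by (simp add: integral_cnj cis_cnj)

lemma fourier_coeff_diff:
  assumes "continuous_on UNIV u" "continuous_on UNIV v"
  shows "fourier_coeff (u - v) n = fourier_coeff u n - fourier_coeff v n"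
proof -
  have "continuous_on UNIV ((-1) *\<^sub>R v)" unfolding scaleR_fun_def by (intro continuous_intros assms)
  from fourier_coeff_add[OF assms(1) this, of n] show ?thesis
    using fourier_coeff_scaleR[of "-1" v n] by simp
qed

lemma fser_periodic: "fser h (x + 2 * pi) = fser h x"
proof -
  have "cis (of_int n * (x + 2 * pi)) = cis (of_int n * x)" for n
  proof -
    have "cis (of_int n * (2 * pi)) = 1" by (metis cis_multiple_2pi Ints_of_int mult.commute)
    then show ?thesis by (simp add: distrib_left cis_mult[symmetric])
  qed
  then show ?thesis by (simp add: fser_def)
qed

text \<open>The function and the sum of its Fourier series are continuous, periodic and have equal
  coefficients, so uniqueness applies to their difference.\<close>

lemma fourier_inversion:
  assumes cont: "continuous_on UNIV u" and per: "\<And>x. u (x + 2*pi) = u x"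
    and l1: "l1 (fourier_coeff u)"
  shows "complex_of_real (u x) = fser (fourier_coeff u) x"
proof -
  define U where "U x = Re (fser (fourier_coeff u) x)" for x
  have U: "complex_of_real (U x) = fser (fourier_coeff u) x" for x
    unfolding U_def by (rule fser_real[symmetric]) (rule fourier_coeff_cnj)
  have cU: "continuous_on UNIV U"
    unfolding U_def[abs_def] by (intro continuous_intros fser_continuous l1)
  have "u - U = 0"
  proof (rule fourier_coeff_eq_0_imp)
    show "continuous_on UNIV (u - U)" unfolding fun_diff_def by (intro continuous_intros cont cU)
    show "(u - U) (x + 2*pi) = (u - U) x" for x by (simp add: per U_def fser_periodic)
    show "fourier_coeff (u - U) n = 0" for n
      by (simp add: fourier_coeff_diff[OF cont cU] fser_coeff[OF l1 U])
  qed
  then have "u x = U x" by (simp add: fun_eq_iff)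
  then show ?thesis by (simp add: U)
qed

lemma l1_mult_int:
  assumes "wiener h"
  shows "l1 h" "l1 (\<lambda>n. \<i> * of_int n * h n)"
  using wiener_imp(1,3)[OF assms] by (simp_all add: norm_mult)

text \<open>The formally differentiated series converges uniformly and may be integrated term by
  term; the fundamental theorem of calculus then gives the derivative. Integration starts at x - 1
  to make x an interior point.\<close>

lemma fser_has_vector_derivative:
  assumes h: "wiener h"
  shows "(fser h has_vector_derivative fser (\<lambda>n. \<i> * of_int n * h n) x) (at x)"
proof -
  let ?h' = "\<lambda>n. \<i> * of_int n * h n"
  note l1 = l1_mult_int[OF h]
  have eq: "integral {x - 1..y} (fser ?h') + fser h (x - 1) = fser h y" if "x - 1 \<le> y" for y
  proof -
    have "((\<lambda>n. ?h' n * integral {x - 1..y} (\<lambda>x. cis (of_int n * x) * 1)) has_sum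
        integral {x - 1..y} (\<lambda>x. fser ?h' x * 1)) UNIV"
      by (rule fser_integral[OF l1(2)]) (intro continuous_intros)
    moreover have "?h' n * integral {x - 1..y} (\<lambda>x. cis (of_int n * x) * 1)
        = h n * cis (of_int n * y) - h n * cis (of_int n * (x - 1))" for n
      using arg_cong[OF integral_cis[OF that, of n], of "\<lambda>z. h n * z"] by (simp add: algebra_simps)
    ultimately have "((\<lambda>n. h n * cis (of_int n * y) - h n * cis (of_int n * (x - 1))) has_sum
        integral {x - 1..y} (fser ?h')) UNIV" by (simp only: mult_1_right)
    from infsumI[OF this] show ?thesis
      unfolding infsum_diff_banach(2)[OF fser_summable[OF l1(1)] fser_summable[OF l1(1)]]
      by (simp add: fser_def[of h, symmetric] diff_eq_eq)
  qed
  have "((\<lambda>y. integral {x - 1..y} (fser ?h')) has_vector_derivative fser ?h' x) (at x within {x - 1..x + 1})"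
    by (rule integral_has_vector_derivative) (auto intro: fser_continuous l1)
  then have "((\<lambda>y. integral {x - 1..y} (fser ?h') + fser h (x - 1)) has_vector_derivative fser ?h' x + 0) (at x within {x - 1..x + 1})"
    by (intro has_vector_derivative_add has_vector_derivative_const)
  then have "(fser h has_vector_derivative fser ?h' x + 0) (at x within {x - 1..x + 1})"
    by (rule has_vector_derivative_transform[rotated 2]) (auto simp: eq)
  then show ?thesis by (simp add: at_within_Icc_at)
qed

section \<open>Fourier coefficients of the equation\<close>

text \<open>Times the imaginary unit, this is the symbol of |D|^\<beta> d/dx; it is used with
  \<beta> = \<alpha> - 1.\<close>

definition psym :: "real \<Rightarrow> int \<Rightarrow> real" where
  "psym \<beta> n = real_of_int n * \<bar>real_of_int n\<bar> powr \<beta>"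

lemma psym_bound:
  assumes "0 < \<beta>" "\<beta> < 1"
  shows "\<bar>psym \<beta> n\<bar> \<le> 1 + (real_of_int n)\<^sup>2"
proof (cases "n = 0")
  case False
  then have "1 \<le> \<bar>real_of_int n\<bar>" by linarith
  then have "\<bar>real_of_int n\<bar> powr \<beta> \<le> \<bar>real_of_int n\<bar> powr 1" using assms by (intro powr_mono) auto
  then have "\<bar>real_of_int n\<bar> * \<bar>real_of_int n\<bar> powr \<beta> \<le> \<bar>real_of_int n\<bar> * \<bar>real_of_int n\<bar>"
    by (intro mult_left_mono) auto
  then show ?thesis by (simp add: psym_def abs_mult power2_eq_square)
qed (simp add: psym_def)

lemma wfin_Hs: "u \<in> Hs s \<Longrightarrow> wfin (hw (s/2)) (fourier_coeff u)"
  using Hs_summable[of u s] by (simp add: wfin_def power_mult_distrib hw_power2) (simp add: hw_def)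

lemma Hs_norm_wsum: "Hs_norm s u = sqrt (wsum (hw (s/2)) (fourier_coeff u))"
  by (simp add: Hs_norm_def wsum_def power_mult_distrib hw_power2) (simp add: hw_def)

lemma wiener_Hs:
  assumes "5/2 < s" "u \<in> Hs s"
  shows "wiener (fourier_coeff u)"
  by (rule wien_Cauchy_Schwarz(1)[OF assms(1) wfin_Hs[OF assms(2)]])

lemma Hs_fourier_coeff_diff:
  assumes "u \<in> Hs s" "v \<in> Hs s"
  shows "fourier_coeff (u - v) = (\<lambda>n. fourier_coeff u n - fourier_coeff v n)"
  by (rule ext) (rule fourier_coeff_diff[OF Hs_continuous[OF assms(1)] Hs_continuous[OF assms(2)]])

lemma l1_psym:
  assumes "0 < \<beta>" "\<beta> < 1" "wiener h"
  shows "l1 (\<lambda>n. \<i> * of_real (psym \<beta> n) * h n)"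
proof (rule summable_on_comparison_test[OF assms(3)])
  show "cmod (\<i> * of_real (psym \<beta> n) * h n) \<le> wien h n" for n
    unfolding wien_def using psym_bound[OF assms(1,2), of n] by (simp add: norm_mult mult_right_mono)
qed simp

lemma Hs_series:
  assumes s: "5/2 < s" and u: "u \<in> Hs s"
  shows "complex_of_real (u x) = fser (fourier_coeff u) x"
    and "(u has_real_derivative deriv u x) (at x)"
    and "complex_of_real (deriv u x) = fser (\<lambda>n. \<i> * of_int n * fourier_coeff u n) x"
    and "fourier_coeff (deriv u) n = \<i> * of_int n * fourier_coeff u n"
    and "0 < \<beta> \<Longrightarrow> \<beta> < 1 \<Longrightarrow>
      complex_of_real (abs_D_powr \<beta> (deriv u) x) = fser (\<lambda>n. \<i> * of_real (psym \<beta> n) * fourier_coeff u n) x"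
proof -
  let ?a = "fourier_coeff u"
  let ?a' = "\<lambda>n. \<i> * of_int n * fourier_coeff u n"
  have w: "wiener ?a" by (rule wiener_Hs[OF s u])
  note l1 = l1_mult_int[OF w]
  show inv: "complex_of_real (u x) = fser ?a x" for x
    using u l1(1) by (intro fourier_inversion) (auto simp: Hs_def)
  have real: "fser ?a' x = of_real (Re (fser ?a' x))" for x
    by (rule fser_real) (simp add: fourier_coeff_cnj)
  have "((\<lambda>x. Re (fser ?a x)) has_vector_derivative Re (fser ?a' x)) (at x)" for x
    by (rule bounded_linear.has_vector_derivative[OF bounded_linear_Re fser_has_vector_derivative[OF w]])
  then have d: "(u has_real_derivative Re (fser ?a' x)) (at x)" for x
    unfolding inv[symmetric] by (simp add: has_real_derivative_iff_has_vector_derivative)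
  then have du: "deriv u x = Re (fser ?a' x)" for x by (rule DERIV_imp_deriv)
  show "(u has_real_derivative deriv u x) (at x)" using d du by simp
  show d': "complex_of_real (deriv u x) = fser ?a' x" for x using real du by simp
  show c': "fourier_coeff (deriv u) n = ?a' n" for n by (rule fser_coeff[OF l1(2) d'])
  let ?b = "\<lambda>n. \<i> * of_real (psym \<beta> n) * fourier_coeff u n"
  have "abs_D_powr \<beta> (deriv u) x = Re (fser ?b x)"
    unfolding abs_D_powr_def c' fser_def psym_def by (simp add: mult_ac)
  moreover have "fser ?b x = of_real (Re (fser ?b x))"
    by (rule fser_real) (simp add: fourier_coeff_cnj psym_def)
  ultimately show "complex_of_real (abs_D_powr \<beta> (deriv u) x) = fser ?b x" by simp
qed

text \<open>Under k -> n - k the two factors k and n - k trade places, and their sum is n: the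
  product rule for half the square.\<close>

lemma conv_derivative:
  assumes a: "wiener a"
  shows "conv a (\<lambda>n. \<i> * of_int n * a n) n = \<i> * of_int n / 2 * conv a a n"
proof -
  let ?a' = "\<lambda>n. \<i> * of_int n * a n"
  have bd: "cmod (?a' m) \<le> wiener_norm a" for m
  proof -
    have "cmod (?a' m) \<le> wien a m" using abs_mult_le_wien[of m a] by (simp add: norm_mult)
    also have "\<dots> \<le> wiener_norm a"
      using finite_sum_le_infsum[OF a, of "{m}"] by (simp add: wien_nonneg)
    finally show ?thesis .
  qed
  have sm: "(\<lambda>k. a k * ?a' (n - k)) summable_on UNIV"
    by (rule dominated_summable(1)[where g = "\<lambda>k. cmod (a k) * wiener_norm a"])
      (auto intro!: summable_on_cmult_left wiener_imp(3)[OF a] mult_left_mono bd simp del: of_int_diff simp: norm_mult[of "a _"])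
  have sm': "(\<lambda>k. ?a' k * a (n - k)) summable_on UNIV"
    by (rule dominated_summable(1)[where g = "\<lambda>k. cmod (?a' k) * wiener_norm a"])
      (auto intro!: summable_on_cmult_left l1_mult_int(2)[OF a] mult_left_mono wiener_imp(6)[OF a] simp: norm_mult[of _ "a (n - _)"])
  have "2 * conv a ?a' n = conv a ?a' n + conv ?a' a n" by (simp add: conv_commute[of ?a' a])
  also have "\<dots> = (\<Sum>\<^sub>\<infinity>k. a k * ?a' (n - k) + ?a' k * a (n - k))"
    unfolding conv_def by (rule infsum_add[OF sm sm', symmetric])
  also have "\<dots> = (\<Sum>\<^sub>\<infinity>k. \<i> * of_int n * (a k * a (n - k)))"
    by (intro infsum_cong) (simp add: algebra_simps)
  also have "\<dots> = \<i> * of_int n * conv a a n" by (simp add: conv_def infsum_cmult_right')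
  finally show ?thesis by (simp add: mult_ac)
qed

lemma continuous_on_of_real_fser:
  assumes "l1 h" "\<And>x. complex_of_real (f x) = fser h x"
  shows "continuous_on A f"
proof -
  have "continuous_on A (\<lambda>x. Re (fser h x))" by (intro continuous_intros fser_continuous assms)
  moreover have "Re (fser h x) = f x" for x by (simp flip: assms(2))
  ultimately show ?thesis by simp
qed

lemma fourier_coeff_rhs:
  assumes s: "5/2 < s" and u: "u \<in> Hs s" and \<beta>: "0 < \<beta>" "\<beta> < 1"
  shows "fourier_coeff (\<lambda>x. - (u x * deriv u x) - abs_D_powr \<beta> (deriv u) x) n
     = - (\<i> * of_int n / 2) * conv (fourier_coeff u) (fourier_coeff u) n - \<i> * of_real (psym \<beta> n) * fourier_coeff u n"
proof -
  let ?a = "fourier_coeff u"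
  have w: "wiener ?a" by (rule wiener_Hs[OF s u])
  note l1 = l1_mult_int[OF w] and l1p = l1_psym[OF \<beta> w]
  note S = Hs_series[OF s u]
  have cu: "continuous_on A u" and cd: "continuous_on A (deriv u)" and cD: "continuous_on A (abs_D_powr \<beta> (deriv u))" for A
    using continuous_on_of_real_fser[OF l1(1) S(1)] continuous_on_of_real_fser[OF l1(2) S(3)]
      continuous_on_of_real_fser[OF l1p S(5)[OF \<beta>]] by auto
  have "((\<lambda>k. ?a k * integral {0..2*pi} (\<lambda>x. cis (of_int k * x) * (of_real (deriv u x) * cis (- (of_int n * x))))) has_sum
      integral {0..2*pi} (\<lambda>x. fser ?a x * (of_real (deriv u x) * cis (- (of_int n * x))))) UNIV"
    by (rule fser_integral[OF l1(1)]) (intro continuous_intros cd)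
  moreover have "integral {0..2*pi} (\<lambda>x. cis (of_int k * x) * (of_real (deriv u x) * cis (- (of_int n * x))))
      = (\<i> * of_int (n - k) * ?a (n - k)) * of_real (2 * pi)" for k
  proof -
    have "integral {0..2*pi} (\<lambda>x. cis (of_int k * x) * (of_real (deriv u x) * cis (- (of_int n * x))))
       = integral {0..2*pi} (\<lambda>x. of_real (deriv u x) * cis (- (of_int (n - k) * x)))"
    proof (rule integral_cong)
      fix x
      have "cis (- (of_int (n - k) * x)) = cis (of_int k * x) * cis (- (of_int n * x))"
        by (simp add: cis_mult algebra_simps)
      then show "cis (of_int k * x) * (of_real (deriv u x) * cis (- (of_int n * x)))
         = of_real (deriv u x) * cis (- (of_int (n - k) * x))" by (simp only: mult_ac)
    qed
    also have "\<dots> = fourier_coeff (deriv u) (n - k) * of_real (2 * pi)" by (simp add: fourier_coeff_def)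
    finally show ?thesis by (simp only: S(4))
  qed
  ultimately have "((\<lambda>k. ?a k * (\<i> * of_int (n - k) * ?a (n - k)) * of_real (2 * pi)) has_sum
      integral {0..2*pi} (\<lambda>x. of_real (u x) * (of_real (deriv u x) * cis (- (of_int n * x))))) UNIV"
    by (simp only: S(1) mult.assoc)
  from infsumI[OF this] have "integral {0..2*pi} (\<lambda>x. of_real (u x) * (of_real (deriv u x) * cis (- (of_int n * x))))
      = conv ?a (\<lambda>n. \<i> * of_int n * ?a n) n * of_real (2 * pi)"
    by (simp add: conv_def infsum_cmult_left')
  then have prod: "fourier_coeff (\<lambda>x. u x * deriv u x) n = \<i> * of_int n / 2 * conv ?a ?a n"
  proof -
    assume eq: "integral {0..2*pi} (\<lambda>x. of_real (u x) * (of_real (deriv u x) * cis (- (of_int n * x))))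
      = conv ?a (\<lambda>n. \<i> * of_int n * ?a n) n * of_real (2 * pi)"
    have "fourier_coeff (\<lambda>x. u x * deriv u x) n
       = integral {0..2*pi} (\<lambda>x. of_real (u x) * (of_real (deriv u x) * cis (- (of_int n * x)))) / of_real (2 * pi)"
      by (simp add: fourier_coeff_def mult.assoc)
    then show ?thesis by (simp only: eq conv_derivative[OF w]) simp
  qed
  have D: "fourier_coeff (abs_D_powr \<beta> (deriv u)) n = \<i> * of_real (psym \<beta> n) * ?a n"
    by (rule fser_coeff[OF l1p S(5)[OF \<beta>]])
  have c1: "continuous_on UNIV (\<lambda>x. u x * deriv u x)" by (intro continuous_intros cu cd)
  have c2: "continuous_on UNIV ((-1) *\<^sub>R (\<lambda>x. u x * deriv u x))" unfolding scaleR_fun_def by (intro continuous_intros cu cd)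
  have "(\<lambda>x. - (u x * deriv u x) - abs_D_powr \<beta> (deriv u) x) = (-1) *\<^sub>R (\<lambda>x. u x * deriv u x) - abs_D_powr \<beta> (deriv u)"
    by (simp add: fun_eq_iff)
  then show ?thesis
    by (simp only: fourier_coeff_diff[OF c2 cD] fourier_coeff_scaleR prod D) simp
qed

lemma fser_diff_bound:
  assumes h: "l1 h" and k: "l1 k" and f: "complex_of_real f = fser h x" and g: "complex_of_real g = fser k x"
    and m: "m summable_on UNIV" "\<And>n. cmod (h n - k n) \<le> m n"
  shows "\<bar>f - g\<bar> \<le> infsum m UNIV"
proof -
  have "complex_of_real (f - g) = (\<Sum>\<^sub>\<infinity>n. h n * cis (of_int n * x) - k n * cis (of_int n * x))"
    by (simp add: f g fser_def infsum_diff_banach(2)[OF fser_summable[OF h] fser_summable[OF k]])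
  also have "cmod \<dots> \<le> infsum m UNIV"
  proof (rule dominated_summable(3)[OF m(1)])
    show "norm (h n * cis (of_int n * x) - k n * cis (of_int n * x)) \<le> m n" for n
      using m(2)[of n] by (simp add: norm_mult flip: left_diff_distrib)
  qed
  finally show ?thesis by (simp only: norm_of_real)
qed

text \<open>All three differences have Fourier coefficients dominated by \<open>wien\<close> of the
  difference. Together the bounds make the right side of the equation depend continuously on time,
  uniformly in x.\<close>

lemma Hs_uniform_bounds:
  assumes s: "5/2 < s" and \<beta>: "0 < \<beta>" "\<beta> < 1"
  shows "\<exists>Z>0. \<forall>u\<in>Hs s. \<forall>v\<in>Hs s. \<forall>x. \<bar>u x - v x\<bar> \<le> Z * Hs_norm s (u - v) \<and>
     \<bar>deriv u x - deriv v x\<bar> \<le> Z * Hs_norm s (u - v) \<and>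
     \<bar>abs_D_powr \<beta> (deriv u) x - abs_D_powr \<beta> (deriv v) x\<bar> \<le> Z * Hs_norm s (u - v)"
proof -
  define Z where "Z = sqrt (infsum (hw (2 - s)) UNIV)"
  have Z0: "0 \<le> Z" by (auto simp: Z_def intro!: infsum_nonneg less_imp_le[OF hw_pos])
  have main: "\<bar>u x - v x\<bar> \<le> Z * Hs_norm s (u - v) \<and> \<bar>deriv u x - deriv v x\<bar> \<le> Z * Hs_norm s (u - v)
     \<and> \<bar>abs_D_powr \<beta> (deriv u) x - abs_D_powr \<beta> (deriv v) x\<bar> \<le> Z * Hs_norm s (u - v)"
    if u: "u \<in> Hs s" and v: "v \<in> Hs s" for u v x
  proof -
    let ?d = "fourier_coeff (u - v)"
    note d = Hs_fourier_coeff_diff[OF u v]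
    note w = Hs_diff[OF u v]
    have wd: "wiener ?d" and wu: "wiener (fourier_coeff u)" and wv: "wiener (fourier_coeff v)"
      by (rule wiener_Hs[OF s], rule w u v)+
    have N: "wiener_norm ?d \<le> Z * Hs_norm s (u - v)"
      unfolding Z_def Hs_norm_wsum by (rule wien_Cauchy_Schwarz(2)[OF s wfin_Hs[OF w]])
    note Su = Hs_series[OF s u] and Sv = Hs_series[OF s v]
    have "\<bar>u x - v x\<bar> \<le> wiener_norm ?d"
      by (rule fser_diff_bound[OF l1_mult_int(1)[OF wu] l1_mult_int(1)[OF wv] Su(1) Sv(1) wd])
        (simp add: d cmod_le_wien[of "\<lambda>n. fourier_coeff u n - fourier_coeff v n", simplified])
    moreover have "\<bar>deriv u x - deriv v x\<bar> \<le> wiener_norm ?d"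
    proof (rule fser_diff_bound[OF l1_mult_int(2)[OF wu] l1_mult_int(2)[OF wv] Su(3) Sv(3) wd])
      show "cmod (\<i> * of_int n * fourier_coeff u n - \<i> * of_int n * fourier_coeff v n) \<le> wien ?d n" for n
        using abs_mult_le_wien[of n ?d] by (simp add: d norm_mult flip: right_diff_distrib)
    qed
    moreover have "\<bar>abs_D_powr \<beta> (deriv u) x - abs_D_powr \<beta> (deriv v) x\<bar> \<le> wiener_norm ?d"
    proof (rule fser_diff_bound[OF l1_psym[OF \<beta> wu] l1_psym[OF \<beta> wv] Su(5)[OF \<beta>] Sv(5)[OF \<beta>] wd])
      fix n
      have "\<bar>psym \<beta> n\<bar> * cmod (?d n) \<le> wien ?d n" unfolding wien_def
        by (intro mult_right_mono psym_bound \<beta>) simp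
      then show "cmod (\<i> * of_real (psym \<beta> n) * fourier_coeff u n - \<i> * of_real (psym \<beta> n) * fourier_coeff v n) \<le> wien ?d n"
        by (simp add: d norm_mult flip: right_diff_distrib)
    qed
    ultimately show ?thesis using N by linarith
  qed
  have le: "Z * Hs_norm s w \<le> (Z + 1) * Hs_norm s w" for w
    using Hs_norm_nonneg[of s w] by (simp add: distrib_right)
  show ?thesis
  proof (intro exI[of _ "Z + 1"] conjI ballI allI)
    fix u v x assume uv: "u \<in> Hs s" "v \<in> Hs s"
    note m = main[OF uv, of x] and l = le[of "u - v"]
    show "\<bar>u x - v x\<bar> \<le> (Z + 1) * Hs_norm s (u - v)" using m l by linarith
    show "\<bar>deriv u x - deriv v x\<bar> \<le> (Z + 1) * Hs_norm s (u - v)" using m l by linarith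
    show "\<bar>abs_D_powr \<beta> (deriv u) x - abs_D_powr \<beta> (deriv v) x\<bar> \<le> (Z + 1) * Hs_norm s (u - v)"
      using m l by linarith
  qed (use Z0 in simp)
qed

section \<open>From pointwise solutions to Fourier coefficients\<close>

lemma C0_Hs_time_continuous:
  assumes v: "v \<in> C0_Hs T s" and t: "t \<in> {0..T}" and e: "0 < e"
  shows "\<exists>d>0. \<forall>t'\<in>{0..T}. \<bar>t' - t\<bar> < d \<longrightarrow> Hs_norm s (v t' - v t) < e"
proof -
  have "continuous_map (top_of_set {0..T}) (Hs.mtopology s) v"
    using v by (simp add: C0_Hs_def Hs_metric_def)
  then have "\<forall>x\<in>{0..T}. \<forall>\<epsilon>>0. \<exists>U. openin (top_of_set {0..T}) U \<and> x \<in> U \<and> (\<forall>y\<in>U. v y \<in> Hs.mball s (v x) \<epsilon>)"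
    unfolding Hs.continuous_map_to_metric topspace_euclidean_subtopology .
  with t e obtain U where U: "openin (top_of_set {0..T}) U" "t \<in> U" "\<forall>y\<in>U. v y \<in> Hs.mball s (v t) e"
    by blast
  from U(1) have "\<forall>x\<in>U. \<exists>d>0. \<forall>x'\<in>{0..T}. dist x' x < d \<longrightarrow> x' \<in> U"
    unfolding openin_euclidean_subtopology_iff by blast
  with U(2) obtain d where d: "0 < d" "\<forall>t'\<in>{0..T}. dist t' t < d \<longrightarrow> t' \<in> U" by blast
  have "Hs_norm s (v t' - v t) < e" if "t' \<in> {0..T}" "\<bar>t' - t\<bar> < d" for t'
  proof -
    have "t' \<in> U" using d(2) that by (simp add: dist_real_def)
    then have "v t' \<in> Hs.mball s (v t) e" using U(3) by blast
    then show ?thesis by (simp add: Hs_norm_minus_commute[of s "v t'"])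
  qed
  then show ?thesis using d(1) by blast
qed

lemma continuous_on_Times_uniform:
  fixes \<phi> :: "real \<Rightarrow> real \<Rightarrow> real"
  assumes t: "\<And>t e. t \<in> S \<Longrightarrow> 0 < e \<Longrightarrow> \<exists>d>0. \<forall>t'\<in>S. \<bar>t' - t\<bar> < d \<longrightarrow> (\<forall>x. \<bar>\<phi> t' x - \<phi> t x\<bar> < e)"
    and x: "\<And>t. t \<in> S \<Longrightarrow> continuous_on UNIV (\<phi> t)"
  shows "continuous_on (S \<times> X) (\<lambda>(t, x). \<phi> t x)"
  unfolding continuous_on_iff
proof (intro ballI allI impI)
  fix p e assume p: "p \<in> S \<times> X" and e: "(0::real) < e"
  obtain t x where tx: "p = (t, x)" "t \<in> S" using p by auto
  obtain d1 where d1: "0 < d1" "\<And>t' y. t' \<in> S \<Longrightarrow> \<bar>t' - t\<bar> < d1 \<Longrightarrow> \<bar>\<phi> t' y - \<phi> t y\<bar> < e/2"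
    using t[OF tx(2), of "e/2"] e by auto
  obtain d2 where d2: "0 < d2" "\<And>y. dist y x < d2 \<Longrightarrow> dist (\<phi> t y) (\<phi> t x) < e/2"
    using x[OF tx(2), unfolded continuous_on_iff, rule_format, OF UNIV_I, of "e/2" x] e by auto
  have "dist (\<phi> t' y) (\<phi> t x) < e" if "t' \<in> S" "dist (t', y) (t, x) < min d1 d2" for t' y
  proof -
    have "dist t' t < d1" "dist y x < d2"
      using that(2) dist_fst_le[of "(t', y)" "(t, x)"] dist_snd_le[of "(t', y)" "(t, x)"] by auto
    then have "\<bar>\<phi> t' y - \<phi> t y\<bar> < e/2" "\<bar>\<phi> t y - \<phi> t x\<bar> < e/2"
      using d1(2)[OF that(1), of y] d2(2)[of y] by (simp_all add: dist_real_def)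
    then show ?thesis unfolding dist_real_def by linarith
  qed
  then show "\<exists>d>0. \<forall>q\<in>S \<times> X. dist q p < d \<longrightarrow> dist (case q of (t, x) \<Rightarrow> \<phi> t x) (case p of (t, x) \<Rightarrow> \<phi> t x) < e"
    using d1(1) d2(1) by (intro exI[of _ "min d1 d2"]) (auto simp: tx(1))
qed

text \<open>Each coefficient is differentiated under the integral sign, for which the time
  derivative has to be jointly continuous in (t, x). The equation expresses it through v, its space
  derivative and the dispersive term, and \<open>Hs_uniform_bounds\<close> turns continuity in H^s
  into joint continuity of these.\<close>

lemma is_solution_csol:
  assumes sol: "is_solution \<alpha> s T v0 v" and s: "5/2 < s" and alpha: "1 < \<alpha>" "\<alpha> < 2"
  shows "csol (psym (\<alpha> - 1)) T s (\<lambda>t. fourier_coeff (v t))"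
  unfolding csol_def
proof (intro conjI ballI allI)
  have v: "v \<in> C0_Hs T s" using sol by (simp add: is_solution_def)
  note vH = C0_Hs_in_Hs[OF v]
  define \<beta> where "\<beta> = \<alpha> - 1"
  have \<beta>: "0 < \<beta>" "\<beta> < 1" using alpha by (auto simp: \<beta>_def)
  fix t n assume t: "t \<in> {0..T}"
  show "fourier_coeff (v t) (- n) = cnj (fourier_coeff (v t) n)" by (rule fourier_coeff_cnj)
  define \<psi> where "\<psi> t x = - (v t x * deriv (v t) x) - abs_D_powr \<beta> (deriv (v t)) x" for t x
  obtain Z where Z0: "0 < Z" and bounds: "\<forall>u\<in>Hs s. \<forall>v\<in>Hs s. \<forall>x. \<bar>u x - v x\<bar> \<le> Z * Hs_norm s (u - v) \<and>
     \<bar>deriv u x - deriv v x\<bar> \<le> Z * Hs_norm s (u - v) \<and>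
     \<bar>abs_D_powr \<beta> (deriv u) x - abs_D_powr \<beta> (deriv v) x\<bar> \<le> Z * Hs_norm s (u - v)"
    using Hs_uniform_bounds[OF s \<beta>] by (elim exE conjE) (rule that)
  have Z: "0 < Z" "\<bar>u x - v x\<bar> \<le> Z * Hs_norm s (u - v)" "\<bar>deriv u x - deriv v x\<bar> \<le> Z * Hs_norm s (u - v)"
    "\<bar>abs_D_powr \<beta> (deriv u) x - abs_D_powr \<beta> (deriv v) x\<bar> \<le> Z * Hs_norm s (u - v)"
    if "u \<in> Hs s" "v \<in> Hs s" for u v x
    using Z0 bounds[THEN bspec, OF that(1), THEN bspec, OF that(2), THEN spec, of x] by simp_all
  have unif: "\<exists>d>0. \<forall>t'\<in>{0..T}. \<bar>t' - t\<bar> < d \<longrightarrow> (\<forall>x. \<bar>L (v t') x - L (v t) x\<bar> < e)"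
    if L: "\<And>u v x. u \<in> Hs s \<Longrightarrow> v \<in> Hs s \<Longrightarrow> \<bar>L u x - L v x\<bar> \<le> Z * Hs_norm s (u - v)"
      and t: "t \<in> {0..T}" and e: "0 < e" for L :: "(real \<Rightarrow> real) \<Rightarrow> real \<Rightarrow> real" and t e
  proof -
    have "0 < e / Z" using e Z0 by simp
    from C0_Hs_time_continuous[OF v t this]
    obtain d where d: "0 < d" "\<forall>t'\<in>{0..T}. \<bar>t' - t\<bar> < d \<longrightarrow> Hs_norm s (v t' - v t) < e / Z" by blast
    have "\<bar>L (v t') x - L (v t) x\<bar> < e" if "t' \<in> {0..T}" "\<bar>t' - t\<bar> < d" for t' x
    proof -
      have "Z * Hs_norm s (v t' - v t) < Z * (e / Z)" using d(2) that Z0 by (intro mult_strict_left_mono) auto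
      then show ?thesis using L[OF vH[OF that(1)] vH[OF t], of x] Z0 by simp
    qed
    then show ?thesis using d(1) by blast
  qed
  have cont: "continuous_on UNIV (v t)" "continuous_on UNIV (deriv (v t))" "continuous_on UNIV (abs_D_powr \<beta> (deriv (v t)))"
    if t: "t \<in> {0..T}" for t
  proof -
    note w = wiener_Hs[OF s vH[OF t]] and S = Hs_series[OF s vH[OF t]]
    show "continuous_on UNIV (v t)" "continuous_on UNIV (deriv (v t))" "continuous_on UNIV (abs_D_powr \<beta> (deriv (v t)))"
      using continuous_on_of_real_fser[OF l1_mult_int(1)[OF w] S(1)] continuous_on_of_real_fser[OF l1_mult_int(2)[OF w] S(3)]
        continuous_on_of_real_fser[OF l1_psym[OF \<beta> w] S(5)[OF \<beta>]] by auto
  qed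
  have C: "continuous_on ({0..T} \<times> X) (\<lambda>p. L (v (fst p)) (snd p))"
    if "\<And>u v x. u \<in> Hs s \<Longrightarrow> v \<in> Hs s \<Longrightarrow> \<bar>L u x - L v x\<bar> \<le> Z * Hs_norm s (u - v)"
      and "\<And>t. t \<in> {0..T} \<Longrightarrow> continuous_on UNIV (L (v t))" for L :: "(real \<Rightarrow> real) \<Rightarrow> real \<Rightarrow> real" and X
    using continuous_on_Times_uniform[of "{0..T}" "\<lambda>t. L (v t)" X, OF unif[OF that(1)] that(2)]
    by (simp add: case_prod_unfold)
  have C\<psi>: "continuous_on ({0..T} \<times> X) (\<lambda>p. \<psi> (fst p) (snd p))" for X
    unfolding \<psi>_def
    by (intro continuous_on_diff continuous_on_minus continuous_on_mult
        C[of "\<lambda>u. u", OF Z(2) cont(1)] C[of deriv, OF Z(3) cont(2)]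
        C[of "\<lambda>u. abs_D_powr \<beta> (deriv u)", OF Z(4) cont(3)])
  have dv: "((\<lambda>\<tau>. v \<tau> x) has_real_derivative \<psi> t x) (at t within {0..T})" if "t \<in> {0..T}" for t x
  proof -
    have "\<forall>t\<in>{0..T}. \<forall>x. \<exists>D. ((\<lambda>\<tau>. v \<tau> x) has_real_derivative D) (at t within {0..T}) \<and>
      D + v t x * deriv (v t) x + abs_D_powr \<beta> (deriv (v t)) x = 0"
      using sol unfolding is_solution_def \<beta>_def by (elim conjE)
    from this[THEN bspec, OF that, THEN spec, of x]
    obtain D where "((\<lambda>\<tau>. v \<tau> x) has_real_derivative D) (at t within {0..T})"
      "D + v t x * deriv (v t) x + abs_D_powr \<beta> (deriv (v t)) x = 0" by (elim exE conjE)
    moreover from this(2) have "D = \<psi> t x" by (simp add: \<psi>_def)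
    ultimately show ?thesis by simp
  qed
  have "((\<lambda>\<tau>. integral (cbox 0 (2*pi)) (\<lambda>x. of_real (v \<tau> x) * cis (- (of_int n * x)))) has_vector_derivative
      integral (cbox 0 (2*pi)) (\<lambda>x. complex_of_real (\<psi> t x) * cis (- (of_int n * x)))) (at t within {0..T})"
  proof (rule leibniz_rule_vector_derivative)
    fix \<tau> x assume \<tau>: "\<tau> \<in> {0..T}"
    have "((\<lambda>\<tau>. v \<tau> x) has_vector_derivative \<psi> \<tau> x) (at \<tau> within {0..T})"
      using dv[OF \<tau>] by (simp add: has_real_derivative_iff_has_vector_derivative)
    from bounded_linear.has_vector_derivative[OF bounded_linear_of_real this]
    show "((\<lambda>\<tau>. complex_of_real (v \<tau> x) * cis (- (of_int n * x))) has_vector_derivative complex_of_real (\<psi> \<tau> x) * cis (- (of_int n * x))) (at \<tau> within {0..T})"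
      by (rule has_vector_derivative_mult_left)
  next
    fix \<tau> assume \<tau>: "\<tau> \<in> {0..T}"
    show "(\<lambda>x. complex_of_real (v \<tau> x) * cis (- (of_int n * x))) integrable_on cbox 0 (2*pi)"
      using fourier_integrable[OF cont(1)[OF \<tau>]] by simp
  next
    show "continuous_on ({0..T} \<times> cbox 0 (2*pi)) (\<lambda>(t, x). complex_of_real (\<psi> t x) * cis (- (of_int n * x)))"
      unfolding case_prod_unfold
      by (intro continuous_on_mult continuous_on_of_real C\<psi>) (intro continuous_intros)
  qed (use t in auto)
  from has_vector_derivative_divide[OF this, of "of_real (2*pi)"]
  have D: "((\<lambda>\<tau>. fourier_coeff (v \<tau>) n) has_vector_derivative fourier_coeff (\<psi> t) n) (at t within {0..T})"
    by (simp only: fourier_coeff_def cbox_interval)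
  have "\<psi> t = (\<lambda>x. - (v t x * deriv (v t) x) - abs_D_powr \<beta> (deriv (v t)) x)"
    by (rule ext) (rule \<psi>_def)
  with fourier_coeff_rhs[OF s vH[OF t] \<beta>, of n]
  have "fourier_coeff (\<psi> t) n = - (\<i> * of_int n / 2) * conv (fourier_coeff (v t)) (fourier_coeff (v t)) n
      - \<i> * of_real (psym \<beta> n) * fourier_coeff (v t) n" by (simp only:)
  with D show "((\<lambda>\<tau>. fourier_coeff (v \<tau>) n) has_vector_derivative
      - (\<i> * of_int n / 2) * conv (fourier_coeff (v t)) (fourier_coeff (v t)) n
      - \<i> * of_real (psym (\<alpha> - 1) n) * fourier_coeff (v t) n) (at t within {0..T})"
    by (simp only: \<beta>_def)
next
  have v: "v \<in> C0_Hs T s" using sol by (simp add: is_solution_def)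
  obtain B where "\<forall>y\<in>(\<lambda>t. Hs_norm s (v t)) ` {0..T}. y \<le> B"
    using C0_Hs_bdd_above[OF v] unfolding bdd_above_def by blast
  then have B: "\<And>t. t \<in> {0..T} \<Longrightarrow> Hs_norm s (v t) \<le> B" by blast
  have "wfin (hw (s/2)) (fourier_coeff (v t)) \<and> wsum (hw (s/2)) (fourier_coeff (v t)) \<le> B\<^sup>2" if t: "t \<in> {0..T}" for t
    using wfin_Hs[OF C0_Hs_in_Hs[OF v t]] B[OF t] unfolding Hs_norm_wsum by (simp add: sqrt_le_D)
  then show "\<exists>B. \<forall>t\<in>{0..T}. wfin (hw (s/2)) (fourier_coeff (v t)) \<and> wsum (hw (s/2)) (fourier_coeff (v t)) \<le> B" by blast
qed

section \<open>Constants and cosines\<close>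

lemma has_sum_two:
  assumes "i \<noteq> j" "\<And>k. k \<noteq> i \<Longrightarrow> k \<noteq> j \<Longrightarrow> f k = 0"
  shows "(f has_sum f i + f j) UNIV"
  by (rule has_sum_finite_neutralI[of "{i, j}"]) (use assms in auto)

lemma trig_in_Hs:
  assumes fin: "finite {n. h n \<noteq> 0}" and u: "\<And>x. complex_of_real (u x) = fser h x"
  shows "u \<in> Hs s" "fourier_coeff u = h"
proof -
  have l1: "l1 h"
    by (rule finite_nonzero_values_imp_summable_on) (use fin in simp)
  show c: "fourier_coeff u = h" using fser_coeff[OF l1 u] by blast
  have "u (x + 2 * pi) = u x" for x
    using u[of x] u[of "x + 2 * pi"] fser_periodic[of h x] by (metis of_real_eq_iff)
  moreover have "(\<lambda>n. (1 + (real_of_int n)\<^sup>2) powr s * (cmod (h n))\<^sup>2) summable_on UNIV"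
    by (rule finite_nonzero_values_imp_summable_on)
      (rule finite_subset[OF _ fin], auto)
  ultimately show "u \<in> Hs s"
    using continuous_on_of_real_fser[OF l1 u] by (simp add: Hs_def c)
qed

lemma const_Hs:
  shows "(\<lambda>_. c) \<in> Hs s" "fourier_coeff (\<lambda>_. c) = (\<lambda>n. if n = 0 then of_real c else 0)" "Hs_norm s (\<lambda>_. c) = \<bar>c\<bar>"
proof -
  let ?h = "\<lambda>n::int. if n = 0 then complex_of_real c else 0"
  have ser: "complex_of_real c = fser ?h x" for x
    using infsumI[OF has_sum_single[of 0 "\<lambda>n. ?h n * cis (of_int n * x)"]] by (simp add: fser_def)
  have fin: "finite {n. ?h n \<noteq> 0}" by (rule finite_subset[of _ "{0}"]) auto
  show "(\<lambda>_. c) \<in> Hs s" and c: "fourier_coeff (\<lambda>_. c) = ?h" using trig_in_Hs[OF fin ser] by auto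
  have "wsum (hw (s/2)) ?h = c\<^sup>2"
    unfolding wsum_def using infsumI[OF has_sum_single[of 0 "\<lambda>n. (hw (s/2) n * cmod (?h n))\<^sup>2"]] by (simp add: hw_def)
  then show "Hs_norm s (\<lambda>_. c) = \<bar>c\<bar>" by (simp add: Hs_norm_wsum c)
qed

text \<open>The index is shifted so that the frequencies \<open>Suc N\<close> and
  \<open>- Suc N\<close> are always distinct.\<close>

definition cosine :: "nat \<Rightarrow> real \<Rightarrow> real" where
  "cosine N x = cos (real (Suc N) * x)"

lemma cosine_Hs:
  shows "cosine N \<in> Hs s"
    and "slow K g \<Longrightarrow> wsum g (fourier_coeff (cosine N)) = (g (int (Suc N)))\<^sup>2 / 2"
proof -
  define m where "m = int (Suc N)"
  have m: "m \<noteq> - m" by (simp add: m_def)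
  let ?h = "\<lambda>n::int. if n = m \<or> n = - m then 1/2 else (0::complex)"
  have ser: "complex_of_real (cosine N x) = fser ?h x" for x
  proof -
    have "fser ?h x = ?h m * cis (of_int m * x) + ?h (- m) * cis (of_int (- m) * x)"
      unfolding fser_def by (rule infsumI, rule has_sum_two[OF m]) auto
    also have "\<dots> = of_real (cosine N x)"
    proof -
      have "real_of_int m * x = real (Suc N) * x" "real_of_int (- m) * x = - (real (Suc N) * x)"
        by (simp_all add: m_def algebra_simps)
      then show ?thesis by (simp only: cosine_def) (simp add: complex_eq_iff)
    qed
    finally show ?thesis by simp
  qed
  have fin: "finite {n. ?h n \<noteq> 0}" by (rule finite_subset[of _ "{m, - m}"]) auto
  show "cosine N \<in> Hs s" by (rule trig_in_Hs[OF fin ser])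
  have c: "fourier_coeff (cosine N) = ?h" by (rule trig_in_Hs[OF fin ser])
  assume g: "slow K g"
  have "wsum g ?h = (g m * cmod (?h m))\<^sup>2 + (g (- m) * cmod (?h (- m)))\<^sup>2"
    unfolding wsum_def by (rule infsumI, rule has_sum_two[OF m]) auto
  then show "wsum g (fourier_coeff (cosine N)) = (g (int (Suc N)))\<^sup>2 / 2"
    unfolding c slow_minus[OF g] m_def[symmetric] by (simp add: power_mult_distrib power_divide)
qed

lemma wsum_scale: "wsum g (\<lambda>n. of_real c * a n) = c\<^sup>2 * wsum g a"
  unfolding wsum_def by (simp add: norm_mult power_mult_distrib infsum_cmult_right' mult.left_commute[of _ "c\<^sup>2"])

text \<open>The size of the perturbation in the Sobolev norm is independent of its frequency.\<close>

definition bump :: "real \<Rightarrow> real \<Rightarrow> nat \<Rightarrow> real \<Rightarrow> real" where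
  "bump s \<eta> N = (\<eta> * hw (- s/2) (int (Suc N))) *\<^sub>R cosine N"

lemma bump_Hs:
  assumes s: "0 < s" and \<eta>: "0 < \<eta>"
  shows "bump s \<eta> N \<in> Hs s" "wsum (hw (s/2)) (fourier_coeff (bump s \<eta> N)) = \<eta>\<^sup>2 / 2"
    "Hs_norm s (bump s \<eta> N) < \<eta>" "(\<lambda>N. l2 (fourier_coeff (bump s \<eta> N))) \<longlonglongrightarrow> 0"
proof -
  define c where "c N = \<eta> * hw (- s/2) (int (Suc N))" for N
  have co: "fourier_coeff (bump s \<eta> N) = (\<lambda>n. of_real (c N) * fourier_coeff (cosine N) n)" for N
    unfolding bump_def c_def[symmetric] by (rule ext) (rule fourier_coeff_scaleR)
  show "bump s \<eta> N \<in> Hs s" unfolding bump_def by (rule Hs_scaleR[OF cosine_Hs(1)])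
  obtain K where K: "slow K (hw (s/2))" using slow_hw[of "s/2"] s by auto
  have "hw (- s/2) (int (Suc N)) * hw (s/2) (int (Suc N)) = 1"
    unfolding hw_add[symmetric] using base_ge_1(2)[of "int (Suc N)"] by (simp add: hw_def)
  then have "c N * hw (s/2) (int (Suc N)) = \<eta>" by (simp add: c_def mult.assoc)
  then show W: "wsum (hw (s/2)) (fourier_coeff (bump s \<eta> N)) = \<eta>\<^sup>2 / 2"
    unfolding co wsum_scale cosine_Hs(2)[OF K] by (metis power_mult_distrib times_divide_eq_right)
  have "sqrt (\<eta>\<^sup>2 / 2) < sqrt (\<eta>\<^sup>2)" using \<eta> by (intro real_sqrt_less_mono) simp
  then show "Hs_norm s (bump s \<eta> N) < \<eta>" unfolding Hs_norm_wsum W using \<eta> by simp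
  have l2: "l2 (fourier_coeff (bump s \<eta> N)) = (c N)\<^sup>2 / 2" for N
    unfolding co wsum_scale using cosine_Hs(2)[OF slow_const[of 1], of N] by simp
  have "(\<lambda>N. (1 + (real (Suc N))\<^sup>2) powr (- s/2)) \<longlonglongrightarrow> 0"
  proof (rule tendsto_neg_powr)
    show "- s/2 < 0" using s by simp
    have "filterlim (\<lambda>N. real (Suc N)) at_top sequentially"
      by (rule filterlim_compose[OF filterlim_real_sequentially filterlim_Suc])
    then show "filterlim (\<lambda>N. 1 + (real (Suc N))\<^sup>2) at_top sequentially"
      by (intro filterlim_tendsto_add_at_top[OF tendsto_const] filterlim_pow_at_top) auto
  qed
  then have "(\<lambda>N. (\<eta> * (1 + (real (Suc N))\<^sup>2) powr (- s/2))\<^sup>2 / 2) \<longlonglongrightarrow> (\<eta> * 0)\<^sup>2 / 2"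
    by (intro tendsto_intros) auto
  then show "(\<lambda>N. l2 (fourier_coeff (bump s \<eta> N))) \<longlonglongrightarrow> 0"
    unfolding l2 c_def by (simp add: hw_def)
qed

section \<open>The flow map\<close>

locale dispersive_burgers =
  fixes \<alpha> s r T :: real and u0 :: "real \<Rightarrow> real"
  assumes alpha: "1 < \<alpha>" "\<alpha> < 2" and s: "5/2 < s" and r: "0 < r" and u0: "u0 \<in> Hs s" and T: "0 < T"
    and well_posed: "\<And>v0. v0 \<in> mball_of (Hs_metric s) u0 r \<Longrightarrow> \<exists>!v. is_solution \<alpha> s T v0 v"
begin

abbreviation "B \<equiv> mball_of (Hs_metric s) u0 r"
abbreviation "\<Phi> \<equiv> flow \<alpha> s T"

definition A :: "(real \<Rightarrow> real) \<Rightarrow> real \<Rightarrow> int \<Rightarrow> complex" where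
  "A w t = fourier_coeff (\<Phi> w t)"

lemma B_iff: "w \<in> B \<longleftrightarrow> w \<in> Hs s \<and> Hs_norm s (w - u0) < r"
  using u0 by (simp add: Hs_metric_def Hs_norm_minus_commute)

lemma solution: "w \<in> B \<Longrightarrow> is_solution \<alpha> s T w (\<Phi> w)"
  unfolding flow_def by (rule theI'[OF well_posed])

lemma \<Phi>_in: "w \<in> B \<Longrightarrow> \<Phi> w \<in> C0_Hs T s" and \<Phi>_0: "w \<in> B \<Longrightarrow> \<Phi> w 0 = w"
  using solution[of w] by (auto simp: is_solution_def)

lemma csol_A: "w \<in> B \<Longrightarrow> csol (psym (\<alpha> - 1)) T s (A w)"
  unfolding A_def[abs_def] by (rule is_solution_csol[OF solution s alpha])

lemma A_0: "w \<in> B \<Longrightarrow> A w 0 = fourier_coeff w"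
  by (simp add: A_def \<Phi>_0)

text \<open>The boosted coefficients solve the same equation with the same datum, so
  \<open>csol_unique\<close> identifies them. Mode 0 is excluded since the boost adds c
  there.\<close>

lemma A_galilei:
  assumes w: "w \<in> B" and wc: "w + (\<lambda>_. c) \<in> B" and t: "t \<in> {0..T}" and n: "n \<noteq> 0"
  shows "A (w + (\<lambda>_. c)) t n = cis (of_int n * (- c * t)) * A w t n"
proof -
  let ?b = "\<lambda>t n. cis (of_int n * (- c * t)) * A w t n + (if n = 0 then of_real c else 0)"
  have "csol (psym (\<alpha> - 1)) T s ?b"
    by (rule csol_galilei[OF csol_A[OF w] s]) (simp add: psym_def)
  moreover have "A (w + (\<lambda>_. c)) 0 = ?b 0"
  proof
    fix n
    have "w \<in> Hs s" using w by (simp only: B_iff)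
    from fourier_coeff_add[OF Hs_continuous[OF this] Hs_continuous[OF const_Hs(1)]] show "A (w + (\<lambda>_. c)) 0 n = ?b 0 n"
      by (simp add: A_0[OF w] A_0[OF wc] const_Hs(2))
  qed
  ultimately have "A (w + (\<lambda>_. c)) t = ?b t"
    by (rule csol_unique[OF _ csol_A[OF wc] s _ t])
  then show ?thesis using n by simp
qed

lemma bump_in_B:
  assumes "0 < \<eta>" "\<eta> \<le> r"
  shows "u0 + bump s \<eta> N \<in> B"
proof -
  have "0 < s" using s by simp
  note b = bump_Hs[OF this assms(1)]
  show ?thesis unfolding B_iff using Hs_add(1)[OF u0 b(1)] b(3)[of N] assms(2) by simp
qed

text \<open>Both negative statements end here. \<open>initial_convergence\<close> would force the
  squared H^s norms of the bumps to 0, whereas they are all equal to \<eta>^2 / 2.\<close>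

lemma no_uniform_tails:
  assumes \<eta>: "0 < \<eta>" "\<eta> \<le> r"
    and tail: "\<And>\<epsilon>. 0 < \<epsilon> \<Longrightarrow> \<exists>F. finite F \<and>
      (\<forall>N. (\<Sum>\<^sub>\<infinity>n\<in>-F. (hw (s/2) n * cmod (A (u0 + bump s \<eta> N) T n))\<^sup>2) \<le> \<epsilon>)"
  shows False
proof -
  have s0: "0 < s" using s by simp
  note b = bump_Hs[OF s0 \<eta>(1)]
  have w: "u0 + bump s \<eta> N \<in> B" for N
    by (rule bump_in_B[OF \<eta>])
  have u0B: "u0 \<in> B" unfolding B_iff using u0 r by (simp add: Hs_norm_def fourier_coeff_def)
  have d: "(\<lambda>n. A (u0 + bump s \<eta> N) 0 n - A u0 0 n) = fourier_coeff (bump s \<eta> N)" for N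
    unfolding A_0[OF w] A_0[OF u0B]
    using fourier_coeff_add[OF Hs_continuous[OF u0] Hs_continuous[OF b(1)]] by auto
  have "(\<lambda>N. wsum (hw (s/2)) (\<lambda>n. A (u0 + bump s \<eta> N) 0 n - A u0 0 n)) \<longlonglongrightarrow> 0"
  proof (rule initial_convergence[OF csol_A[OF u0B] csol_A[OF w] s _ _ tail])
    show "(\<lambda>N. l2 (\<lambda>n. A (u0 + bump s \<eta> N) 0 n - A u0 0 n)) \<longlonglongrightarrow> 0" unfolding d by (rule b(4))
  qed (use T in auto)
  then have "(\<lambda>N::nat. \<eta>\<^sup>2 / 2) \<longlonglongrightarrow> 0" unfolding d b(2) .
  then show False using \<eta>(1) by (simp add: LIMSEQ_const_iff)
qed

end

text \<open>Boundedness is what makes the supremum in \<open>C0_Hs_norm\<close> dominate the norm at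
  each time, and it passes to differences by the triangle inequality.\<close>

definition C0b :: "real \<Rightarrow> real \<Rightarrow> (real \<Rightarrow> real \<Rightarrow> real) \<Rightarrow> bool" where
  "C0b T s v \<longleftrightarrow> (\<forall>t\<in>{0..T}. v t \<in> Hs s) \<and> bdd_above ((\<lambda>t. Hs_norm s (v t)) ` {0..T})"

lemma C0b_C0: "v \<in> C0_Hs T s \<Longrightarrow> C0b T s v"
  using C0_Hs_in_Hs C0_Hs_bdd_above by (auto simp: C0b_def)

lemma C0b_diff:
  assumes v: "C0b T s v" and w: "C0b T s w"
  shows "C0b T s (v - w)"
proof -
  obtain K L where "\<forall>y\<in>(\<lambda>t. Hs_norm s (v t)) ` {0..T}. y \<le> K" "\<forall>y\<in>(\<lambda>t. Hs_norm s (w t)) ` {0..T}. y \<le> L"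
    using v w unfolding C0b_def bdd_above_def by blast
  then have KL: "Hs_norm s (v t) \<le> K" "Hs_norm s (w t) \<le> L" if "t \<in> {0..T}" for t using that by auto
  have in_Hs: "v t \<in> Hs s" "w t \<in> Hs s" if "t \<in> {0..T}" for t using v w that by (auto simp: C0b_def)
  have "Hs_norm s (v t - w t) \<le> K + L" if t: "t \<in> {0..T}" for t
  proof -
    have "Hs_norm s (v t - w t) \<le> Hs_norm s (v t) + Hs_norm s (w t)"
      using Hs_add(2)[OF in_Hs(1)[OF t] Hs_scaleR(1)[OF in_Hs(2)[OF t], of "-1"]] Hs_scaleR(2)[OF in_Hs(2)[OF t], of "-1"]
      by simp
    then show ?thesis using KL[OF t] by linarith
  qed
  then have "bdd_above ((\<lambda>t. Hs_norm s ((v - w) t)) ` {0..T})" by (intro bdd_aboveI2[of _ _ "K + L"]) simp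
  then show ?thesis using Hs_diff[OF in_Hs] by (simp add: C0b_def)
qed

lemma C0b_norm_ge: "C0b T s v \<Longrightarrow> t \<in> {0..T} \<Longrightarrow> Hs_norm s (v t) \<le> C0_Hs_norm T s v"
  unfolding C0_Hs_norm_def C0b_def by (intro cSUP_upper) auto

lemma Hs_norm_diff_wsum:
  assumes "u \<in> Hs s" "v \<in> Hs s"
  shows "Hs_norm s (u - v) = sqrt (wsum (hw (s/2)) (\<lambda>n. fourier_coeff u n - fourier_coeff v n))"
  unfolding Hs_norm_wsum Hs_fourier_coeff_diff[OF assms] ..

lemma fourier_coeff_le_Hs_norm:
  assumes "0 \<le> s" "u \<in> Hs s"
  shows "cmod (fourier_coeff u n) \<le> Hs_norm s u"
proof -
  have "1 * cmod (fourier_coeff u n) \<le> hw (s/2) n * cmod (fourier_coeff u n)"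
    using hw_ge_1[of "s/2" n] assms(1) by (intro mult_right_mono) auto
  also have "\<dots> \<le> Hs_norm s u"
    unfolding Hs_norm_wsum wsum_def
    using finite_sum_le_infsum[of "\<lambda>n. (hw (s/2) n * cmod (fourier_coeff u n))\<^sup>2" UNIV "{n}"] wfin_Hs[OF assms(2)]
    by (intro real_le_rsqrt) (simp add: wfin_def)
  finally show ?thesis by simp
qed

section \<open>Averages and difference quotients of phases\<close>

lemma cmod_cis_minus_1: "(cmod (cis x - 1))\<^sup>2 = 2 - 2 * cos x"
proof -
  have "(cmod (cis x - 1))\<^sup>2 = (cos x)\<^sup>2 + (sin x)\<^sup>2 + 1 - 2 * cos x"
    by (simp add: cmod_power2 power2_diff)
  then show ?thesis by simp
qed

text \<open>Over \<open>c \<in> [0, c0]\<close> the factor \<open>\<bar>cis (- n c T) - 1\<bar>\<^sup>2\<close> has mean at least \<open>1\<close>.\<close>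

lemma average_translations:
  fixes q :: "int \<Rightarrow> real"
  assumes F: "finite F" and q: "\<And>n. 0 \<le> q n" and c0: "0 < c0" and T: "0 < T"
    and large: "\<And>n. n \<in> F \<Longrightarrow> 2 \<le> \<bar>real_of_int n\<bar> * T * c0"
    and bound: "\<And>c. c \<in> {0..c0} \<Longrightarrow> (\<Sum>n\<in>F. q n * (cmod (cis (of_int n * (- c * T)) - 1))\<^sup>2) \<le> E"
  shows "(\<Sum>n\<in>F. q n) \<le> E"
proof -
  \<comment> \<open>No single c serves all n, as the phase is trivial when n c T is a multiple of 2
    pi. In the integral of 2 - 2 cos(n T c) over [0, c0] the oscillating part is at most 2 / (|n| T)
    \<le> c0, which leaves at least c0.\<close>
  define I where "I n = 2 * c0 - 2 * sin (of_int n * T * c0) / (of_int n * T)" for n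
  have int: "((\<lambda>c. 2 - 2 * cos (of_int n * T * c)) has_integral I n) {0..c0}" if n: "n \<in> F" for n
  proof -
    have nz: "n \<noteq> 0" using large[OF n] by auto
    have "((\<lambda>c. 2 * c - 2 * sin (of_int n * T * c) / (of_int n * T)) has_real_derivative 2 - 2 * cos (of_int n * T * c)) (at c within {0..c0})" for c
      using nz T by (auto intro!: derivative_eq_intros)
    then have "((\<lambda>c. 2 - 2 * cos (of_int n * T * c)) has_integral
      (2 * c0 - 2 * sin (of_int n * T * c0) / (of_int n * T)) - (2 * 0 - 2 * sin (of_int n * T * 0) / (of_int n * T))) {0..c0}"
      using c0 by (intro fundamental_theorem_of_calculus) (auto simp: has_real_derivative_iff_has_vector_derivative)
    then show ?thesis by (simp add: I_def)
  qed
  have I_ge: "c0 \<le> I n" if n: "n \<in> F" for n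
  proof -
    have p: "0 < \<bar>real_of_int n\<bar> * T" using large[OF n] T by (auto simp: zero_less_mult_iff)
    have "\<bar>2 * sin (of_int n * T * c0) / (of_int n * T)\<bar> \<le> 2 / (\<bar>real_of_int n\<bar> * T)"
      using p T by (simp add: abs_mult divide_right_mono)
    also have "\<dots> \<le> c0" using large[OF n] p by (simp add: divide_le_eq mult_ac)
    finally show ?thesis unfolding I_def by linarith
  qed
  have "((\<lambda>c. \<Sum>n\<in>F. q n * (2 - 2 * cos (of_int n * T * c))) has_integral (\<Sum>n\<in>F. q n * I n)) {0..c0}"
    by (intro has_integral_sum F has_integral_mult_right int)
  moreover have "((\<lambda>c. E) has_integral E * c0) {0..c0}"
    using has_integral_const_real[of E 0 c0] c0 by (simp add: mult.commute)
  ultimately have "(\<Sum>n\<in>F. q n * I n) \<le> E * c0"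
  proof (rule has_integral_le)
    fix c assume c: "c \<in> {0..c0}"
    have "cos (of_int n * (- c * T)) = cos (of_int n * T * c)" for n
      using cos_minus[of "of_int n * T * c"] by (simp add: mult_ac)
    then show "(\<Sum>n\<in>F. q n * (2 - 2 * cos (of_int n * T * c))) \<le> E"
      using bound[OF c] by (simp only: cmod_cis_minus_1)
  qed
  moreover have "(\<Sum>n\<in>F. q n) * c0 \<le> (\<Sum>n\<in>F. q n * I n)"
    unfolding sum_distrib_right by (intro sum_mono mult_left_mono I_ge q)
  ultimately have "(\<Sum>n\<in>F. q n) * c0 \<le> E * c0" by linarith
  then show ?thesis using c0 by simp
qed

lemma finite_int_abs_less: "finite {n::int. \<bar>real_of_int n\<bar> < K}"
proof (rule finite_subset)
  show "{n::int. \<bar>real_of_int n\<bar> < K} \<subseteq> {- \<lceil>K\<rceil>..\<lceil>K\<rceil>}" by (auto simp: abs_less_iff) linarith+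
qed simp

lemma finite_hw_level:
  assumes "0 < p" "0 < q"
  shows "finite {n. q < hw (- p) n}"
proof (rule finite_subset[OF _ finite_int_abs_less])
  show "{n. q < hw (- p) n} \<subseteq> {n. \<bar>real_of_int n\<bar> < q powr (- (1/p))}"
  proof safe
    fix n assume "q < hw (- p) n"
    then have "hw (- p) n powr (- (1/p)) < q powr (- (1/p))"
      using assms by (intro powr_less_mono2_neg) auto
    moreover have "hw (- p) n powr (- (1/p)) = 1 + (real_of_int n)\<^sup>2"
      using assms base_ge_1(2)[of n] by (simp add: hw_def powr_powr)
    ultimately show "\<bar>real_of_int n\<bar> < q powr (- (1/p))" using abs_int_le[of n] by linarith
  qed
qed

lemma cis_difference_quotient:
  "((\<lambda>c. (cis (of_int n * (- c * T)) - 1) / of_real c) \<longlongrightarrow> - (\<i> * of_int n * of_real T)) (at_right 0)"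
proof -
  let ?k = "- (\<i> * of_int n * of_real T) :: complex"
  have "((\<lambda>z. exp (?k * z)) has_field_derivative ?k) (at 0)"
    by (auto intro!: derivative_eq_intros)
  then have "((\<lambda>h. (exp (?k * (0 + h)) - exp (?k * 0)) / h) \<longlongrightarrow> ?k) (at 0)"
    unfolding DERIV_def .
  then have lim: "((\<lambda>h. (exp (?k * h) - 1) / h) \<longlongrightarrow> ?k) (at 0)" by simp
  have "filterlim complex_of_real (at 0) (at_right 0)"
    by (intro filterlim_atI tendsto_eq_intros) (auto simp: eventually_at_right_field intro: exI[of _ 1] tendsto_of_real[of "\<lambda>x. x" 0, simplified])
  from filterlim_compose[OF lim this]
  have "((\<lambda>c. (exp (?k * of_real c) - 1) / of_real c) \<longlongrightarrow> ?k) (at_right 0)" .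
  moreover have "exp (?k * of_real c) = cis (of_int n * (- c * T))" for c
    by (simp add: cis_conv_exp mult_ac)
  ultimately show ?thesis by simp
qed

section \<open>Continuity of the flow and the two negative statements\<close>

context dispersive_burgers
begin

lemma flow_continuous:
  assumes w: "w \<in> B" and e: "0 < e"
  shows "\<exists>d>0. \<forall>z\<in>B. Hs_norm s (z - w) < d \<longrightarrow> C0_Hs_norm T s (\<Phi> z - \<Phi> w) \<le> e"
proof -
  have T0: "0 \<le> T" using T by simp
  have "0 < e\<^sup>2" using e by simp
  from csol_stability[OF csol_A[OF w] s T0 this] obtain \<delta> where \<delta>: "0 < \<delta>"
    "\<forall>b. csol (psym (\<alpha> - 1)) T s b \<and> wsum (hw (s/2)) (\<lambda>n. b 0 n - A w 0 n) < \<delta> \<longrightarrow>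
       (\<forall>t\<in>{0..T}. wsum (hw (s/2)) (\<lambda>n. b t n - A w t n) \<le> e\<^sup>2)" by blast
  have "C0_Hs_norm T s (\<Phi> z - \<Phi> w) \<le> e" if z: "z \<in> B" and d: "Hs_norm s (z - w) < sqrt \<delta>" for z
  proof -
    have zw: "z \<in> Hs s" "w \<in> Hs s" using z w by (simp_all only: B_iff)
    have "wsum (hw (s/2)) (\<lambda>n. A z 0 n - A w 0 n) < \<delta>"
      using d unfolding Hs_norm_diff_wsum[OF zw] A_0[OF z] A_0[OF w] by simp
    then have *: "wsum (hw (s/2)) (\<lambda>n. A z t n - A w t n) \<le> e\<^sup>2" if "t \<in> {0..T}" for t
      using \<delta>(2) csol_A[OF z] that by blast
    have "Hs_norm s (\<Phi> z t - \<Phi> w t) \<le> e" if t: "t \<in> {0..T}" for t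
      unfolding Hs_norm_diff_wsum[OF C0_Hs_in_Hs[OF \<Phi>_in[OF z] t] C0_Hs_in_Hs[OF \<Phi>_in[OF w] t]]
      using *[OF t] e unfolding A_def by (intro real_le_lsqrt) auto
    then show ?thesis unfolding C0_Hs_norm_def using T0 by (intro cSUP_least) auto
  qed
  then show ?thesis using \<delta>(1) by (intro exI[of _ "sqrt \<delta>"]) auto
qed

lemma add_const_in_B:
  assumes w: "w \<in> B" and c: "Hs_norm s (w - u0) + \<bar>c\<bar> < r"
  shows "w + (\<lambda>_. c) \<in> B"
proof -
  have wH: "w \<in> Hs s" using w by (simp only: B_iff)
  have eq: "w + (\<lambda>_. c) - u0 = (w - u0) + (\<lambda>_. c)" by simp
  have "Hs_norm s (w + (\<lambda>_. c) - u0) \<le> Hs_norm s (w - u0) + \<bar>c\<bar>"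
    unfolding eq using Hs_add(2)[OF Hs_diff[OF wH u0] const_Hs(1)[of c s]] by (simp add: const_Hs(3))
  then show ?thesis unfolding B_iff using Hs_add(1)[OF wH const_Hs(1)] c by simp
qed

lemma wfin_A: "w \<in> B \<Longrightarrow> wfin (hw (s/2)) (A w T)"
  using csolD(2)[OF csol_A, of w T] T by simp

text \<open>One modulus d serves the data of all bumps at once. For every c in [0, c0] it bounds the
  H^s distance at time T between a solution and its translate; averaging over c converts these
  bounds into a bound on the tail that is independent of N.\<close>

lemma not_uniformly_continuous:
  assumes unif: "\<And>e. 0 < e \<Longrightarrow> \<exists>d>0. \<forall>z\<in>B. \<forall>w\<in>B. Hs_norm s (z - w) < d \<longrightarrow> C0_Hs_norm T s (\<Phi> z - \<Phi> w) < e"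
  shows False
proof (rule no_uniform_tails[of "r/2"])
  show "0 < r/2" "r/2 \<le> r" using r by auto
  fix \<epsilon> :: real assume \<epsilon>: "0 < \<epsilon>"
  obtain d where d: "0 < d" "\<And>z w. z \<in> B \<Longrightarrow> w \<in> B \<Longrightarrow> Hs_norm s (z - w) < d \<Longrightarrow> C0_Hs_norm T s (\<Phi> z - \<Phi> w) < sqrt \<epsilon>"
    using unif[of "sqrt \<epsilon>"] \<epsilon> by (meson real_sqrt_gt_zero)
  \<comment> \<open>The entry d/2 keeps the boost within the modulus; r/4 keeps the boosted datum in
    the ball, the bump having norm less than r/2.\<close>
  define c0 where "c0 = min (d/2) (r/4)"
  have c0: "0 < c0" using d(1) r by (simp add: c0_def)
  \<comment> \<open>Off F the averaging condition holds, which also excludes n = 0. The set depends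
    on d, r and T but not on N.\<close>
  define F where "F = {n::int. \<bar>real_of_int n\<bar> < 2 / (T * c0)}"
  have F: "finite F" unfolding F_def by (rule finite_int_abs_less)
  have large: "2 \<le> \<bar>real_of_int n\<bar> * T * c0" "n \<noteq> 0" if "n \<notin> F" for n
  proof -
    have "2 / (T * c0) \<le> \<bar>real_of_int n\<bar>" using that by (simp add: F_def)
    then show "2 \<le> \<bar>real_of_int n\<bar> * T * c0" using T c0 by (simp add: divide_le_eq mult_ac)
    then show "n \<noteq> 0" by auto
  qed
  have TT: "T \<in> {0..T}" using T by simp
  have "(\<Sum>\<^sub>\<infinity>n\<in>-F. (hw (s/2) n * cmod (A (u0 + bump s (r/2) N) T n))\<^sup>2) \<le> \<epsilon>" for N
  proof (rule infsum_le_finite_sums)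
    define w where "w = u0 + bump s (r/2) N"
    have w: "w \<in> B" unfolding w_def using r by (intro bump_in_B) auto
    have "0 < s" using s by simp
    then have wd: "Hs_norm s (w - u0) < r/2" using bump_Hs(3)[of s "r/2" N] r by (simp add: w_def)
    show "(\<lambda>n. (hw (s/2) n * cmod (A (u0 + bump s (r/2) N) T n))\<^sup>2) summable_on - F"
      using wfin_A[OF w] unfolding wfin_def w_def by (rule summable_on_subset_banach) simp
    fix G assume G: "finite G" "G \<subseteq> - F"
    have "(\<Sum>n\<in>G. (hw (s/2) n * cmod (A w T n))\<^sup>2) \<le> \<epsilon>"
    proof (rule average_translations[OF G(1) _ c0 T])
      show "2 \<le> \<bar>real_of_int n\<bar> * T * c0" if "n \<in> G" for n using large(1) G that by blast
      fix c assume c: "c \<in> {0..c0}"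
      then have c': "c < d" "c < r/2" "0 \<le> c" using d(1) r by (auto simp: c0_def)
      have wc: "w + (\<lambda>_. c) \<in> B" by (rule add_const_in_B[OF w]) (use wd c' in auto)
      have "Hs_norm s (w + (\<lambda>_. c) - w) < d" using c' by (simp add: const_Hs(3))
      then have lt: "C0_Hs_norm T s (\<Phi> (w + (\<lambda>_. c)) - \<Phi> w) < sqrt \<epsilon>" by (rule d(2)[OF wc w])
      note in_Hs = C0_Hs_in_Hs[OF \<Phi>_in[OF wc] TT] C0_Hs_in_Hs[OF \<Phi>_in[OF w] TT]
      have "Hs_norm s (\<Phi> (w + (\<lambda>_. c)) T - \<Phi> w T) < sqrt \<epsilon>"
        using C0b_norm_ge[OF C0b_diff[OF C0b_C0[OF \<Phi>_in[OF wc]] C0b_C0[OF \<Phi>_in[OF w]]] TT] lt by simp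
      then have W: "wsum (hw (s/2)) (\<lambda>n. A (w + (\<lambda>_. c)) T n - A w T n) \<le> \<epsilon>"
        unfolding Hs_norm_diff_wsum[OF in_Hs] A_def by simp
      have "(\<Sum>n\<in>G. (hw (s/2) n * cmod (A w T n))\<^sup>2 * (cmod (cis (of_int n * (- c * T)) - 1))\<^sup>2)
         = (\<Sum>n\<in>G. (hw (s/2) n * cmod (A (w + (\<lambda>_. c)) T n - A w T n))\<^sup>2)"
      proof (rule sum.cong[OF refl])
        fix n assume "n \<in> G"
        then have "n \<noteq> 0" using large(2) G by blast
        from A_galilei[OF w wc TT this]
        have "A (w + (\<lambda>_. c)) T n - A w T n = (cis (of_int n * (- c * T)) - 1) * A w T n"
          by (simp add: algebra_simps)
        then show "(hw (s/2) n * cmod (A w T n))\<^sup>2 * (cmod (cis (of_int n * (- c * T)) - 1))\<^sup>2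
           = (hw (s/2) n * cmod (A (w + (\<lambda>_. c)) T n - A w T n))\<^sup>2"
          by (simp only: norm_mult power_mult_distrib mult_ac)
      qed
      also have "\<dots> \<le> wsum (hw (s/2)) (\<lambda>n. A (w + (\<lambda>_. c)) T n - A w T n)"
        unfolding wsum_def
        using wfin_diff(1)[OF wfin_A[OF wc] wfin_A[OF w] less_imp_le[OF hw_pos]]
        by (intro finite_sum_le_infsum G) (auto simp: wfin_def)
      finally show "(\<Sum>n\<in>G. (hw (s/2) n * cmod (A w T n))\<^sup>2 * (cmod (cis (of_int n * (- c * T)) - 1))\<^sup>2) \<le> \<epsilon>"
        using W by linarith
    qed simp
    then show "(\<Sum>n\<in>G. (hw (s/2) n * cmod (A (u0 + bump s (r/2) N) T n))\<^sup>2) \<le> \<epsilon>" by (simp add: w_def)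
  qed
  then show "\<exists>F. finite F \<and> (\<forall>N. (\<Sum>\<^sub>\<infinity>n\<in>-F. (hw (s/2) n * cmod (A (u0 + bump s (r/2) N) T n))\<^sup>2) \<le> \<epsilon>)"
    using F by blast
qed

text \<open>
  The Galilean boost by \<open>c\<close> translates the solution by \<open>c t\<close>, so the derivative of the flow
  in the direction of the constants contains \<open>- t \<partial>\<^sub>x v\<close>.
\<close>

lemma derivative_in_constant_direction:
  assumes w: "w \<in> B" and wc: "\<And>c. 0 < c \<Longrightarrow> c < c1 \<Longrightarrow> w + (\<lambda>_. c) \<in> B" and c1: "0 < c1"
    and \<sigma>: "0 \<le> \<sigma>" and \<Phi>\<sigma>: "\<Phi> \<in> B \<rightarrow> C0_Hs T \<sigma>"
    and g: "g \<in> C0_Hs T \<sigma>"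
    and diff: "\<And>e. 0 < e \<Longrightarrow> \<exists>d>0. \<forall>c. 0 < c \<and> c < d \<longrightarrow>
        C0b T \<sigma> (\<Phi> (w + (\<lambda>_. c)) - \<Phi> w - c *\<^sub>R g) \<and> C0_Hs_norm T \<sigma> (\<Phi> (w + (\<lambda>_. c)) - \<Phi> w - c *\<^sub>R g) \<le> e * c"
    and n: "n \<noteq> 0"
  shows "fourier_coeff (g T) n = - (\<i> * of_int n * of_real T) * A w T n"
proof -
  have TT: "T \<in> {0..T}" using T by simp
  let ?D = "- (\<i> * of_int n * of_real T) * A w T n"
  let ?q = "\<lambda>c. (cis (of_int n * (- c * T)) - 1) / of_real c"
  have lim: "cmod (?D - fourier_coeff (g T) n) \<le> e" if e: "0 < e" for e
  proof (rule tendsto_upperbound)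
    show "((\<lambda>c. cmod (?q c * A w T n - fourier_coeff (g T) n)) \<longlongrightarrow> cmod (?D - fourier_coeff (g T) n)) (at_right 0)"
      by (rule tendsto_norm[OF tendsto_diff[OF tendsto_mult[OF cis_difference_quotient tendsto_const] tendsto_const]])
    from diff[OF e] obtain d where d: "0 < d" "\<forall>c. 0 < c \<and> c < d \<longrightarrow>
        C0b T \<sigma> (\<Phi> (w + (\<lambda>_. c)) - \<Phi> w - c *\<^sub>R g) \<and> C0_Hs_norm T \<sigma> (\<Phi> (w + (\<lambda>_. c)) - \<Phi> w - c *\<^sub>R g) \<le> e * c"
      by (elim exE conjE) (rule that)
    \<comment> \<open>Mode n of the remainder at time T is c times the quantity to be estimated. As
      \<sigma> \<ge> 0, the norm of H^\<sigma> dominates each single coefficient, so the bound e c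
      on the remainder can be divided by c.\<close>
    have *: "cmod (?q c * A w T n - fourier_coeff (g T) n) \<le> e" if c: "0 < c" "c < min d c1" for c
    proof -
      define x where "x = \<Phi> (w + (\<lambda>_. c)) T - \<Phi> w T - c *\<^sub>R g T"
      have wcB: "w + (\<lambda>_. c) \<in> B" using c by (intro wc) auto
      have "0 < c \<and> c < d" using c by simp
      note D = d(2)[THEN spec, THEN mp, OF this]
      have xT: "x = (\<Phi> (w + (\<lambda>_. c)) - \<Phi> w - c *\<^sub>R g) T" by (simp add: x_def)
      have x1: "x \<in> Hs \<sigma>" unfolding xT using D[THEN conjunct1] TT unfolding C0b_def by (elim conjE) (rule bspec)
      have x2: "Hs_norm \<sigma> x \<le> e * c"
        unfolding xT by (rule order_trans[OF C0b_norm_ge[OF D[THEN conjunct1] TT] D[THEN conjunct2]])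
      have H: "\<Phi> (w + (\<lambda>_. c)) T \<in> Hs \<sigma>" "\<Phi> w T \<in> Hs \<sigma>" "c *\<^sub>R g T \<in> Hs \<sigma>"
        by (rule C0_Hs_in_Hs[OF funcset_mem[OF \<Phi>\<sigma> wcB] TT] C0_Hs_in_Hs[OF funcset_mem[OF \<Phi>\<sigma> w] TT]
            Hs_scaleR(1)[OF C0_Hs_in_Hs[OF g TT]])+
      have "fourier_coeff x n = A (w + (\<lambda>_. c)) T n - A w T n - of_real c * fourier_coeff (g T) n"
        unfolding x_def Hs_fourier_coeff_diff[OF Hs_diff[OF H(1,2)] H(3)] Hs_fourier_coeff_diff[OF H(1,2)]
          fourier_coeff_scaleR A_def ..
      also have "\<dots> = (cis (of_int n * (- c * T)) - 1) * A w T n - of_real c * fourier_coeff (g T) n"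
        unfolding A_galilei[OF w wcB TT n] by (simp only: left_diff_distrib mult_1)
      also have "\<dots> = of_real c * (?q c * A w T n - fourier_coeff (g T) n)"
        unfolding right_diff_distrib using c(1) by simp
      finally have "cmod (fourier_coeff x n) = c * cmod (?q c * A w T n - fourier_coeff (g T) n)"
        using c(1) by (simp only: norm_mult norm_of_real abs_of_pos)
      moreover have "cmod (fourier_coeff x n) \<le> e * c"
        using fourier_coeff_le_Hs_norm[OF \<sigma> x1, of n] x2 by linarith
      ultimately have "c * cmod (?q c * A w T n - fourier_coeff (g T) n) \<le> c * e" by (simp only: mult.commute)
      then show ?thesis using c(1) by (simp only: mult_le_cancel_left_pos)
    qed
    have "0 < min d c1" using d(1) c1 by simp
    then show "\<forall>\<^sub>F c in at_right 0. cmod (?q c * A w T n - fourier_coeff (g T) n) \<le> e"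
      unfolding eventually_at_right_field using * by (intro exI[of _ "min d c1"] conjI allI impI)
  qed (rule trivial_limit_at_right_real)
  have "cmod (?D - fourier_coeff (g T) n) \<le> 0"
  proof (rule field_le_epsilon)
    fix e :: real assume "0 < e"
    then show "cmod (?D - fourier_coeff (g T) n) \<le> 0 + e" unfolding add_0 by (rule lim)
  qed
  then have "?D - fourier_coeff (g T) n = 0" by (simp only: norm_le_zero_iff)
  then show ?thesis by (simp only: right_minus_eq)
qed

text \<open>Continuity of the derivative at u0, with tolerance 1, bounds \<open>Df w\<close> on the
  constant 1 in H^\<sigma> for all w near u0, where \<sigma> = s - 1 + \<epsilon>. At time T its
  modes are - i n T times those of the solution; the factor n turns this into a bound in H^(s +
  \<epsilon>), and the surplus \<epsilon> makes the tails in H^s uniformly small.\<close>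

lemma not_C1:
  assumes \<epsilon>: "0 < \<epsilon>"
    and C1: "C1_map_between (Hs s) (Hs_norm s) (C0_Hs T (s - 1 + \<epsilon>)) (C0_Hs_norm T (s - 1 + \<epsilon>)) B \<Phi>"
  shows False
proof -
  define \<sigma> where "\<sigma> = s - 1 + \<epsilon>"
  have \<sigma>: "0 \<le> \<sigma>" using s \<epsilon> by (simp add: \<sigma>_def)
  have TT: "T \<in> {0..T}" using T by simp
  let ?N = "C0_Hs_norm T \<sigma>" and ?one = "(\<lambda>_. 1) :: real \<Rightarrow> real"
  obtain Df where \<Phi>\<sigma>: "\<Phi> \<in> B \<rightarrow> C0_Hs T \<sigma>"
    and lin: "\<forall>u\<in>B. bounded_linear_between (Hs s) (Hs_norm s) (C0_Hs T \<sigma>) ?N (Df u)"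
    and dif: "\<forall>u\<in>B. \<forall>e>0. \<exists>d>0. \<forall>w\<in>B. Hs_norm s (w - u) < d \<longrightarrow>
           ?N (\<Phi> w - \<Phi> u - Df u (w - u)) \<le> e * Hs_norm s (w - u)"
    and con: "\<forall>u\<in>B. \<forall>e>0. \<exists>d>0. \<forall>w\<in>B. Hs_norm s (w - u) < d \<longrightarrow>
           (\<forall>h\<in>Hs s. ?N (Df w h - Df u h) \<le> e * Hs_norm s h)"
    using C1 unfolding C1_map_between_def \<sigma>_def[symmetric] by (elim conjE exE) (rule that)
  have DfC: "Df u h \<in> C0_Hs T \<sigma>" if "u \<in> B" "h \<in> Hs s" for u h
    using bspec[OF lin that(1)] that(2) unfolding bounded_linear_between_def by blast
  have Dfs: "Df u (c *\<^sub>R h) = c *\<^sub>R Df u h" if "u \<in> B" "h \<in> Hs s" for u h c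
    using bspec[OF lin that(1)] that(2) unfolding bounded_linear_between_def by blast
  have u0B: "u0 \<in> B" unfolding B_iff using u0 r by (simp add: Hs_norm_def fourier_coeff_def)
  from con[THEN bspec, OF u0B, THEN spec, THEN mp, OF zero_less_one]
  obtain d where d: "0 < d" "\<forall>w\<in>B. Hs_norm s (w - u0) < d \<longrightarrow> (\<forall>h\<in>Hs s. ?N (Df w h - Df u0 h) \<le> 1 * Hs_norm s h)"
    by (elim exE conjE) (rule that)
  \<comment> \<open>The bumps stay in the ball as well as in the neighbourhood of u0 where the
    derivative is bounded.\<close>
  define \<eta> where "\<eta> = min r d"
  have \<eta>: "0 < \<eta>" "\<eta> \<le> r" "\<eta> \<le> d" using r d(1) by (auto simp: \<eta>_def)
  define L where "L = 1 + ?N (Df u0 ?one)"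
  have bound: "Hs_norm \<sigma> (Df w ?one T) \<le> L" if w: "w \<in> B" "Hs_norm s (w - u0) < d" for w
  proof -
    note C = DfC[OF w(1) const_Hs(1)[of 1]] DfC[OF u0B const_Hs(1)[of 1]]
    have "Hs_norm \<sigma> (Df w ?one T - Df u0 ?one T) \<le> 1"
      using C0b_norm_ge[OF C0b_diff[OF C0b_C0[OF C(1)] C0b_C0[OF C(2)]] TT] d(2)[rule_format, OF w const_Hs(1)[of 1]]
      by (simp add: const_Hs(3))
    moreover have "Hs_norm \<sigma> (Df u0 ?one T) \<le> ?N (Df u0 ?one)" by (rule C0b_norm_ge[OF C0b_C0[OF C(2)] TT])
    moreover have "Hs_norm \<sigma> (Df w ?one T) \<le> Hs_norm \<sigma> (Df w ?one T - Df u0 ?one T) + Hs_norm \<sigma> (Df u0 ?one T)"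
      using Hs_add(2)[OF Hs_diff[OF C0_Hs_in_Hs[OF C(1) TT] C0_Hs_in_Hs[OF C(2) TT]] C0_Hs_in_Hs[OF C(2) TT]] by simp
    ultimately show ?thesis by (simp add: L_def)
  qed
  have deriv: "fourier_coeff (Df w ?one T) n = - (\<i> * of_int n * of_real T) * A w T n" if w: "w \<in> B" and n: "n \<noteq> 0" for w n
  proof (rule derivative_in_constant_direction[OF w _ _ \<sigma> \<Phi>\<sigma> DfC[OF w const_Hs(1)] _ n])
    have wn: "Hs_norm s (w - u0) < r" using w by (simp only: B_iff)
    show wc: "w + (\<lambda>_. c) \<in> B" if "0 < c" "c < r - Hs_norm s (w - u0)" for c
      by (rule add_const_in_B[OF w]) (use that in auto)
    show "0 < r - Hs_norm s (w - u0)" using wn by simp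
    fix e :: real assume e: "0 < e"
    from dif[THEN bspec, OF w, THEN spec, THEN mp, OF e]
    obtain d where d: "0 < d" "\<forall>z\<in>B. Hs_norm s (z - w) < d \<longrightarrow> ?N (\<Phi> z - \<Phi> w - Df w (z - w)) \<le> e * Hs_norm s (z - w)"
      by (elim exE conjE) (rule that)
    show "\<exists>d>0. \<forall>c. 0 < c \<and> c < d \<longrightarrow>
        C0b T \<sigma> (\<Phi> (w + (\<lambda>_. c)) - \<Phi> w - c *\<^sub>R Df w ?one) \<and> ?N (\<Phi> (w + (\<lambda>_. c)) - \<Phi> w - c *\<^sub>R Df w ?one) \<le> e * c"
    proof (intro exI[of _ "min d (r - Hs_norm s (w - u0))"] conjI allI impI)
      show "0 < min d (r - Hs_norm s (w - u0))" using d(1) wn by simp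
      fix c assume c: "0 < c \<and> c < min d (r - Hs_norm s (w - u0))"
      have wcB: "w + (\<lambda>_. c) \<in> B" by (rule wc) (use c in auto)
      have eq: "w + (\<lambda>_. c) - w = c *\<^sub>R ?one" "c *\<^sub>R ?one = (\<lambda>_. c)" by (auto simp: fun_eq_iff)
      have nc: "Hs_norm s (w + (\<lambda>_. c) - w) = c" unfolding eq using c by (simp add: const_Hs(3))
      have Dc: "Df w (w + (\<lambda>_. c) - w) = c *\<^sub>R Df w ?one" unfolding eq(1) by (rule Dfs[OF w const_Hs(1)])
      have "c *\<^sub>R Df w ?one \<in> C0_Hs T \<sigma>"
        unfolding Dfs[OF w const_Hs(1), symmetric] eq(2) by (rule DfC[OF w const_Hs(1)])
      then show "C0b T \<sigma> (\<Phi> (w + (\<lambda>_. c)) - \<Phi> w - c *\<^sub>R Df w ?one)"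
        using \<Phi>\<sigma> w wcB by (intro C0b_diff C0b_C0) auto
      show "?N (\<Phi> (w + (\<lambda>_. c)) - \<Phi> w - c *\<^sub>R Df w ?one) \<le> e * c"
        using d(2)[THEN bspec, OF wcB] c unfolding nc Dc by simp
    qed
  qed
  show False
  proof (rule no_uniform_tails[OF \<eta>(1,2)])
    fix \<epsilon>' :: real assume \<epsilon>': "0 < \<epsilon>'"
    define M where "M = 1 + L\<^sup>2"
    \<comment> \<open>Chosen so that \<open>2 * q / T\<^sup>2 * M\<close> is \<epsilon>'; the
      summand 1 in M keeps the denominator positive.\<close>
    define q where "q = \<epsilon>' * T\<^sup>2 / (2 * M)"
    have M: "0 < M" "L\<^sup>2 \<le> M" by (simp_all add: M_def add_pos_nonneg)
    have q: "0 < q" using \<epsilon>' T M by (simp add: q_def)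
    \<comment> \<open>Mode 0 is set aside because the formula for the derivative excludes it; off F
      the gain <n>^(-2 \<epsilon>) is at most q.\<close>
    define F where "F = insert 0 {n. q < hw (- \<epsilon>) n}"
    have F: "finite F" unfolding F_def using finite_hw_level[OF \<epsilon> q] by simp
    have "(\<Sum>\<^sub>\<infinity>n\<in>-F. (hw (s/2) n * cmod (A (u0 + bump s \<eta> N) T n))\<^sup>2) \<le> \<epsilon>'" for N
    proof -
      define w where "w = u0 + bump s \<eta> N"
      have w: "w \<in> B" unfolding w_def by (rule bump_in_B[OF \<eta>(1,2)])
      have "0 < s" using s by simp
      then have wd: "Hs_norm s (w - u0) < d" using bump_Hs(3)[of s \<eta> N] \<eta> by (simp add: w_def)
      let ?G = "\<lambda>n. (hw (\<sigma>/2) n * cmod (fourier_coeff (Df w ?one T) n))\<^sup>2"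
      have gH: "Df w ?one T \<in> Hs \<sigma>" by (rule C0_Hs_in_Hs[OF DfC[OF w const_Hs(1)] TT])
      have Gs: "?G summable_on UNIV" using wfin_Hs[OF gH] by (simp add: wfin_def)
      have GL: "infsum ?G UNIV \<le> L\<^sup>2"
        using bound[OF w wd] unfolding Hs_norm_wsum wsum_def by (rule sqrt_le_D)
      have le: "(hw (s/2) n * cmod (A w T n))\<^sup>2 \<le> (2 * q / T\<^sup>2) * ?G n" if n: "n \<in> - F" for n
      proof -
        have n0: "n \<noteq> 0" and hq: "hw (- \<epsilon>) n \<le> q" using n by (auto simp: F_def)
        have "1 \<le> \<bar>real_of_int n\<bar>" using n0 by linarith
        then have n1: "1 \<le> (real_of_int n)\<^sup>2" using one_le_power[of "\<bar>real_of_int n\<bar>" 2] by simp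
        \<comment> \<open>This is s = \<sigma> + 1 - \<epsilon> in the exponents. For n \<noteq> 0
          the factor 1 + n^2 is at most 2 n^2, which matches the derivative in
          \<open>?G\<close>.\<close>
        have "(hw (s/2) n)\<^sup>2 = hw \<sigma> n * (hw 1 n * hw (- \<epsilon>) n)"
          unfolding hw_power2 hw_add[symmetric] by (simp add: \<sigma>_def)
        also have "\<dots> \<le> hw \<sigma> n * ((2 * (real_of_int n)\<^sup>2) * q)"
          using n1 hq hw_pos[of "- \<epsilon>" n] hw_pos[of \<sigma> n] by (intro mult_left_mono mult_mono) (auto simp: hw_1)
        finally have "(hw (s/2) n)\<^sup>2 * (cmod (A w T n))\<^sup>2 \<le> (hw \<sigma> n * ((2 * (real_of_int n)\<^sup>2) * q)) * (cmod (A w T n))\<^sup>2"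
          by (intro mult_right_mono) auto
        also have "\<dots> = (2 * q / T\<^sup>2) * ?G n"
        proof -
          have "?G n = hw \<sigma> n * ((real_of_int n)\<^sup>2 * T\<^sup>2 * (cmod (A w T n))\<^sup>2)"
            unfolding deriv[OF w n0] power_mult_distrib hw_power2 by (simp add: norm_mult power_mult_distrib)
          then show ?thesis using T by simp
        qed
        finally show ?thesis by (simp add: power_mult_distrib)
      qed
      have Gs': "(\<lambda>n. (2 * q / T\<^sup>2) * ?G n) summable_on - F"
        by (rule summable_on_subset_banach[OF summable_on_cmult_right[OF Gs]]) simp
      have As: "(\<lambda>n. (hw (s/2) n * cmod (A w T n))\<^sup>2) summable_on - F"
        using wfin_A[OF w] unfolding wfin_def by (rule summable_on_subset_banach) simp
      have "(\<Sum>\<^sub>\<infinity>n\<in>-F. (hw (s/2) n * cmod (A w T n))\<^sup>2) \<le> (\<Sum>\<^sub>\<infinity>n\<in>-F. (2 * q / T\<^sup>2) * ?G n)"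
        by (rule infsum_mono[OF As Gs' le])
      also have "\<dots> = (2 * q / T\<^sup>2) * infsum ?G (- F)" by (rule infsum_cmult_right')
      also have "\<dots> \<le> (2 * q / T\<^sup>2) * M"
      proof (rule mult_left_mono)
        have "infsum ?G (- F) \<le> infsum ?G UNIV"
          by (rule infsum_mono2[OF summable_on_subset_banach[OF Gs] Gs]) auto
        then show "infsum ?G (- F) \<le> M" using GL M(2) by linarith
      qed (use q in simp)
      also have "\<dots> = \<epsilon>'" using T M(1) by (simp add: q_def)
      finally show ?thesis by (simp add: w_def)
    qed
    then show "\<exists>F. finite F \<and> (\<forall>N. (\<Sum>\<^sub>\<infinity>n\<in>-F. (hw (s/2) n * cmod (A (u0 + bump s \<eta> N) T n))\<^sup>2) \<le> \<epsilon>')"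
      using F by blast
  qed
qed

end

theorem corollary1p1:
  fixes \<alpha> s r C T :: real and u0 :: "real \<Rightarrow> real"
  assumes alpha: "1 < \<alpha>" "\<alpha> < 2"
    and s: "s > of_int \<lceil>\<alpha> / (\<alpha> - 1)\<rceil> - 1/2"
    and r: "r > 0"
    and u0: "u0 \<in> Hs s"
    and C: "well_posedness_constant \<alpha> s r u0 C"
    and T: "0 < T" "T < C / (r + Linf_norm (deriv u0))"
  shows "(continuous_map (mtopology_of (submetric (Hs_metric s) (mball_of (Hs_metric s) u0 r)))
            (mtopology_of (C0_Hs_metric T s)) (flow \<alpha> s T) \<and>
          \<not> uniformly_continuous_map (submetric (Hs_metric s) (mball_of (Hs_metric s) u0 r))
            (C0_Hs_metric T s) (flow \<alpha> s T)) \<and>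
         (\<forall>\<epsilon>>0. \<not> C1_map_between (Hs s) (Hs_norm s)
            (C0_Hs T (s - 1 + \<epsilon>)) (C0_Hs_norm T (s - 1 + \<epsilon>))
            (mball_of (Hs_metric s) u0 r) (flow \<alpha> s T))"
proof -
  \<comment> \<open>As \<alpha> < 2, the quotient exceeds 2 and its ceiling is at least 3, so the
    hypothesis on s yields the threshold 5/2.\<close>
  have "2 < \<alpha> / (\<alpha> - 1)" using alpha by (simp add: less_divide_eq)
  then have "3 \<le> \<lceil>\<alpha> / (\<alpha> - 1)\<rceil>" by linarith
  then have "(3::real) \<le> of_int \<lceil>\<alpha> / (\<alpha> - 1)\<rceil>" by linarith
  then have s52: "5/2 < s" using s by linarith
  interpret dispersive_burgers \<alpha> s r T u0
  proof
    fix v0 assume "v0 \<in> mball_of (Hs_metric s) u0 r"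
    then show "\<exists>!v. is_solution \<alpha> s T v0 v"
      using C T unfolding well_posedness_constant_def by blast
  qed (fact alpha s52 r u0 T)+
  have T0: "0 \<le> T" using T by simp
  define X where "X = submetric (Hs_metric s) B"
  have BH: "B \<subseteq> Hs s" using B_iff by blast
  have X: "mspace X = B" "mdist X = (\<lambda>u v. Hs_norm s (u - v))"
    using BH by (auto simp: X_def Hs_metric_def)
  note Y = Metric_space.mspace_metric[OF Metric_space_C0_Hs[OF T0, of s], folded C0_Hs_metric_def]
    Metric_space.mdist_metric[OF Metric_space_C0_Hs[OF T0, of s], folded C0_Hs_metric_def]
  have dist: "mdist (C0_Hs_metric T s) (\<Phi> z) (\<Phi> w) = C0_Hs_norm T s (\<Phi> z - \<Phi> w)" if "z \<in> B" "w \<in> B" for z w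
    unfolding Y(2) using \<Phi>_in that by simp
  have "continuous_map (mtopology_of X) (mtopology_of (C0_Hs_metric T s)) \<Phi>"
    unfolding mtopology_of_def
    unfolding Metric_space.metric_continuous_map[OF Metric_space_mspace_mdist Metric_space_mspace_mdist]
    unfolding X(1) Y(1)
  proof (intro conjI ballI allI impI)
    show "\<Phi> ` B \<subseteq> C0_Hs T s" using \<Phi>_in by blast
    fix w e assume w: "w \<in> B" and e: "(0::real) < e"
    obtain d where d: "0 < d" "\<forall>z\<in>B. Hs_norm s (z - w) < d \<longrightarrow> C0_Hs_norm T s (\<Phi> z - \<Phi> w) \<le> e/2"
      using flow_continuous[OF w, of "e/2"] e by auto
    have "mdist (C0_Hs_metric T s) (\<Phi> w) (\<Phi> z) < e" if "z \<in> B" "mdist X w z < d" for z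
    proof -
      have "C0_Hs_norm T s (\<Phi> z - \<Phi> w) \<le> e/2"
        using d(2) that by (simp add: X(2) Hs_norm_minus_commute[of s z w])
      then show ?thesis using e unfolding mdist_commute[of _ "\<Phi> w"] dist[OF that(1) w] by simp
    qed
    then show "\<exists>d>0. \<forall>z. z \<in> B \<and> mdist X w z < d \<longrightarrow> mdist (C0_Hs_metric T s) (\<Phi> w) (\<Phi> z) < e"
      using d(1) by blast
  qed
  moreover have "\<not> uniformly_continuous_map X (C0_Hs_metric T s) \<Phi>"
  proof
    assume U: "uniformly_continuous_map X (C0_Hs_metric T s) \<Phi>"
    show False
    proof (rule not_uniformly_continuous)
      fix e :: real assume "0 < e"
      then obtain d where d: "0 < d" "\<forall>w\<in>B. \<forall>z\<in>B. mdist X z w < d \<longrightarrow> mdist (C0_Hs_metric T s) (\<Phi> z) (\<Phi> w) < e"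
        using U unfolding uniformly_continuous_map_def X(1) by blast
      then have "\<forall>z\<in>B. \<forall>w\<in>B. Hs_norm s (z - w) < d \<longrightarrow> C0_Hs_norm T s (\<Phi> z - \<Phi> w) < e"
        using dist unfolding X(2) by metis
      then show "\<exists>d>0. \<forall>z\<in>B. \<forall>w\<in>B. Hs_norm s (z - w) < d \<longrightarrow> C0_Hs_norm T s (\<Phi> z - \<Phi> w) < e"
        using d(1) by blast
    qed
  qed
  ultimately show ?thesis using not_C1 unfolding X_def by blast
qed

end
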